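(* (1) There exists an anti-stochastic graph property expressible in terms of the degree sequence such that $\Pr[\mathbf{G}_n\in A]=(2+o(1))/(n\ln n)$. (2) Every anti-stochastic graph property $A$ expressible in terms of the degree sequence satisfies $\Pr[\mathbf{G}_n\in A]\ge (1-o(1))/(n\ln n)$.
   Context: For each $n$, $\mathbf{G}_n$ denotes a graph chosen uniformly at random from all graphs on the vertex set $[n]=\{1,\dots,n\}$. A graph property $A$ is a sequence of sets $A_n$ of graphs on $[n]$; it is expressible in terms of the degree sequence if, for each $n$, whether a graph $G$ on $[n]$ belongs to $A_n$ depends only on the multiset of vertex degrees of $G$. An adversary is a function $f$ assigning to each graph $G$ on $[n]$ a graph $f(G)$ on $[n]$ such that $G$ and $f(G)$ differ in the adjacency of at most one pair of vertices. A property $A$ is anti-stochastic if $\Pr[\mathbf{G}_n\in A]=o(1)$ and there is an adversary $f$ with $\Pr[f(\mathbf{G}_n)\in A]=1-o(1)$, as $n\to\infty$. *)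

theory Defs
  imports "HOL-Probability.Probability" "HOL-Library.Multiset" "HOL-Library.Landau_Symbols"
begin

text \<open>A simple graph on \<^term>\<open>{1..n}\<close> is represented by its edge set, a set of
  two-element subsets of \<^term>\<open>{1..n}\<close>.\<close>

type_synonym graph = "nat set set"

definition graphs_on :: "nat \<Rightarrow> graph set" where
  "graphs_on n = Pow {e. e \<subseteq> {1..n} \<and> card e = 2}"

definition random_graph :: "nat \<Rightarrow> graph pmf" where
  "random_graph n = pmf_of_set (graphs_on n)"

definition vertex_degree :: "graph \<Rightarrow> nat \<Rightarrow> nat" where
  "vertex_degree G v = card {e \<in> G. v \<in> e}"

definition degree_multiset :: "nat \<Rightarrow> graph \<Rightarrow> nat multiset" where
  "degree_multiset n G = image_mset (vertex_degree G) (mset_set {1..n})"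

definition graph_property :: "(nat \<Rightarrow> graph set) \<Rightarrow> bool" where
  "graph_property A \<longleftrightarrow> (\<forall>n. A n \<subseteq> graphs_on n)"

definition degree_expressible :: "(nat \<Rightarrow> graph set) \<Rightarrow> bool" where
  "degree_expressible A \<longleftrightarrow>
     (\<forall>n. \<forall>G\<in>graphs_on n. \<forall>H\<in>graphs_on n.
        degree_multiset n G = degree_multiset n H \<longrightarrow> (G \<in> A n \<longleftrightarrow> H \<in> A n))"

text \<open>The index \<^term>\<open>n\<close> of an adversary is explicit because an edge set does not
  determine the vertex set.\<close>

definition adversary :: "(nat \<Rightarrow> graph \<Rightarrow> graph) \<Rightarrow> bool" where
  "adversary f \<longleftrightarrow>
     (\<forall>n. \<forall>G\<in>graphs_on n. f n G \<in> graphs_on n \<and> card (sym_diff G (f n G)) \<le> 1)"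

definition anti_stochastic :: "(nat \<Rightarrow> graph set) \<Rightarrow> bool" where
  "anti_stochastic A \<longleftrightarrow>
     (\<lambda>n. measure_pmf.prob (random_graph n) {G. G \<in> A n}) \<in> o(\<lambda>_. 1) \<and>
     (\<exists>f. adversary f \<and>
        (\<lambda>n. 1 - measure_pmf.prob (random_graph n) {G. f n G \<in> A n}) \<in> o(\<lambda>_. 1))"

end

theory Submission
  imports Defs "HOL-Real_Asymp.Real_Asymp"
begin

text \<open>
  Almost surely \<open>(1 + o(1)) * sqrt (n * ln n)\<close> different degrees occur, namely essentially all \<open>d\<close> with
  \<open>\<bar>d - n / 2\<bar> \<le> sqrt (n * ln n) / 2\<close>. Flipping an edge moves two vertices to a neighbouring degree, so a degree
  multiset has about \<open>n * ln n\<close> neighbours: \<open>n * ln n / 2\<close> pairs of degrees, each raised or lowered.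

  Lower bound. If adding an edge between vertices of degrees \<open>i\<close> and \<open>j\<close> leads into \<open>A\<close>, then so does every
  switching that raises a vertex of degree \<open>i\<close> and one of degree \<open>j\<close>. Counting switchings in both directions, the
  weight that a graph of \<open>A\<close> receives is \<open>(1 + o(1)) * (\<Sum>i\<le>j. r i * r j)\<close>, where \<open>r i\<close> is about the ratio of the
  numbers of vertices of degrees \<open>i + 1\<close> and \<open>i\<close>, and almost surely \<open>(\<Sum>i. r i) \<le> (1 + o(1)) * sqrt (n * ln n)\<close>.
  Passing to complements handles the removal of edges.

  Construction. With \<open>m\<close> about \<open>sqrt (n * ln n) / 2\<close>, a potential \<open>\<Sum>v. g (deg v)\<close> is chosen such that adding or
  removing an edge between suitable degrees changes it by every integer of absolute value less than \<open>m\<^sup>2\<close>; so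
  all residues modulo \<open>2 * m\<^sup>2 - 1\<close> can be reached, and some residue class is as rare as the average and almost
  surely reachable. Graphs with very few edges are added to adjust the probability.
\<close>

text \<open>The scale: at distance t from n / 2 the expected number of vertices of a given degree
  is, up to a constant, \<open>sqrt n * exp (- 2 * t^2 / n)\<close>, which falls to order 1 near t =
  \<open>sqrt (n * ln n) / 2\<close>. The gap between the two constants: with D the number of
  degrees that occur, the lower bound allows all unordered types, D^2 / 2 for additions and as many
  for removals, D^2 in all. The construction only combines a degree of the lower half with one of
  the upper half, so it has D^2 / 4 moves in either direction and about D^2 / 2 residues. The
  obstacle in the lower bound: which type of move succeeds may depend on the graph in any way, so
  all types must be summed at the receiving graph, and near the ends of the window degree counts
  stay bounded and do not concentrate. Hence only the sum of the ratios is controlled: by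
  concentration well inside the window, by a bounded expected ratio at the few border degrees, and
  by the small number of vertices beyond.\<close>

definition edges_on :: "nat \<Rightarrow> nat set set" where
  "edges_on n = {e. e \<subseteq> {1..n} \<and> card e = 2}"

lemma graphs_on_eq: "graphs_on n = Pow (edges_on n)"
  by (simp add: graphs_on_def edges_on_def)

lemma finite_edges_on [simp]: "finite (edges_on n)"
  by (rule finite_subset[of _ "Pow {1..n}"]) (auto simp: edges_on_def)

lemma finite_graphs_on [simp]: "finite (graphs_on n)"
  by (simp add: graphs_on_eq)

lemma card_edges_on: "card (edges_on n) = n choose 2"
  using n_subsets[of "{1..n}" 2] by (simp add: edges_on_def)

lemma card_graphs_on: "card (graphs_on n) = 2 ^ (n choose 2)"
  by (simp add: graphs_on_eq card_Pow card_edges_on)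

lemma graphs_on_finite: "G \<in> graphs_on n \<Longrightarrow> finite G"
  unfolding graphs_on_eq using finite_subset[OF _ finite_edges_on] by auto

lemma edges_onE:
  assumes "e \<in> edges_on n"
  obtains u v where "e = {u, v}" "u \<noteq> v" "u \<in> {1..n}" "v \<in> {1..n}"
  using assms unfolding edges_on_def card_2_iff by auto

lemma doubleton_in_edges_on: "{u, v} \<in> edges_on n \<longleftrightarrow> u \<noteq> v \<and> u \<in> {1..n} \<and> v \<in> {1..n}"
  by (auto simp: edges_on_def card_insert_if)

subsection \<open>Averages over all graphs\<close>

definition avg :: "nat \<Rightarrow> (graph \<Rightarrow> real) \<Rightarrow> real" where
  "avg n f = (\<Sum>G\<in>graphs_on n. f G) / 2 ^ (n choose 2)"

definition pr :: "nat \<Rightarrow> (graph \<Rightarrow> bool) \<Rightarrow> real" where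
  "pr n P = avg n (\<lambda>G. of_bool (P G))"

lemma pr_eq_card: "pr n P = card {G \<in> graphs_on n. P G} / 2 ^ (n choose 2)"
  by (simp add: pr_def avg_def of_bool_def sum.If_cases Int_def)

lemma prob_random_graph: "measure_pmf.prob (random_graph n) {G. P G} = pr n P"
proof -
  have "graphs_on n \<noteq> {}" by (auto simp: graphs_on_eq)
  then show ?thesis
    by (simp add: random_graph_def measure_pmf_of_set pr_eq_card card_graphs_on Int_def)
qed

lemma avg_mono: "(\<And>G. G \<in> graphs_on n \<Longrightarrow> f G \<le> g G) \<Longrightarrow> avg n f \<le> avg n g"
  unfolding avg_def by (intro divide_right_mono sum_mono) auto

lemma avg_cong: "(\<And>G. G \<in> graphs_on n \<Longrightarrow> f G = g G) \<Longrightarrow> avg n f = avg n g"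
  unfolding avg_def by (metis (mono_tags, lifting) sum.cong)

lemma avg_const [simp]: "avg n (\<lambda>_. c) = c"
  by (simp add: avg_def card_graphs_on)

lemma avg_nonneg: "(\<And>G. G \<in> graphs_on n \<Longrightarrow> 0 \<le> f G) \<Longrightarrow> 0 \<le> avg n f"
  using avg_mono[of n "\<lambda>_. 0" f] by simp

lemma avg_add: "avg n (\<lambda>G. f G + g G) = avg n f + avg n g"
  by (simp add: avg_def sum.distrib add_divide_distrib)

lemma avg_diff: "avg n (\<lambda>G. f G - g G) = avg n f - avg n g"
  by (simp add: avg_def sum_subtractf diff_divide_distrib)

lemma avg_cmult: "avg n (\<lambda>G. c * f G) = c * avg n f"
  by (simp add: avg_def sum_distrib_left)

lemma avg_sum: "avg n (\<lambda>G. \<Sum>i\<in>I. f i G) = (\<Sum>i\<in>I. avg n (f i))"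
  unfolding avg_def by (subst sum.swap) (simp add: sum_divide_distrib)

text \<open>Nonnegativity of the variance; it turns second moments into bounds on mean absolute
  deviations.\<close>

lemma avg_power2_le: "(avg n f)\<^sup>2 \<le> avg n (\<lambda>G. (f G)\<^sup>2)"
proof -
  define m where "m = avg n f"
  have "0 \<le> avg n (\<lambda>G. (f G - m)\<^sup>2)" by (rule avg_nonneg) simp
  also have "(\<lambda>G. (f G - m)\<^sup>2) = (\<lambda>G. (f G)\<^sup>2 - (2 * m) * f G + m\<^sup>2)"
    by (auto simp: power2_eq_square algebra_simps)
  also have "avg n \<dots> = avg n (\<lambda>G. (f G)\<^sup>2) - 2 * m * m + m\<^sup>2"
    unfolding avg_add avg_diff avg_cmult m_def by simp
  finally show ?thesis by (simp add: m_def power2_eq_square)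
qed

lemma pr_nonneg [simp]: "0 \<le> pr n P"
  by (simp add: pr_eq_card)

lemma pr_mono: "(\<And>G. G \<in> graphs_on n \<Longrightarrow> P G \<Longrightarrow> Q G) \<Longrightarrow> pr n P \<le> pr n Q"
  unfolding pr_def by (rule avg_mono) auto

lemma pr_cong: "(\<And>G. G \<in> graphs_on n \<Longrightarrow> P G = Q G) \<Longrightarrow> pr n P = pr n Q"
  unfolding pr_def by (rule avg_cong) auto

lemma pr_True [simp]: "pr n (\<lambda>_. True) = 1"
  by (simp add: pr_def)

lemma pr_False [simp]: "pr n (\<lambda>_. False) = 0"
  by (simp add: pr_def)

lemma pr_le_1: "pr n P \<le> 1"
  using pr_mono[of n P "\<lambda>_. True"] by simp

lemma pr_not: "pr n (\<lambda>G. \<not> P G) = 1 - pr n P"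
proof -
  have "pr n (\<lambda>G. \<not> P G) = avg n (\<lambda>G. 1 - of_bool (P G))"
    unfolding pr_def by (rule avg_cong) auto
  then show ?thesis unfolding avg_diff by (simp add: pr_def)
qed

lemma pr_disj_le: "pr n (\<lambda>G. P G \<or> Q G) \<le> pr n P + pr n Q"
  unfolding pr_def avg_add[symmetric] by (rule avg_mono) auto

lemma pr_Bex_le: "finite I \<Longrightarrow> pr n (\<lambda>G. \<exists>i\<in>I. P i G) \<le> (\<Sum>i\<in>I. pr n (P i))"
proof (induction I rule: finite_induct)
  case (insert x F)
  have "pr n (\<lambda>G. \<exists>i\<in>insert x F. P i G) \<le> pr n (P x) + pr n (\<lambda>G. \<exists>i\<in>F. P i G)"
    using pr_disj_le[of n "P x" "\<lambda>G. \<exists>i\<in>F. P i G"] by simp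
  then show ?case using insert by simp
qed simp

lemma pr_markov:
  assumes "\<And>G. G \<in> graphs_on n \<Longrightarrow> 0 \<le> f G" "0 < t"
  shows "pr n (\<lambda>G. t \<le> f G) \<le> avg n f / t"
proof -
  have "t * pr n (\<lambda>G. t \<le> f G) \<le> avg n f"
    unfolding pr_def avg_cmult[symmetric] by (rule avg_mono) (use assms in auto)
  then show ?thesis using assms(2) by (simp add: field_simps)
qed

lemma pr_chebyshev:
  assumes "0 < t"
  shows "pr n (\<lambda>G. t \<le> \<bar>f G - m\<bar>) \<le> avg n (\<lambda>G. (f G - m)\<^sup>2) / t\<^sup>2"
proof -
  have "pr n (\<lambda>G. t \<le> \<bar>f G - m\<bar>) \<le> pr n (\<lambda>G. t\<^sup>2 \<le> (f G - m)\<^sup>2)"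
    by (rule pr_mono) (use assms in \<open>auto simp: abs_le_square_iff[symmetric]\<close>)
  also have "\<dots> \<le> avg n (\<lambda>G. (f G - m)\<^sup>2) / t\<^sup>2"
    by (rule pr_markov) (use assms in auto)
  finally show ?thesis .
qed

text \<open>Complementation permutes the graphs; later it turns statements about adding edges into
  statements about removing them.\<close>

lemma avg_compl: "avg n (\<lambda>G. f (edges_on n - G)) = avg n f"
proof -
  have "bij_betw (\<lambda>G. edges_on n - G) (graphs_on n) (graphs_on n)"
    by (rule bij_betw_byWitness[where f' = "\<lambda>G. edges_on n - G"]) (auto simp: graphs_on_eq)
  from sum.reindex_bij_betw[OF this, of f] show ?thesis by (simp add: avg_def)
qed

lemma pr_compl: "pr n (\<lambda>G. P (edges_on n - G)) = pr n P"
  unfolding pr_def by (rule avg_compl[of n "\<lambda>G. of_bool (P G)"])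

subsection \<open>Independence of disjoint edge sets\<close>

lemma sum_Pow_Un:
  assumes "finite S" "finite R" "S \<inter> R = {}"
  shows "(\<Sum>G\<in>Pow (S \<union> R). f G) = (\<Sum>A\<in>Pow S. \<Sum>B\<in>Pow R. f (A \<union> B))"
proof -
  have "bij_betw (\<lambda>(A, B). A \<union> B) (Pow S \<times> Pow R) (Pow (S \<union> R))"
    by (rule bij_betw_byWitness[where f' = "\<lambda>G. (G \<inter> S, G \<inter> R)"]) (use assms in auto)
  from sum.reindex_bij_betw[OF this, of f, symmetric] show ?thesis
    by (simp add: sum.cartesian_product case_prod_unfold)
qed

text \<open>Distributivity, in the form in which independence is used: a subset of a disjoint union
  is a free choice of a subset of each block.\<close>

lemma sum_Pow_UN_prod:
  fixes h :: "'i \<Rightarrow> 'a set \<Rightarrow> real"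
  assumes "finite S" "\<And>v. v \<in> S \<Longrightarrow> finite (T v)" "disjoint_family_on T S"
  shows "(\<Sum>B\<in>Pow (\<Union>v\<in>S. T v). \<Prod>v\<in>S. h v (B \<inter> T v)) = (\<Prod>v\<in>S. \<Sum>B\<in>Pow (T v). h v B)"
  using assms
proof (induction S rule: finite_induct)
  case (insert x F)
  have dj: "T x \<inter> (\<Union>v\<in>F. T v) = {}"
    using insert.prems(2) insert.hyps(2) unfolding disjoint_family_on_def by auto
  have dj': "T x \<inter> T v = {}" if "v \<in> F" for v using dj that by auto
  have "(\<Sum>B\<in>Pow (\<Union>v\<in>insert x F. T v). \<Prod>v\<in>insert x F. h v (B \<inter> T v))
      = (\<Sum>A\<in>Pow (T x). \<Sum>B\<in>Pow (\<Union>v\<in>F. T v). \<Prod>v\<in>insert x F. h v ((A \<union> B) \<inter> T v))"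
    using sum_Pow_Un[OF _ _ dj, of "\<lambda>B. \<Prod>v\<in>insert x F. h v (B \<inter> T v)"] insert by simp
  also have "\<dots> = (\<Sum>A\<in>Pow (T x). \<Sum>B\<in>Pow (\<Union>v\<in>F. T v). h x A * (\<Prod>v\<in>F. h v (B \<inter> T v)))"
  proof (intro sum.cong refl)
    fix A B assume "A \<in> Pow (T x)" "B \<in> Pow (\<Union>v\<in>F. T v)"
    then have "(A \<union> B) \<inter> T x = A" "\<And>v. v \<in> F \<Longrightarrow> (A \<union> B) \<inter> T v = B \<inter> T v"
      using dj dj' by blast+
    then show "(\<Prod>v\<in>insert x F. h v ((A \<union> B) \<inter> T v)) = h x A * (\<Prod>v\<in>F. h v (B \<inter> T v))"
      using insert.hyps by simp
  qed
  also have "\<dots> = (\<Sum>A\<in>Pow (T x). h x A) * (\<Sum>B\<in>Pow (\<Union>v\<in>F. T v). \<Prod>v\<in>F. h v (B \<inter> T v))"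
    by (simp add: sum_product)
  also have "\<dots> = (\<Prod>v\<in>insert x F. \<Sum>B\<in>Pow (T v). h v B)"
    using insert by (simp add: disjoint_family_on_mono[OF subset_insertI])
  finally show ?case .
qed simp

text \<open>The probability that a symmetric binomial variable with \<open>N\<close> trials takes
  the value \<open>k\<close>; it vanishes for \<open>k > N\<close>.\<close>

definition bp :: "nat \<Rightarrow> nat \<Rightarrow> real" where
  "bp N k = real (N choose k) / 2 ^ N"

definition star :: "nat \<Rightarrow> nat set \<Rightarrow> nat \<Rightarrow> nat set set" where
  "star n S v = (\<lambda>w. {v, w}) ` ({1..n} - S)"

definition inner_degree :: "nat set \<Rightarrow> graph \<Rightarrow> nat \<Rightarrow> nat" where
  "inner_degree S G v = card {e \<in> G. v \<in> e \<and> e \<subseteq> S}"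

lemma star_subset: "S \<subseteq> {1..n} \<Longrightarrow> v \<in> S \<Longrightarrow> star n S v \<subseteq> edges_on n"
  by (auto simp: star_def doubleton_in_edges_on)

lemma finite_star [simp]: "finite (star n S v)"
  by (simp add: star_def)

lemma card_star: "S \<subseteq> {1..n} \<Longrightarrow> v \<in> S \<Longrightarrow> card (star n S v) = n - card S"
proof -
  assume *: "S \<subseteq> {1..n}" "v \<in> S"
  have "inj_on (\<lambda>w. {v, w}) ({1..n} - S)"
    using * by (intro inj_onI) (auto simp: doubleton_eq_iff)
  then show ?thesis using * by (simp add: star_def card_image card_Diff_subset finite_subset)
qed

lemma disjoint_star: "disjoint_family_on (star n S) S"
  unfolding disjoint_family_on_def star_def by (auto simp: doubleton_eq_iff)

lemma vertex_degree_split: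
  assumes "G \<in> graphs_on n" "S \<subseteq> {1..n}" "v \<in> S"
  shows "vertex_degree G v = card (G \<inter> star n S v) + inner_degree S G v"
proof -
  have "{e \<in> G. v \<in> e} = (G \<inter> star n S v) \<union> {e \<in> G. v \<in> e \<and> e \<subseteq> S}"
  proof (intro equalityI subsetI)
    fix e assume e: "e \<in> {e \<in> G. v \<in> e}"
    then have "e \<in> edges_on n" using assms by (auto simp: graphs_on_eq)
    then obtain a b where "e = {a, b}" "a \<noteq> b" "a \<in> {1..n}" "b \<in> {1..n}" by (rule edges_onE)
    then obtain w where "e = {v, w}" "w \<in> {1..n}" using e by auto
    then show "e \<in> (G \<inter> star n S v) \<union> {e \<in> G. v \<in> e \<and> e \<subseteq> S}"
      using e assms by (cases "w \<in> S") (auto simp: star_def)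
  qed (auto simp: star_def)
  moreover have "(G \<inter> star n S v) \<inter> {e \<in> G. v \<in> e \<and> e \<subseteq> S} = {}"
    by (auto simp: star_def)
  ultimately show ?thesis
    unfolding vertex_degree_def inner_degree_def
    using card_Un_disjoint[of "G \<inter> star n S v" "{e \<in> G. v \<in> e \<and> e \<subseteq> S}"] graphs_on_finite[OF assms(1)]
    by simp
qed

text \<open>The stars from the vertices of \<open>S\<close> to the outside are disjoint. Once all
  other edges are fixed, the outside degrees are therefore independent binomial variables with
  \<open>n - card S\<close> trials. \<open>F\<close> may only look at edges inside \<open>S\<close>,
  and these are fixed together with the rest.\<close>

lemma joint_degrees:
  assumes S: "S \<subseteq> {1..n}"
    and F: "\<And>G H. G \<in> graphs_on n \<Longrightarrow> H \<in> graphs_on n \<Longrightarrow> G \<inter> Pow S = H \<inter> Pow S \<Longrightarrow> F G = F H"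
  shows "pr n (\<lambda>G. F G \<and> (\<forall>v\<in>S. vertex_degree G v = k v)) =
    avg n (\<lambda>G. of_bool (F G) * (\<Prod>v\<in>S. if inner_degree S G v \<le> k v
         then bp (n - card S) (k v - inner_degree S G v) else 0))"
proof -
  let ?T = "star n S" and ?d = "inner_degree S"
  \<comment> \<open>\<open>C\<close> holds the edges inside \<open>S\<close> and the edges disjoint
    from \<open>S\<close>.\<close>
  define C where "C = edges_on n - (\<Union>v\<in>S. ?T v)"
  let ?R = "\<Union>v\<in>S. ?T v"
  have finS: "finite S" using S finite_subset by auto
  have R: "?R \<subseteq> edges_on n" using star_subset[OF S] by blast
  have E: "edges_on n = C \<union> ?R" "C \<inter> ?R = {}" using R by (auto simp: C_def)
  have fin: "finite C" "finite ?R" by (auto simp: C_def finS)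
  have inS: "(A \<union> B) \<inter> Pow S = A \<inter> Pow S" if "A \<subseteq> C" "B \<subseteq> ?R" for A B
    using that by (auto simp: star_def)
  have d_eq: "?d (A \<union> B) v = ?d A v" if "A \<subseteq> C" "B \<subseteq> ?R" for A B v
  proof -
    have "{e \<in> A \<union> B. v \<in> e \<and> e \<subseteq> S} = {e \<in> A. v \<in> e \<and> e \<subseteq> S}"
      using inS[OF that] by blast
    then show ?thesis by (simp add: inner_degree_def)
  qed
  have F_eq: "F (A \<union> B) = F A" if "A \<subseteq> C" "B \<subseteq> ?R" for A B
    by (rule F) (use that inS[OF that] E in \<open>auto simp: graphs_on_eq\<close>)
  have deg: "vertex_degree (A \<union> B) v = card (B \<inter> ?T v) + ?d A v"
    if "A \<subseteq> C" "B \<subseteq> ?R" "v \<in> S" for A B v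
  proof -
    have "A \<union> B \<in> graphs_on n" using that E by (auto simp: graphs_on_eq)
    from vertex_degree_split[OF this S that(3)]
    have "vertex_degree (A \<union> B) v = card ((A \<union> B) \<inter> ?T v) + ?d A v" using d_eq that by simp
    moreover have "(A \<union> B) \<inter> ?T v = B \<inter> ?T v" using that E by blast
    ultimately show ?thesis by simp
  qed
  have cnt: "(\<Sum>B\<in>Pow ?R. \<Prod>v\<in>S. of_bool (card (B \<inter> ?T v) + ?d A v = k v))
     = (\<Sum>B\<in>Pow ?R. \<Prod>v\<in>S. if ?d A v \<le> k v then bp (n - card S) (k v - ?d A v) else 0)" for A
  proof -
    have "(\<Sum>B\<in>Pow ?R. \<Prod>v\<in>S. of_bool (card (B \<inter> ?T v) + ?d A v = k v)) =
      (\<Prod>v\<in>S. \<Sum>B\<in>Pow (?T v). (of_bool (card B + ?d A v = k v) :: real))"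
      by (rule sum_Pow_UN_prod[OF finS _ disjoint_star]) auto
    also have "\<dots> = (\<Prod>v\<in>S. \<Sum>B\<in>Pow (?T v). if ?d A v \<le> k v then bp (n - card S) (k v - ?d A v) else 0)"
    proof (rule prod.cong[OF refl])
      fix v assume v: "v \<in> S"
      have "(\<Sum>B\<in>Pow (?T v). (of_bool (card B + ?d A v = k v) :: real)) =
        (if ?d A v \<le> k v then real (card {B. B \<subseteq> ?T v \<and> card B = k v - ?d A v}) else 0)"
      proof (cases "?d A v \<le> k v")
        case True
        then have "{B \<in> Pow (?T v). card B + ?d A v = k v} = {B. B \<subseteq> ?T v \<and> card B = k v - ?d A v}"
          by auto
        then show ?thesis using True by (simp add: of_bool_def sum.If_cases Int_def)
      qed (auto intro!: sum.neutral)
      also have "\<dots> = (\<Sum>B\<in>Pow (?T v). if ?d A v \<le> k v then bp (n - card S) (k v - ?d A v) else 0)"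
        using card_star[OF S v] by (simp add: n_subsets card_Pow bp_def)
      finally show "(\<Sum>B\<in>Pow (?T v). (of_bool (card B + ?d A v = k v) :: real)) = \<dots>" .
    qed
    also have "\<dots> = (\<Sum>B\<in>Pow ?R. \<Prod>v\<in>S. if ?d A v \<le> k v then bp (n - card S) (k v - ?d A v) else 0)"
      by (rule sum_Pow_UN_prod[OF finS _ disjoint_star, symmetric]) auto
    finally show ?thesis .
  qed
  have "(\<Sum>G\<in>graphs_on n. of_bool (F G \<and> (\<forall>v\<in>S. vertex_degree G v = k v)) :: real) =
    (\<Sum>A\<in>Pow C. \<Sum>B\<in>Pow ?R. of_bool (F (A \<union> B) \<and> (\<forall>v\<in>S. vertex_degree (A \<union> B) v = k v)))"
    unfolding graphs_on_eq E(1) by (rule sum_Pow_Un[OF fin E(2)])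
  also have "\<dots> = (\<Sum>A\<in>Pow C. \<Sum>B\<in>Pow ?R. of_bool (F A) *
      (\<Prod>v\<in>S. of_bool (card (B \<inter> ?T v) + ?d A v = k v)))"
    by (intro sum.cong refl) (use F_eq deg finS in \<open>auto intro!: prod.neutral\<close>)
  also have "\<dots> = (\<Sum>A\<in>Pow C. \<Sum>B\<in>Pow ?R. of_bool (F A) *
      (\<Prod>v\<in>S. if ?d A v \<le> k v then bp (n - card S) (k v - ?d A v) else 0))"
    by (simp only: sum_distrib_left[symmetric] cnt)
  also have "\<dots> = (\<Sum>A\<in>Pow C. \<Sum>B\<in>Pow ?R. of_bool (F (A \<union> B)) *
      (\<Prod>v\<in>S. if ?d (A \<union> B) v \<le> k v then bp (n - card S) (k v - ?d (A \<union> B) v) else 0))"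
    by (intro sum.cong refl arg_cong2[where f = "(*)"] prod.cong) (auto simp: F_eq d_eq)
  also have "\<dots> = (\<Sum>G\<in>graphs_on n. of_bool (F G) *
      (\<Prod>v\<in>S. if ?d G v \<le> k v then bp (n - card S) (k v - ?d G v) else 0))"
    unfolding graphs_on_eq E(1) by (rule sum_Pow_Un[OF fin E(2), symmetric])
  finally show ?thesis unfolding pr_def avg_def by simp
qed

text \<open>For events \<open>F\<close> that leave the inner degrees open: each binomial factor is
  bounded over all inner degrees compatible with \<open>F\<close>.\<close>

lemma joint_degrees_le:
  assumes S: "S \<subseteq> {1..n}"
    and F: "\<And>G H. G \<in> graphs_on n \<Longrightarrow> H \<in> graphs_on n \<Longrightarrow> G \<inter> Pow S = H \<inter> Pow S \<Longrightarrow> F G = F H"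
    and B: "\<And>G v. G \<in> graphs_on n \<Longrightarrow> F G \<Longrightarrow> v \<in> S \<Longrightarrow> inner_degree S G v \<le> k v \<Longrightarrow>
      bp (n - card S) (k v - inner_degree S G v) \<le> B v"
    and B0: "\<And>v. v \<in> S \<Longrightarrow> 0 \<le> B v"
  shows "pr n (\<lambda>G. F G \<and> (\<forall>v\<in>S. vertex_degree G v = k v)) \<le> pr n F * (\<Prod>v\<in>S. B v)"
proof -
  let ?q = "\<Prod>v\<in>S. B v"
  have "pr n (\<lambda>G. F G \<and> (\<forall>v\<in>S. vertex_degree G v = k v)) \<le> avg n (\<lambda>G. (\<Prod>v\<in>S. B v) * of_bool (F G))"
  proof (subst joint_degrees[OF S, of F k])
    show "F G = F H" if "G \<in> graphs_on n" "H \<in> graphs_on n" "G \<inter> Pow S = H \<inter> Pow S" for G H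
      using F that .
  next
    show "avg n (\<lambda>G. of_bool (F G) * (\<Prod>v\<in>S. if inner_degree S G v \<le> k v
         then bp (n - card S) (k v - inner_degree S G v) else 0)) \<le> avg n (\<lambda>G. ?q * of_bool (F G))"
    proof (rule avg_mono)
      fix G assume G: "G \<in> graphs_on n"
      have "(\<Prod>v\<in>S. if inner_degree S G v \<le> k v
           then bp (n - card S) (k v - inner_degree S G v) else 0) \<le> (\<Prod>v\<in>S. B v)" if "F G"
        by (rule prod_mono) (use B[OF G that] B0 in \<open>auto simp: bp_def\<close>)
      then show "of_bool (F G) * (\<Prod>v\<in>S. if inner_degree S G v \<le> k v
           then bp (n - card S) (k v - inner_degree S G v) else 0) \<le> (\<Prod>v\<in>S. B v) * of_bool (F G)"
        by (cases "F G") auto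
    qed
  qed
  then show ?thesis unfolding avg_cmult pr_def by (simp add: mult.commute)
qed

text \<open>When \<open>F\<close> fixes all inner degrees, the event decouples exactly from the
  degrees; applied to one or two vertices.\<close>

lemma joint_degrees_eq:
  assumes S: "S \<subseteq> {1..n}"
    and F: "\<And>G H. G \<in> graphs_on n \<Longrightarrow> H \<in> graphs_on n \<Longrightarrow> G \<inter> Pow S = H \<inter> Pow S \<Longrightarrow> F G = F H"
    and d: "\<And>G v. G \<in> graphs_on n \<Longrightarrow> F G \<Longrightarrow> v \<in> S \<Longrightarrow> inner_degree S G v = d"
    and dk: "\<And>v. v \<in> S \<Longrightarrow> d \<le> k v"
  shows "pr n (\<lambda>G. F G \<and> (\<forall>v\<in>S. vertex_degree G v = k v)) =
    pr n F * (\<Prod>v\<in>S. bp (n - card S) (k v - d))"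
proof -
  let ?q = "\<Prod>v\<in>S. bp (n - card S) (k v - d)"
  have "pr n (\<lambda>G. F G \<and> (\<forall>v\<in>S. vertex_degree G v = k v)) =
      avg n (\<lambda>G. (\<Prod>v\<in>S. bp (n - card S) (k v - d)) * of_bool (F G))"
  proof (subst joint_degrees[OF S, of F k])
    show "F G = F H" if "G \<in> graphs_on n" "H \<in> graphs_on n" "G \<inter> Pow S = H \<inter> Pow S" for G H
      using F that .
  next
    show "avg n (\<lambda>G. of_bool (F G) * (\<Prod>v\<in>S. if inner_degree S G v \<le> k v
         then bp (n - card S) (k v - inner_degree S G v) else 0)) = avg n (\<lambda>G. ?q * of_bool (F G))"
    proof (rule avg_cong)
      fix G assume G: "G \<in> graphs_on n"
      have "(\<Prod>v\<in>S. if inner_degree S G v \<le> k v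
           then bp (n - card S) (k v - inner_degree S G v) else 0) = (\<Prod>v\<in>S. bp (n - card S) (k v - d))" if "F G"
        by (rule prod.cong) (use d[OF G that] dk in auto)
      then show "of_bool (F G) * (\<Prod>v\<in>S. if inner_degree S G v \<le> k v
           then bp (n - card S) (k v - inner_degree S G v) else 0) =
           (\<Prod>v\<in>S. bp (n - card S) (k v - d)) * of_bool (F G)"
        by (cases "F G") auto
    qed
  qed
  then show ?thesis unfolding avg_cmult pr_def by (simp add: mult.commute)
qed

lemma pr_avoid_edges:
  assumes "K \<subseteq> edges_on n"
  shows "pr n (\<lambda>G. G \<inter> K = {}) = 1 / 2 ^ card K"
proof -
  have "{G \<in> graphs_on n. G \<inter> K = {}} = Pow (edges_on n - K)" by (auto simp: graphs_on_eq)
  moreover have "card (edges_on n - K) = (n choose 2) - card K"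
    using assms by (simp add: card_Diff_subset finite_subset card_edges_on)
  moreover have "card K \<le> n choose 2" using assms card_mono[OF finite_edges_on] card_edges_on by metis
  ultimately show ?thesis by (simp add: pr_eq_card card_Pow power_diff real_of_nat_div le_imp_power_dvd)
qed

subsection \<open>Binomial probabilities\<close>

lemma bp_nonneg [simp]: "0 \<le> bp N k"
  by (simp add: bp_def)

lemma sum_bp_le_1: "finite A \<Longrightarrow> (\<Sum>k\<in>A. bp N k) \<le> 1"
proof -
  assume "finite A"
  have "(\<Sum>k\<in>A. bp N k) = (\<Sum>k\<in>A \<inter> {..N}. bp N k)"
    by (rule sum.mono_neutral_right) (use \<open>finite A\<close> in \<open>auto simp: bp_def binomial_eq_0\<close>)
  also have "\<dots> \<le> (\<Sum>k\<le>N. bp N k)" by (rule sum_mono2) auto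
  also have "\<dots> = real (\<Sum>k\<le>N. N choose k) / 2 ^ N" by (simp add: bp_def sum_divide_distrib)
  also have "\<dots> = 1" by (simp only: choose_row_sum) simp
  finally show ?thesis .
qed

text \<open>Hoeffding's inequality, imported through the binomial distribution with success
  probability 1 / 2.\<close>

lemma bp_tail:
  assumes "0 < N" "0 \<le> t"
  shows "(\<Sum>k | k \<le> N \<and> t \<le> \<bar>real k - real N / 2\<bar>. bp N k) \<le> 2 * exp (- 2 * t\<^sup>2 / real N)"
proof -
  interpret binomial_distribution N "1/2" by unfold_locales simp
  let ?A = "{k. k \<le> N \<and> t \<le> \<bar>real k - real N / 2\<bar>}"
  have "(\<Sum>k\<in>?A. bp N k) = (\<Sum>k\<in>?A. pmf (binomial_pmf N (1/2)) k)"
    by (rule sum.cong) (auto simp: bp_def power_add[symmetric] field_simps)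
  also have "\<dots> = measure_pmf.prob (binomial_pmf N (1/2)) ?A"
    by (subst measure_measure_pmf_finite) auto
  also have "\<dots> \<le> measure_pmf.prob (binomial_pmf N (1/2)) {x. t \<le> \<bar>real x - real N * (1/2)\<bar>}"
    by (rule measure_pmf.finite_measure_mono) auto
  also have "\<dots> \<le> 2 * exp (- 2 * t\<^sup>2 / real N)"
    by (rule prob_abs_ge) (use assms in auto)
  finally show ?thesis .
qed

lemma bp_le_exp:
  assumes "0 < N" "0 \<le> t" "t \<le> \<bar>real k - real N / 2\<bar>"
  shows "bp N k \<le> 2 * exp (- 2 * t\<^sup>2 / real N)"
proof (cases "k \<le> N")
  case True
  have "bp N k = (\<Sum>k\<in>{k}. bp N k)" by simp
  also have "\<dots> \<le> (\<Sum>k | k \<le> N \<and> t \<le> \<bar>real k - real N / 2\<bar>. bp N k)"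
    by (rule sum_mono2) (use assms True in auto)
  finally show ?thesis using bp_tail[OF assms(1,2)] by simp
qed (simp add: bp_def binomial_eq_0)

text \<open>The quotient of consecutive binomial coefficients, cleared of denominators and with the
  subtraction in the reals, so that no condition on \<open>k\<close> is needed.\<close>

lemma bp_Suc_mult: "bp N (Suc k) * real (Suc k) = bp N k * (real N - real k)"
proof (cases "k \<le> N")
  case True
  have "(N choose Suc k) * Suc k = (N choose k) * (N - k)"
    using binomial_absorb_comp[of N k] binomial_absorption[of k N]
    by (metis Suc_times_binomial_eq binomial_absorb_comp mult.commute)
  then have "real (N choose Suc k) * real (Suc k) = real (N choose k) * real (N - k)"
    by (metis of_nat_mult)
  then show ?thesis using True by (simp add: bp_def of_nat_diff)
qed (simp add: bp_def binomial_eq_0)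

lemma bp_Suc_Suc: "bp (Suc N) (Suc k) = (bp N k + bp N (Suc k)) / 2"
  by (simp add: bp_def field_simps)

lemma bp_Suc_0: "bp (Suc N) 0 = bp N 0 / 2"
  by (simp add: bp_def)

lemma central_step: "bp (2 * Suc m) (Suc m) * (2 * real m + 2) = bp (2 * m) m * (2 * real m + 1)"
proof -
  have "Suc m * (Suc (2 * m) choose Suc m) = Suc (2 * m) * (2 * m choose m)"
    by (metis Suc_times_binomial_eq mult.commute)
  moreover have "Suc m * (2 * Suc m choose Suc m) = 2 * Suc m * (Suc (2 * m) choose m)"
    using Suc_times_binomial_eq[of "Suc (2 * m)" m] by (simp add: algebra_simps)
  moreover have "(Suc (2 * m) choose m) = (Suc (2 * m) choose Suc m)"
    using binomial_symmetric[of m "Suc (2 * m)"] by (simp add: Suc_diff_le)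
  ultimately have "Suc m * (2 * Suc m choose Suc m) = 2 * Suc (2 * m) * (2 * m choose m)"
    by (simp only: mult.assoc)
  then have "real (Suc m) * real (2 * Suc m choose Suc m) = 2 * real (Suc (2 * m)) * real (2 * m choose m)"
    by (metis (no_types, lifting) of_nat_mult of_nat_numeral)
  then have Z: "(real m + 1) * real (2 * Suc m choose Suc m) = 2 * (2 * real m + 1) * real (2 * m choose m)"
    by (simp only: of_nat_Suc of_nat_mult of_nat_numeral) (simp add: algebra_simps)
  have P: "(2::real) ^ (2 * Suc m) = 4 * 2 ^ (2 * m)" by simp
  have "Z / (4 * P) * (2 * x + 2) = c / P * (2 * x + 1)" if "(x + 1) * Z = 2 * (2 * x + 1) * c" "P > 0"
    for Z P x c :: real using that by (simp add: divide_simps) algebra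
  from this[OF Z, of "2 ^ (2 * m)"] show ?thesis unfolding bp_def P by simp
qed

text \<open>The product decreases in \<open>m\<close>: by \<open>central_step\<close> its quotient
  is \<open>sqrt (a * (a + 2)) / (a + 1)\<close> with \<open>a = 2 * m + 1\<close>, at most 1 by the
  arithmetic-geometric mean inequality.\<close>

lemma central_upper: "bp (2 * m) m * sqrt (2 * real m + 1) \<le> 1"
proof (induction m)
  case (Suc m)
  let ?a = "2 * real m + 1"
  have "bp (2 * Suc m) (Suc m) = bp (2 * m) m * ?a / (?a + 1)"
    using central_step[of m] by (simp add: field_simps)
  moreover have "p * ?a / (?a + 1) * t = (p * sqrt ?a) * (sqrt ?a * t / (?a + 1))" for p t
  proof -
    have "sqrt ?a * sqrt ?a = ?a" by simp
    then show ?thesis by (metis (no_types, opaque_lifting) mult.assoc times_divide_eq_left times_divide_eq_right)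
  qed
  moreover have "2 * real (Suc m) + 1 = ?a + 2" by simp
  ultimately have "bp (2 * Suc m) (Suc m) * sqrt (2 * real (Suc m) + 1) =
      (bp (2 * m) m * sqrt ?a) * (sqrt ?a * sqrt (?a + 2) / (?a + 1))"
    by metis
  also have "\<dots> \<le> 1 * 1"
  proof (rule mult_mono)
    have "sqrt ?a * sqrt (?a + 2) \<le> ?a + 1"
      unfolding real_sqrt_mult[symmetric] by (rule real_le_lsqrt) (auto simp: power2_eq_square algebra_simps)
    then show "sqrt ?a * sqrt (?a + 2) / (?a + 1) \<le> 1" by (simp add: field_simps)
  qed (use Suc in auto)
  finally show ?case by simp
qed (simp add: bp_def)

text \<open>The product increases in \<open>m\<close> and equals 1 at \<open>m = 1\<close>, which
  fixes the constant 2.\<close>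

lemma central_lower: "m \<ge> 1 \<Longrightarrow> 1 \<le> bp (2 * m) m * (2 * sqrt m)"
proof (induction m rule: nat_induct_at_least)
  case (Suc m)
  let ?a = "2 * real m + 1"
  have "bp (2 * Suc m) (Suc m) = bp (2 * m) m * ?a / (?a + 1)"
    using central_step[of m] by (simp add: field_simps)
  moreover have "p * ?a / (?a + 1) * (2 * t) = (p * (2 * sqrt m)) * (?a * t / ((?a + 1) * sqrt m))" for p t
    using Suc.hyps by (simp add: divide_simps)
  moreover have "real (Suc m) = real m + 1" by simp
  ultimately have "bp (2 * Suc m) (Suc m) * (2 * sqrt (Suc m)) =
      (bp (2 * m) m * (2 * sqrt m)) * (?a * sqrt (real m + 1) / ((?a + 1) * sqrt m))"
    by metis
  also have "\<dots> \<ge> 1 * 1"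
  proof (rule mult_mono)
    have "(?a + 1) * sqrt m = sqrt ((?a + 1)\<^sup>2 * m)" by (simp add: real_sqrt_mult)
    also have "\<dots> \<le> sqrt (?a\<^sup>2 * (real m + 1))"
      by (rule real_sqrt_le_mono) (simp add: power2_eq_square algebra_simps)
    also have "\<dots> = ?a * sqrt (real m + 1)" by (simp add: real_sqrt_mult)
    finally show "1 \<le> ?a * sqrt (real m + 1) / ((?a + 1) * sqrt m)"
      using Suc.hyps by (subst le_divide_eq_1_pos) auto
  qed (use Suc in auto)
  finally show ?case by simp
qed (simp add: bp_def)

text \<open>For even \<open>N\<close> the central term dominates; Pascal's rule makes an odd row the
  mean of two entries of an even one.\<close>

lemma bp_le_sqrt:
  assumes "0 < N" shows "bp N k \<le> 1 / sqrt N"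
proof -
  have even: "bp (2 * m) k \<le> 1 / sqrt (2 * real m + 1)" for m k
  proof -
    have "bp (2 * m) k \<le> bp (2 * m) m"
      unfolding bp_def by (intro divide_right_mono) (auto simp: binomial_maximum')
    then show ?thesis using central_upper[of m] by (simp add: field_simps) (smt (verit) mult_right_mono real_sqrt_ge_zero of_nat_0_le_iff)
  qed
  show ?thesis
  proof (cases "even N")
    case True
    then obtain m where N: "N = 2 * m" by auto
    have "1 / sqrt (2 * real m + 1) \<le> 1 / sqrt N" using assms by (simp add: N field_simps)
    then show ?thesis using even[of m k] N by simp
  next
    case False
    then obtain m where N: "N = Suc (2 * m)" by (auto elim: oddE)
    show ?thesis
    proof (cases k)
      case 0
      then have "bp N k \<le> bp (2 * m) 0" by (simp add: N bp_Suc_0)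
      then show ?thesis using even[of m 0] N by (simp add: algebra_simps)
    next
      case (Suc j)
      then show ?thesis using even[of m j] even[of m "Suc j"] by (simp add: N bp_Suc_Suc algebra_simps)
    qed
  qed
qed

lemma bp_symmetric: "k \<le> N \<Longrightarrow> bp N (N - k) = bp N k"
  by (simp add: bp_def binomial_symmetric[symmetric])

text \<open>A Gaussian lower bound: walking out from the centre, step \<open>s\<close> costs a
  factor \<open>1 + (2 * s + 1) / (m - s)\<close>, at most \<open>exp ((2 * s + 1) / q)\<close>, and
  the odd numbers add up to a square.\<close>

lemma bp_even_lower_aux:
  assumes "t \<le> m" "s \<le> t"
  shows "bp (2 * m) m * exp (- (real s)\<^sup>2 / (real m - real t + 1)) \<le> bp (2 * m) (m + s)"
  using assms(2)
proof (induction s)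
  case (Suc s)
  \<comment> \<open>A common lower bound for the denominators \<open>m - s\<close> of all steps
    \<open>s < t\<close>.\<close>
  define q where "q = real m - real t + 1"
  have q: "q > 0" using assms by (simp add: q_def)
  define y where "y = (2 * real s + 1) / (real m - real s)"
  have ms: "real m - real s > 0" "q \<le> real m - real s" using Suc.prems assms by (auto simp: q_def)
  have "bp (2 * m) (m + Suc s) * (1 + y) = bp (2 * m) (m + s)"
    using bp_Suc_mult[of "2 * m" "m + s"] ms by (simp add: y_def field_simps)
  moreover have "1 + y \<le> exp ((2 * real s + 1) / q)"
  proof -
    have "1 + y \<le> exp y" by (rule exp_ge_add_one_self)
    also have "y \<le> (2 * real s + 1) / q" unfolding y_def by (rule divide_left_mono) (use ms q in auto)
    finally show ?thesis by simp
  qed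
  ultimately have "bp (2 * m) (m + s) \<le> bp (2 * m) (m + Suc s) * exp ((2 * real s + 1) / q)"
    by (metis bp_nonneg mult_left_mono)
  then have "bp (2 * m) m * exp (- (real s)\<^sup>2 / q) \<le> bp (2 * m) (m + Suc s) * exp ((2 * real s + 1) / q)"
    using Suc by (simp add: q_def)
  then have "bp (2 * m) m * (exp (- (real s)\<^sup>2 / q) / exp ((2 * real s + 1) / q)) \<le> bp (2 * m) (m + Suc s)"
    by (simp add: field_simps)
  also have "exp (- (real s)\<^sup>2 / q) / exp ((2 * real s + 1) / q) = exp (- (real (Suc s))\<^sup>2 / q)"
  proof -
    have "- (real s)\<^sup>2 / q - (2 * real s + 1) / q = (- (real s)\<^sup>2 - (2 * real s + 1)) / q"
      by (simp only: diff_divide_distrib)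
    also have "- (real s)\<^sup>2 - (2 * real s + 1) = - (real (Suc s))\<^sup>2"
      by (simp add: power2_eq_square algebra_simps)
    finally show ?thesis unfolding exp_diff[symmetric] by (rule arg_cong)
  qed
  finally show ?case by (simp add: q_def)
qed simp

lemma bp_even_lower:
  assumes "1 \<le> m" "\<bar>real k - real m\<bar> \<le> r" "r < real m"
  shows "1 / (2 * sqrt m) * exp (- r\<^sup>2 / (real m - r)) \<le> bp (2 * m) k"
proof -
  have r0: "0 \<le> r" using assms by linarith
  define s where "s = (if k \<ge> m then k - m else m - k)"
  have s: "real s \<le> r" "s \<le> m" using assms by (auto simp: s_def of_nat_diff split: if_splits)
  have eq: "bp (2 * m) k = bp (2 * m) (m + s)"
  proof (cases "k \<ge> m")
    case False
    then show ?thesis using bp_symmetric[of k "2 * m"] by (simp add: s_def mult_2)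
  qed (simp add: s_def)
  have "1 / (2 * sqrt m) \<le> bp (2 * m) m"
    using central_lower[OF assms(1)] assms(1) by (simp add: field_simps)
  moreover have "exp (- r\<^sup>2 / (real m - r)) \<le> exp (- (real s)\<^sup>2 / (real m - real s + 1))"
  proof -
    have "(real s)\<^sup>2 / (real m - real s + 1) \<le> r\<^sup>2 / (real m - r)"
      by (rule frac_le) (use s assms in \<open>auto intro!: power_mono\<close>)
    then show ?thesis by simp
  qed
  ultimately have "1 / (2 * sqrt m) * exp (- r\<^sup>2 / (real m - r)) \<le>
     bp (2 * m) m * exp (- (real s)\<^sup>2 / (real m - real s + 1))"
    by (intro mult_mono) auto
  also have "\<dots> \<le> bp (2 * m) (m + s)" by (rule bp_even_lower_aux) (use s in auto)
  finally show ?thesis by (simp add: eq)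
qed

text \<open>For odd \<open>N\<close>, Pascal's rule gives half the sum of two even terms, and one of
  them suffices; this costs a factor 2, while the rounding of \<open>N / 2\<close> is absorbed by
  the unit added to \<open>r\<close>.\<close>

lemma bp_lower:
  assumes "2 \<le> N" "\<bar>real k - real N / 2\<bar> \<le> r" "r + 1 < real N / 2"
  shows "1 / (4 * sqrt N) * exp (- (r + 1)\<^sup>2 / (real N / 2 - r - 1)) \<le> bp N k"
proof -
  define m where "m = N div 2"
  have m1: "1 \<le> m" using assms by (simp add: m_def)
  have r0: "0 \<le> r" using assms by linarith
  have mN: "real N / 2 - 1 / 2 \<le> real m" "real m \<le> real N" unfolding m_def by linarith+
  have key: "1 / (2 * sqrt N) * exp (- (r + 1)\<^sup>2 / (real N / 2 - r - 1)) \<le> bp (2 * m) j"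
    if j: "\<bar>real j - real m\<bar> \<le> r + 1 / 2" for j
  proof -
    have "1 / (2 * sqrt N) * exp (- (r + 1)\<^sup>2 / (real N / 2 - r - 1)) \<le>
        1 / (2 * sqrt m) * exp (- (r + 1/2)\<^sup>2 / (real m - (r + 1/2)))"
    proof (rule mult_mono)
      show "1 / (2 * sqrt N) \<le> 1 / (2 * sqrt m)" using mN m1 by (simp add: field_simps)
      have "(r + 1/2)\<^sup>2 / (real m - (r + 1/2)) \<le> (r + 1)\<^sup>2 / (real N / 2 - r - 1)"
        by (rule frac_le) (use assms mN r0 in \<open>auto intro!: power_mono\<close>)
      then show "exp (- (r + 1)\<^sup>2 / (real N / 2 - r - 1)) \<le> exp (- (r + 1/2)\<^sup>2 / (real m - (r + 1/2)))"
        by simp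
    qed auto
    also have "\<dots> \<le> bp (2 * m) j"
      by (rule bp_even_lower) (use j mN assms m1 in auto)
    finally show ?thesis .
  qed
  let ?L = "1 / (2 * sqrt N) * exp (- (r + 1)\<^sup>2 / (real N / 2 - r - 1))"
  have L: "1 / (4 * sqrt N) * exp (- (r + 1)\<^sup>2 / (real N / 2 - r - 1)) = ?L / 2" by simp
  have L0: "?L \<ge> 0" by simp
  show ?thesis
  proof (cases "even N")
    case True
    then have "N = 2 * m" by (simp add: m_def)
    then have "\<bar>real k - real m\<bar> \<le> r + 1 / 2" using assms(2) by simp
    from key[OF this] have "?L \<le> bp N k" using \<open>N = 2 * m\<close> by simp
    then show ?thesis using L L0 by linarith
  next
    case False
    then have N: "N = Suc (2 * m)" by (simp add: m_def)
    obtain j where k: "k = Suc j" using assms N by (cases k) auto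
    have "?L \<le> bp (2 * m) j \<or> ?L \<le> bp (2 * m) (Suc j)"
    proof -
      have "\<bar>real j - real m\<bar> \<le> r + 1/2" 
      proof -
        have "real k = real j + 1" "real N / 2 = real m + 1 / 2" by (simp_all add: N k field_simps)
        then show ?thesis using assms(2) by linarith
      qed
      then show ?thesis using key by blast
    qed
    moreover have "L \<le> a \<or> L \<le> b \<Longrightarrow> 0 \<le> a \<Longrightarrow> 0 \<le> b \<Longrightarrow> L / 2 \<le> (a + b) / 2" for L a b :: real
      by auto
    ultimately have "?L / 2 \<le> bp N k"
      unfolding N k bp_Suc_Suc using bp_nonneg by blast
    then show ?thesis using L by simp
  qed
qed

section \<open>The window of degrees that almost surely occur, of width about
  \<open>dd n\<close>\<close>

definition dd :: "nat \<Rightarrow> real" where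
  "dd n = sqrt (real n * ln (real n))"

text \<open>In the shrunken window the exponent is at most \<open>(1 - \<delta>) / 2 * ln n\<close>,
  so the product is at least of order \<open>n powr (\<delta> / 2)\<close> and exceeds every
  constant. There are \<open>n - 2\<close> trials because degrees will be read off outside a fixed
  pair of vertices; the slack 2 leaves room for later shifts of the degree.\<close>

lemma window_lower:
  assumes "0 < \<delta>" "\<delta> < 1"
  shows "\<forall>\<^sub>F n in sequentially. \<forall>k. \<bar>real k - real n / 2\<bar> \<le> (1 - \<delta>) * dd n / 2 + 2 \<longrightarrow>
     K \<le> real n * bp (n - 2) k"
proof -
  \<comment> \<open>The slack 2, and 1 more for moving the centre from \<open>n / 2\<close> to
    \<open>(n - 2) / 2\<close>.\<close>
  define r where "r = (\<lambda>n::nat. (1 - \<delta>) * dd n / 2 + 3)"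
  have lim: "(\<lambda>n::nat. (r n + 1)\<^sup>2 / ((real n - 2) / 2 - r n - 1) / ln n) \<longlonglongrightarrow> (1 - \<delta>)\<^sup>2 / 2"
  proof -
    have "(\<lambda>n::nat. (c * dd n / 2 + 4)\<^sup>2 / ((real n - 2) / 2 - (c * dd n / 2 + 3) - 1) / ln n) \<longlonglongrightarrow> c\<^sup>2 / 2"
      if "0 < c" for c :: real
      unfolding dd_def using that by (real_asymp simp: field_simps power2_eq_square)
    from this[of "1 - \<delta>"] assms show ?thesis by (simp add: r_def add.assoc)
  qed
  \<comment> \<open>The strict gap between the limiting exponent and
    \<open>(1 - \<delta>) / 2\<close> makes the estimate hold for all large
    \<open>n\<close>.\<close>
  have "(1 - \<delta>)\<^sup>2 / 2 < (1 - \<delta>) / 2" using assms by (simp add: power2_eq_square)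
  from order_tendstoD(2)[OF lim this]
  have e1: "\<forall>\<^sub>F n in sequentially. (r n + 1)\<^sup>2 / ((real n - 2) / 2 - r n - 1) / ln n < (1 - \<delta>) / 2" .
  have e2: "\<forall>\<^sub>F n::nat in sequentially. r n + 1 < (real n - 2) / 2"
    unfolding r_def dd_def by real_asymp
  have "filterlim (\<lambda>n::nat. real n / (4 * sqrt n) * n powr (- (1 - \<delta>) / 2)) at_top sequentially"
  proof (rule filterlim_cong[THEN iffD1, OF refl refl])
    show "filterlim (\<lambda>n::nat. real n powr (\<delta> / 2) / 4) at_top sequentially"
      using assms by real_asymp
    show "\<forall>\<^sub>F n in sequentially. real n powr (\<delta> / 2) / 4 = real n / (4 * sqrt n) * n powr (- (1 - \<delta>) / 2)"
      using eventually_gt_at_top[of 0]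
    proof eventually_elim
      case (elim n)
      have "real n / sqrt n = real n powr (1/2)"
        using elim by (simp add: powr_half_sqrt real_div_sqrt)
      moreover have "real n / (4 * sqrt n) * n powr (- (1 - \<delta>) / 2) = (real n / sqrt n) * n powr (- (1 - \<delta>) / 2) / 4"
        by simp
      ultimately have "real n / (4 * sqrt n) * n powr (- (1 - \<delta>) / 2) = real n powr (1/2) * n powr (- (1 - \<delta>) / 2) / 4"
        by simp
      also have "\<dots> = real n powr (\<delta> / 2) / 4"
        unfolding powr_add[symmetric] by (simp add: field_simps)
      finally show ?case by simp
    qed
  qed
  then have e3: "\<forall>\<^sub>F n::nat in sequentially. K \<le> real n / (4 * sqrt n) * n powr (- (1 - \<delta>) / 2)"
    by (simp add: filterlim_at_top)
  show ?thesis
    using e1 e2 e3 eventually_ge_at_top[of 4]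
  proof eventually_elim
    case (elim n)
    show ?case
    proof (intro allI impI)
      fix k assume k: "\<bar>real k - real n / 2\<bar> \<le> (1 - \<delta>) * dd n / 2 + 2"
      have n2: "real (n - 2) = real n - 2" using elim by (simp add: of_nat_diff)
      have ln: "ln (real n) > 0" using elim by simp
      have "real (n - 2) / 2 = real n / 2 - 1" by (simp add: n2 diff_divide_distrib)
      then have k': "\<bar>real k - real (n - 2) / 2\<bar> \<le> r n" using k unfolding r_def by (simp only: abs_le_iff) argo
      have "1 / (4 * sqrt n) * n powr (- (1 - \<delta>) / 2) \<le>
        1 / (4 * sqrt (n - 2)) * exp (- (r n + 1)\<^sup>2 / (real (n - 2) / 2 - r n - 1))"
      proof (rule mult_mono)
        show "1 / (4 * sqrt n) \<le> 1 / (4 * sqrt (n - 2))" using elim by (simp add: field_simps)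
        have "(r n + 1)\<^sup>2 / ((real n - 2) / 2 - r n - 1) \<le> (1 - \<delta>) / 2 * ln n"
          using pos_divide_less_eq[THEN iffD1, OF ln elim(1)] by simp
        then have "- ((1 - \<delta>) / 2 * ln n) \<le> - ((r n + 1)\<^sup>2 / ((real n - 2) / 2 - r n - 1))" by simp
        then have "exp (- ((1 - \<delta>) / 2 * ln n)) \<le> exp (- ((r n + 1)\<^sup>2 / ((real n - 2) / 2 - r n - 1)))" by simp
        moreover have "n powr (- (1 - \<delta>) / 2) = exp (- ((1 - \<delta>) / 2 * ln n))"
          using elim(4) by (simp add: powr_def) (simp add: algebra_simps)
        ultimately show "n powr (- (1 - \<delta>) / 2) \<le> exp (- (r n + 1)\<^sup>2 / (real (n - 2) / 2 - r n - 1))"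
          by (simp only: n2 minus_divide_left)
      qed auto
      also have "\<dots> \<le> bp (n - 2) k"
        by (rule bp_lower) (use elim(2,4) k' n2 in auto)
      finally have "real n * (1 / (4 * sqrt n) * n powr (- (1 - \<delta>) / 2)) \<le> real n * bp (n - 2) k"
        by (intro mult_left_mono) auto
      then show "K \<le> real n * bp (n - 2) k" using elim(3) by simp
    qed
  qed
qed

text \<open>By \<open>bp_Suc_mult\<close> the quotient is \<open>(N - k) / (k + 1)\<close>, and both
  numbers lie between \<open>Y\<close> and \<open>X\<close> below, whose quotient tends to 1. Up to
  four vertices will be set apart, hence \<open>N\<close> down to \<open>n - 4\<close>. The last
  clause is for use with \<open>avg_degcount_ratio\<close>.\<close>

lemma window_ratio:
  assumes "0 < \<eta>"
  shows "\<forall>\<^sub>F n in sequentially. \<forall>k N. \<bar>real k - real n / 2\<bar> \<le> dd n + 4 \<longrightarrow> n \<le> N + 4 \<longrightarrow> N < n \<longrightarrow>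
     4 \<le> k \<and> k + 8 \<le> n \<and> bp N (Suc k) \<le> (1 + \<eta>) * bp N k \<and> bp N k \<le> (1 + \<eta>) * bp N (Suc k) \<and> 
     real (n - 1 - k) \<le> 2 * real (Suc k)"
proof -
  have "(\<lambda>n::nat. (real n / 2 + dd n + 5) / (real n / 2 - dd n - 9)) \<longlonglongrightarrow> 1"
    unfolding dd_def by real_asymp
  then have e1: "\<forall>\<^sub>F n::nat in sequentially. (real n / 2 + dd n + 5) / (real n / 2 - dd n - 9) < 1 + min \<eta> 1"
    by (rule order_tendstoD) (use assms in auto)
  have e2: "\<forall>\<^sub>F n::nat in sequentially. real n / 2 - dd n - 9 > 4"
    unfolding dd_def by real_asymp
  show ?thesis
    using e1 e2
  proof eventually_elim
    case (elim n)
    show ?case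
    proof (intro allI impI)
      fix k N assume k: "\<bar>real k - real n / 2\<bar> \<le> dd n + 4" and N: "n \<le> N + 4" "N < n"
      define X where "X = real n / 2 + dd n + 5"
      define Y where "Y = real n / 2 - dd n - 9"
      have XY: "X \<le> (1 + min \<eta> 1) * Y" using elim by (simp add: X_def Y_def field_simps)
      have Y: "Y > 4" using elim by (simp add: Y_def)
      have a: "Y \<le> real (Suc k)" "real (Suc k) \<le> X" using k by (auto simp: X_def Y_def)
      have N': "real n - 4 \<le> real N" "real N < real n" using N by linarith+
      have b: "Y \<le> real N - real k" "real N - real k \<le> X" using k N' unfolding X_def Y_def by linarith+
      have m1: "(1 + min \<eta> 1) \<le> 1 + \<eta>" "(1 + min \<eta> 1) \<le> 2" by auto
      have "X \<le> (1 + \<eta>) * Y" using XY mult_right_mono[OF m1(1), of Y] Y by linarith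
      then have XY': "real N - real k \<le> (1 + \<eta>) * real (Suc k)" "real (Suc k) \<le> (1 + \<eta>) * (real N - real k)"
        using a b assms mult_left_mono[of Y "real (Suc k)" "1 + \<eta>"] mult_left_mono[of Y "real N - real k" "1 + \<eta>"]
        by linarith+
      have eq: "bp N (Suc k) * real (Suc k) = bp N k * (real N - real k)" by (rule bp_Suc_mult)
      have "bp N (Suc k) * real (Suc k) \<le> ((1 + \<eta>) * bp N k) * real (Suc k)"
        unfolding eq using mult_left_mono[OF XY'(1), of "bp N k"] by (simp add: mult_ac)
      then have r1: "bp N (Suc k) \<le> (1 + \<eta>) * bp N k" by (rule mult_right_le_imp_le) simp
      have "bp N k * (real N - real k) \<le> ((1 + \<eta>) * bp N (Suc k)) * (real N - real k)"
        unfolding eq[symmetric] using mult_left_mono[OF XY'(2), of "bp N (Suc k)"] by (simp add: mult_ac)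
      then have r2: "bp N k \<le> (1 + \<eta>) * bp N (Suc k)" by (rule mult_right_le_imp_le) (use b Y in linarith)
      have k4: "4 \<le> k" using k elim(2) by linarith
      have k8: "k + 8 \<le> n"
      proof -
        have "real k + 8 \<le> real n" using k elim(2) by linarith
        then show ?thesis by linarith
      qed
      have "real (n - 1 - k) \<le> X" using k by (simp add: X_def)
      also have "\<dots> \<le> 2 * Y" using XY mult_right_mono[OF m1(2), of Y] Y by linarith
      also have "\<dots> \<le> 2 * real (Suc k)" using a by simp
      finally show "4 \<le> k \<and> k + 8 \<le> n \<and> bp N (Suc k) \<le> (1 + \<eta>) * bp N k \<and> bp N k \<le> (1 + \<eta>) * bp N (Suc k) \<and> 
         real (n - 1 - k) \<le> 2 * real (Suc k)"
        using r1 r2 k4 k8 by blast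
    qed
  qed
qed

subsection \<open>The number of vertices of given degree\<close>

definition degcount :: "nat \<Rightarrow> graph \<Rightarrow> nat \<Rightarrow> nat" where
  "degcount n G i = card {v \<in> {1..n}. vertex_degree G v = i}"

lemma degcount_eq_sum: "real (degcount n G i) = (\<Sum>v\<in>{1..n}. of_bool (vertex_degree G v = i))"
  by (simp add: degcount_def of_bool_def sum.If_cases Int_def)

lemma graphs_on_doubleton:
  "G \<in> graphs_on n \<Longrightarrow> {u, v} \<in> G \<Longrightarrow> u \<noteq> v \<and> u \<in> {1..n} \<and> v \<in> {1..n}"
  using doubleton_in_edges_on[of u v n] by (auto simp: graphs_on_eq)

lemma graphs_on_card_2: "G \<in> graphs_on n \<Longrightarrow> e \<in> G \<Longrightarrow> card e = 2"
  by (auto simp: graphs_on_def)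

definition nbrs :: "graph \<Rightarrow> nat \<Rightarrow> nat set" where
  "nbrs G v = {w. {v, w} \<in> G}"

lemma nbrs_subset: "G \<in> graphs_on n \<Longrightarrow> nbrs G v \<subseteq> {1..n} - {v}"
  using graphs_on_doubleton[of G n v] by (auto simp: nbrs_def)

lemma finite_nbrs: "G \<in> graphs_on n \<Longrightarrow> finite (nbrs G v)"
  by (rule finite_subset[OF nbrs_subset]) auto

lemma card_nbrs:
  assumes "G \<in> graphs_on n"
  shows "card (nbrs G v) = vertex_degree G v"
proof -
  have "bij_betw (\<lambda>w. {v, w}) (nbrs G v) {e \<in> G. v \<in> e}"
  proof (rule bij_betw_imageI)
    show "inj_on (\<lambda>w. {v, w}) (nbrs G v)" by (rule inj_onI) (auto simp: doubleton_eq_iff)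
    have "e \<in> (\<lambda>w. {v, w}) ` nbrs G v" if "e \<in> G" "v \<in> e" for e
    proof -
      have "e \<in> edges_on n" using that assms by (auto simp: graphs_on_eq)
      then obtain a b where "e = {a, b}" by (rule edges_onE)
      then have "e = {v, b} \<or> e = {v, a}" using that by auto
      then show ?thesis using that by (auto simp: nbrs_def)
    qed
    then show "(\<lambda>w. {v, w}) ` nbrs G v = {e \<in> G. v \<in> e}" by (auto simp: nbrs_def)
  qed
  then show ?thesis by (simp add: bij_betw_same_card vertex_degree_def)
qed

lemma vertex_degree_le: "G \<in> graphs_on n \<Longrightarrow> v \<in> {1..n} \<Longrightarrow> vertex_degree G v \<le> n - 1"
  using card_mono[OF _ nbrs_subset[of G n v]] by (simp add: card_nbrs)

lemma degcount_eq_0: "G \<in> graphs_on n \<Longrightarrow> n \<le> i \<Longrightarrow> degcount n G i = 0"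
  unfolding degcount_def using vertex_degree_le[of G n] by fastforce

lemma vertex_degree_insert:
  assumes "finite G" "e \<notin> G"
  shows "vertex_degree (insert e G) x = vertex_degree G x + of_bool (x \<in> e)"
proof (cases "x \<in> e")
  case True
  then have "{f \<in> insert e G. x \<in> f} = insert e {f \<in> G. x \<in> f}" by auto
  then show ?thesis using assms True by (simp add: vertex_degree_def)
next
  case False
  then have "{f \<in> insert e G. x \<in> f} = {f \<in> G. x \<in> f}" by auto
  then show ?thesis using False by (simp add: vertex_degree_def)
qed

lemma vertex_degree_remove:
  assumes "finite G" "e \<in> G"
  shows "vertex_degree G x = vertex_degree (G - {e}) x + of_bool (x \<in> e)"
  using vertex_degree_insert[of "G - {e}" e x] assms by (simp add: insert_absorb)

lemma inner_degree_singleton: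
  assumes "G \<in> graphs_on n" shows "inner_degree {u} G v = 0"
proof -
  have "{e \<in> G. v \<in> e \<and> e \<subseteq> {u}} = {}"
  proof safe
    fix e assume "e \<in> G" "e \<subseteq> {u}"
    then have "card e = 2" "card e \<le> card {u}"
      using graphs_on_card_2[OF assms] card_mono[of "{u}" e] by auto
    then show "e \<in> {}" by simp
  qed
  then show ?thesis unfolding inner_degree_def by simp
qed

lemma pr_degree:
  assumes "u \<in> {1..n}"
  shows "pr n (\<lambda>G. vertex_degree G u = i) = bp (n - 1) i"
  using joint_degrees_eq[of "{u}" n "\<lambda>_. True" 0 "\<lambda>_. i"] assms
  by (simp add: inner_degree_singleton)

lemma inner_degree_pair:
  assumes "G \<in> graphs_on n" "u \<noteq> v" "x \<in> {u, v}"
  shows "inner_degree {u, v} G x = of_bool ({u, v} \<in> G)"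
proof -
  have "{e \<in> G. x \<in> e \<and> e \<subseteq> {u, v}} = (if {u, v} \<in> G then {{u, v}} else {})"
  proof -
    have "e = {u, v}" if "e \<in> G" "e \<subseteq> {u, v}" for e
    proof (rule card_subset_eq)
      show "card e = card {u, v}" using graphs_on_card_2[OF assms(1) that(1)] assms(2) by simp
    qed (use that in auto)
    then show ?thesis using assms(3) by auto
  qed
  then show ?thesis by (simp add: inner_degree_def)
qed

lemma pr_no_edge:
  assumes "{u, v} \<in> edges_on n"
  shows "pr n (\<lambda>G. {u, v} \<notin> G) = 1 / 2"
  using pr_avoid_edges[of "{{u, v}}" n] assms by simp

lemma pr_edge:
  assumes "{u, v} \<in> edges_on n"
  shows "pr n (\<lambda>G. {u, v} \<in> G) = 1 / 2"
  using pr_not[of n "\<lambda>G. {u, v} \<notin> G"] pr_no_edge[OF assms] by simp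

text \<open>Without the edge \<open>uv\<close> the two degrees are independent, each with
  \<open>n - 2\<close> potential neighbours.\<close>

lemma pr_degree_nonadjacent:
  assumes "u \<in> {1..n}" "v \<in> {1..n}" "u \<noteq> v"
  shows "pr n (\<lambda>G. {u, v} \<notin> G \<and> vertex_degree G u = i \<and> vertex_degree G v = j) =
    bp (n - 2) i * bp (n - 2) j / 2"
proof -
  let ?k = "\<lambda>x. if x = u then i else j"
  have "pr n (\<lambda>G. {u, v} \<notin> G \<and> (\<forall>x\<in>{u, v}. vertex_degree G x = ?k x)) =
    pr n (\<lambda>G. {u, v} \<notin> G) * (\<Prod>x\<in>{u, v}. bp (n - card {u, v}) (?k x - 0))"
    by (rule joint_degrees_eq) (use assms in \<open>auto simp: inner_degree_pair\<close>)
  moreover have "pr n (\<lambda>G. {u, v} \<notin> G) = 1 / 2"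
    using assms by (intro pr_no_edge) (simp add: doubleton_in_edges_on)
  ultimately show ?thesis using assms by (auto simp: numeral_2_eq_2)
qed

lemma pr_degree_adjacent:
  assumes "u \<in> {1..n}" "v \<in> {1..n}" "u \<noteq> v"
  shows "pr n (\<lambda>G. {u, v} \<in> G \<and> vertex_degree G u = Suc i \<and> vertex_degree G v = Suc j) =
    bp (n - 2) i * bp (n - 2) j / 2"
proof -
  let ?k = "\<lambda>x. if x = u then Suc i else Suc j"
  have "pr n (\<lambda>G. {u, v} \<in> G \<and> (\<forall>x\<in>{u, v}. vertex_degree G x = ?k x)) =
    pr n (\<lambda>G. {u, v} \<in> G) * (\<Prod>x\<in>{u, v}. bp (n - card {u, v}) (?k x - 1))"
    by (rule joint_degrees_eq) (use assms in \<open>auto simp: inner_degree_pair\<close>)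
  moreover have "pr n (\<lambda>G. {u, v} \<in> G) = 1 / 2"
    using assms by (intro pr_edge) (simp add: doubleton_in_edges_on)
  ultimately show ?thesis using assms by (auto simp: numeral_2_eq_2)
qed

lemma avg_degcount: "avg n (\<lambda>G. real (degcount n G i)) = real n * bp (n - 1) i"
proof -
  have "avg n (\<lambda>G. real (degcount n G i)) = (\<Sum>v\<in>{1..n}. pr n (\<lambda>G. vertex_degree G v = i))"
    unfolding degcount_eq_sum avg_sum pr_def ..
  then show ?thesis by (simp add: pr_degree)
qed

text \<open>\<open>bp N (i - 1)\<close> with the correct value 0 at \<open>i = 0\<close>, where
  truncated subtraction would give \<open>bp N 0\<close>.\<close>

definition bp_pred :: "nat \<Rightarrow> nat \<Rightarrow> real" where
  "bp_pred N i = (if i = 0 then 0 else bp N (i - 1))"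

lemma bp_Suc_eq: "bp (Suc N) i = (bp N i + bp_pred N i) / 2"
  by (cases i) (simp_all add: bp_pred_def bp_Suc_0 bp_Suc_Suc)

lemma pr_degree_pair:
  assumes "u \<in> {1..n}" "v \<in> {1..n}" "u \<noteq> v"
  shows "pr n (\<lambda>G. vertex_degree G u = i \<and> vertex_degree G v = i) =
    ((bp (n - 2) i)\<^sup>2 + (bp_pred (n - 2) i)\<^sup>2) / 2"
proof -
  have "pr n (\<lambda>G. vertex_degree G u = i \<and> vertex_degree G v = i) =
     avg n (\<lambda>G. of_bool ({u, v} \<notin> G \<and> vertex_degree G u = i \<and> vertex_degree G v = i) +
       of_bool ({u, v} \<in> G \<and> vertex_degree G u = i \<and> vertex_degree G v = i))"
    unfolding pr_def by (rule avg_cong) auto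
  also have "\<dots> = (bp (n - 2) i)\<^sup>2 / 2 +
      pr n (\<lambda>G. {u, v} \<in> G \<and> vertex_degree G u = i \<and> vertex_degree G v = i)"
    unfolding avg_add pr_def[symmetric] pr_degree_nonadjacent[OF assms] by (simp add: power2_eq_square)
  also have "pr n (\<lambda>G. {u, v} \<in> G \<and> vertex_degree G u = i \<and> vertex_degree G v = i) =
      (bp_pred (n - 2) i)\<^sup>2 / 2"
  proof (cases i)
    case 0
    have "vertex_degree G u \<noteq> 0" if "G \<in> graphs_on n" "{u, v} \<in> G" for G
      using that graphs_on_finite[OF that(1)] by (auto simp: vertex_degree_def)
    then have "pr n (\<lambda>G. {u, v} \<in> G \<and> vertex_degree G u = i \<and> vertex_degree G v = i) = pr n (\<lambda>_. False)"
      using 0 by (intro pr_cong) auto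
    then show ?thesis using 0 by (simp add: bp_pred_def)
  next
    case (Suc j)
    then show ?thesis using pr_degree_adjacent[OF assms, of j j] by (simp add: bp_pred_def power2_eq_square)
  qed
  finally show ?thesis by (simp add: add_divide_distrib)
qed

text \<open>The events that \<open>u\<close> and that \<open>v\<close> has degree \<open>i\<close>
  are correlated only through the edge \<open>uv\<close>. Conditioning on it gives the covariance
  \<open>(a^2 + b^2) / 2 - ((a + b) / 2)^2 = (a - b)^2 / 4\<close> for the neighbouring binomial
  probabilities \<open>a\<close> and \<open>b\<close>.\<close>

lemma var_degcount:
  assumes "2 \<le> n"
  shows "avg n (\<lambda>G. (real (degcount n G i) - real n * bp (n - 1) i)\<^sup>2) \<le>
    real n * bp (n - 1) i + (real n)\<^sup>2 / 4 * (bp (n - 2) i - bp_pred (n - 2) i)\<^sup>2"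
proof -
  define p where "p = bp (n - 1) i"
  define a where "a = bp (n - 2) i"
  define b where "b = bp_pred (n - 2) i"
  have pab: "p = (a + b) / 2" unfolding p_def a_def b_def
    using bp_Suc_eq[of "n - 2" i] assms by (simp add: Suc_diff_Suc numeral_2_eq_2)
  have sq: "(real (degcount n G i))\<^sup>2 = (\<Sum>u\<in>{1..n}. \<Sum>v\<in>{1..n}.
      of_bool (vertex_degree G u = i \<and> vertex_degree G v = i))" for G
    unfolding degcount_eq_sum power2_eq_square sum_product by (intro sum.cong refl) auto
  have "avg n (\<lambda>G. (real (degcount n G i))\<^sup>2) =
     (\<Sum>u\<in>{1..n}. \<Sum>v\<in>{1..n}. pr n (\<lambda>G. vertex_degree G u = i \<and> vertex_degree G v = i))"
    unfolding sq avg_sum pr_def ..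
  also have "\<dots> = (\<Sum>u\<in>{1..n}. \<Sum>v\<in>{1..n}. if u = v then p else (a\<^sup>2 + b\<^sup>2) / 2)"
    by (intro sum.cong refl) (use pr_degree_pair pr_degree in \<open>auto simp: p_def a_def b_def\<close>)
  also have "\<dots> = (\<Sum>u\<in>{1..n}. p + real (n - 1) * ((a\<^sup>2 + b\<^sup>2) / 2))"
  proof (rule sum.cong[OF refl])
    fix u assume u: "u \<in> {1..n}"
    have "(\<Sum>v\<in>{1..n}. if u = v then p else (a\<^sup>2 + b\<^sup>2) / 2) =
       p + (\<Sum>v\<in>{1..n} - {u}. if u = v then p else (a\<^sup>2 + b\<^sup>2) / 2)"
      using u by (subst sum.remove[of _ u]) auto
    also have "(\<Sum>v\<in>{1..n} - {u}. if u = v then p else (a\<^sup>2 + b\<^sup>2) / 2) = (\<Sum>v\<in>{1..n} - {u}. (a\<^sup>2 + b\<^sup>2) / 2)"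
      by (rule sum.cong) auto
    finally show "(\<Sum>v\<in>{1..n}. if u = v then p else (a\<^sup>2 + b\<^sup>2) / 2) = p + real (n - 1) * ((a\<^sup>2 + b\<^sup>2) / 2)"
      using u by simp
  qed
  also have "\<dots> = real n * p + real n * (real n - 1) * (p\<^sup>2 + (a - b)\<^sup>2 / 4)"
    using assms by (simp add: pab of_nat_diff power2_eq_square field_simps)
  finally have E2: "avg n (\<lambda>G. (real (degcount n G i))\<^sup>2) =
     real n * p + real n * (real n - 1) * (p\<^sup>2 + (a - b)\<^sup>2 / 4)" .
  have "avg n (\<lambda>G. (real (degcount n G i) - real n * p)\<^sup>2) =
     avg n (\<lambda>G. (real (degcount n G i))\<^sup>2 - (2 * real n * p) * real (degcount n G i) + (real n * p)\<^sup>2)"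
    by (rule avg_cong) (simp add: power2_eq_square algebra_simps)
  also have "\<dots> = real n * p + real n * (real n - 1) * (p\<^sup>2 + (a - b)\<^sup>2 / 4) - (real n * p)\<^sup>2"
    unfolding avg_add avg_diff avg_cmult E2 avg_degcount by (simp add: p_def power2_eq_square)
  also have "\<dots> = real n * p + (real n)\<^sup>2 / 4 * (a - b)\<^sup>2 - real n * (p\<^sup>2 + (a - b)\<^sup>2 / 4)"
  proof -
    have "m * p + m * (m - 1) * (p\<^sup>2 + X / 4) - (m * p)\<^sup>2 = m * p + m\<^sup>2 / 4 * X - m * (p\<^sup>2 + X / 4)"
      for m X :: real by (simp add: power2_eq_square field_simps)
    then show ?thesis .
  qed
  also have "\<dots> \<le> real n * p + (real n)\<^sup>2 / 4 * (a - b)\<^sup>2" by simp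
  finally show ?thesis by (simp add: p_def a_def b_def)
qed

text \<open>Expanding the square and applying Vandermonde leaves twice the difference of the two
  central coefficients of row \<open>2 * N\<close>, over \<open>4 ^ N\<close>; that difference is
  the fraction \<open>1 / (N + 1)\<close> of the central one.\<close>

lemma sum_bp_diff_le: "(\<Sum>i\<le>Suc N. (bp N i - bp_pred N i)\<^sup>2) \<le> 2 / (real N + 1)"
proof -
  have s1: "(\<Sum>i\<le>Suc N. (bp N i)\<^sup>2) = real (2 * N choose N) / 4 ^ N"
  proof -
    have "(\<Sum>i\<le>Suc N. (bp N i)\<^sup>2) = (\<Sum>i\<le>N. (bp N i)\<^sup>2)" by (simp add: bp_def)
    also have "\<dots> = real (\<Sum>i\<le>N. (N choose i)\<^sup>2) / 4 ^ N"
      by (simp add: bp_def sum_divide_distrib power_divide power2_eq_square power_mult_distrib[symmetric])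
    finally show ?thesis by (simp only: choose_square_sum)
  qed
  have s2: "(\<Sum>i\<le>Suc N. (bp_pred N i)\<^sup>2) = real (2 * N choose N) / 4 ^ N"
  proof -
    have "(\<Sum>i\<le>Suc N. (bp_pred N i)\<^sup>2) = (\<Sum>i\<le>N. (bp N i)\<^sup>2)"
      by (subst sum.atMost_Suc_shift) (simp add: bp_pred_def)
    also have "\<dots> = (\<Sum>i\<le>Suc N. (bp N i)\<^sup>2)" by (simp add: bp_def)
    finally show ?thesis using s1 by simp
  qed
  have s3: "(\<Sum>i\<le>Suc N. bp N i * bp_pred N i) = real (2 * N choose Suc N) / 4 ^ N"
  proof -
    have "(\<Sum>i\<le>Suc N. bp N i * bp_pred N i) = (\<Sum>i\<le>Suc N. real ((N choose i) * (N choose (Suc N - i))) / 4 ^ N)"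
    proof (rule sum.cong[OF refl])
      fix i assume i: "i \<in> {..Suc N}"
      have "bp_pred N i = real (N choose (Suc N - i)) / 2 ^ N"
      proof (cases i)
        case (Suc j)
        then show ?thesis using i binomial_symmetric[of j N] by (simp add: bp_pred_def bp_def)
      qed (simp add: bp_pred_def)
      then show "bp N i * bp_pred N i = real ((N choose i) * (N choose (Suc N - i))) / 4 ^ N"
        by (simp add: bp_def power_mult_distrib[symmetric])
    qed
    also have "\<dots> = real (\<Sum>i\<le>Suc N. (N choose i) * (N choose (Suc N - i))) / 4 ^ N"
      by (simp only: sum_divide_distrib of_nat_sum)
    finally show ?thesis unfolding vandermonde by (simp add: mult_2)
  qed
  have c: "real (2 * N choose Suc N) * (real N + 1) = real (2 * N choose N) * real N"
    using bp_Suc_mult[of "2 * N" N] by (simp add: bp_def field_simps)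
  have "(\<Sum>i\<le>Suc N. (bp N i - bp_pred N i)\<^sup>2) =
     (\<Sum>i\<le>Suc N. (bp N i)\<^sup>2) + (\<Sum>i\<le>Suc N. (bp_pred N i)\<^sup>2) - 2 * (\<Sum>i\<le>Suc N. bp N i * bp_pred N i)"
    unfolding sum_distrib_left sum.distrib[symmetric] sum_subtractf[symmetric]
    by (rule sum.cong) (auto simp: power2_eq_square algebra_simps)
  also have "\<dots> = 2 * (real (2 * N choose N) - real (2 * N choose Suc N)) / 4 ^ N"
    unfolding s1 s2 s3 by (simp add: diff_divide_distrib)
  also have "real (2 * N choose N) - real (2 * N choose Suc N) = real (2 * N choose N) / (real N + 1)"
    using c by (simp add: field_simps)
  also have "2 * (real (2 * N choose N) / (real N + 1)) / 4 ^ N = 2 / (real N + 1) * bp (2 * N) N"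
    by (simp add: bp_def power_mult)
  also have "\<dots> \<le> 2 / (real N + 1) * 1"
    by (rule mult_left_mono) (use sum_bp_le_1[of "{N}" "2 * N"] in auto)
  finally show ?thesis by simp
qed

text \<open>The variances of all degree counts together are linear in \<open>n\<close>, whereas the
  square of \<open>dd n\<close> is \<open>n * ln n\<close>; this lets Chebyshev's inequality survive
  a union bound over all degrees.\<close>

lemma sum_var_degcount:
  assumes "2 \<le> n"
  shows "(\<Sum>i<n. avg n (\<lambda>G. (real (degcount n G i) - real n * bp (n - 1) i)\<^sup>2)) \<le> 2 * real n"
proof -
  obtain N where n: "n = Suc (Suc N)" using assms that[of "n - 2"] by simp
  have set: "{..<n} = {..Suc N}" by (auto simp: n)
  have "(\<Sum>i<n. avg n (\<lambda>G. (real (degcount n G i) - real n * bp (n - 1) i)\<^sup>2)) \<le>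
     (\<Sum>i<n. real n * bp (n - 1) i + (real n)\<^sup>2 / 4 * (bp N i - bp_pred N i)\<^sup>2)"
    by (rule sum_mono) (use var_degcount[OF assms] in \<open>simp add: n\<close>)
  also have "\<dots> = real n * (\<Sum>i<n. bp (n - 1) i) + (real n)\<^sup>2 / 4 * (\<Sum>i\<le>Suc N. (bp N i - bp_pred N i)\<^sup>2)"
    unfolding sum.distrib sum_distrib_left[symmetric] set ..
  also have "\<dots> \<le> real n * 1 + (real n)\<^sup>2 / 4 * (2 / (real N + 1))"
    by (intro add_mono mult_left_mono sum_bp_le_1 sum_bp_diff_le) auto
  also have "\<dots> \<le> 2 * real n"
    by (simp add: n field_simps power2_eq_square)
  finally show ?thesis .
qed

text \<open>Every mean is at most \<open>n / sqrt (n - 1)\<close>, which is small against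
  \<open>dd n\<close>. The union bound over all degrees then costs
  \<open>8 / (\<epsilon>^2 * ln n)\<close>, so the logarithm in \<open>dd\<close> is just
  enough.\<close>

lemma degcount_max:
  assumes "0 < \<epsilon>"
  shows "\<forall>\<^sub>F n in sequentially. pr n (\<lambda>G. \<exists>i. \<epsilon> * dd n \<le> real (degcount n G i)) \<le> \<epsilon>"
proof -
  have "(\<lambda>n::nat. 8 / (\<epsilon>\<^sup>2 * ln n)) \<longlonglongrightarrow> 0" using assms by real_asymp
  then have e1: "\<forall>\<^sub>F n::nat in sequentially. 8 / (\<epsilon>\<^sup>2 * ln n) < \<epsilon>"
    by (rule order_tendstoD) (use assms in auto)
  have "(\<lambda>n::nat. real n / sqrt (real n - 1) / sqrt (real n * ln n)) \<longlonglongrightarrow> 0" by real_asymp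
  then have e2: "\<forall>\<^sub>F n::nat in sequentially. real n / sqrt (real n - 1) / sqrt (real n * ln n) < \<epsilon> / 2"
    by (rule order_tendstoD) (use assms in auto)
  show ?thesis using e1 e2 eventually_ge_at_top[of 2]
  proof eventually_elim
    case (elim n)
    have D: "dd n > 0" using elim by (simp add: dd_def)
    have lam: "real n * bp (n - 1) i \<le> \<epsilon> * dd n / 2" for i
    proof -
      have "real n * bp (n - 1) i \<le> real n * (1 / sqrt (n - 1))"
        by (intro mult_left_mono bp_le_sqrt) (use elim in auto)
      also have "\<dots> \<le> \<epsilon> * dd n / 2"
      proof -
        have "real n / sqrt (real n - 1) / dd n < \<epsilon> / 2" using elim(2) by (simp add: dd_def)
        then have "real n / sqrt (real n - 1) < \<epsilon> / 2 * dd n" using D by (subst (asm) pos_divide_less_eq)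
        then show ?thesis using elim(3) by (simp add: of_nat_diff)
      qed
      finally show ?thesis .
    qed
    have "pr n (\<lambda>G. \<exists>i. \<epsilon> * dd n \<le> real (degcount n G i)) \<le>
      pr n (\<lambda>G. \<exists>i\<in>{..<n}. \<epsilon> * dd n / 2 \<le> \<bar>real (degcount n G i) - real n * bp (n - 1) i\<bar>)"
    proof (rule pr_mono)
      fix G assume G: "G \<in> graphs_on n" and "\<exists>i. \<epsilon> * dd n \<le> real (degcount n G i)"
      then obtain i where i: "\<epsilon> * dd n \<le> real (degcount n G i)" by blast
      have "i < n" using degcount_eq_0[OF G, of i] i mult_pos_pos[OF assms D] by (rule_tac ccontr) auto
      moreover have "\<epsilon> * dd n / 2 \<le> \<bar>real (degcount n G i) - real n * bp (n - 1) i\<bar>"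
        using i lam[of i] by linarith
      ultimately show "\<exists>i\<in>{..<n}. \<epsilon> * dd n / 2 \<le> \<bar>real (degcount n G i) - real n * bp (n - 1) i\<bar>" by blast
    qed
    also have "\<dots> \<le> (\<Sum>i<n. pr n (\<lambda>G. \<epsilon> * dd n / 2 \<le> \<bar>real (degcount n G i) - real n * bp (n - 1) i\<bar>))"
      by (rule pr_Bex_le) simp
    also have "\<dots> \<le> (\<Sum>i<n. avg n (\<lambda>G. (real (degcount n G i) - real n * bp (n - 1) i)\<^sup>2) / (\<epsilon> * dd n / 2)\<^sup>2)"
      by (intro sum_mono pr_chebyshev) (use D assms in auto)
    also have "\<dots> \<le> 2 * real n / (\<epsilon> * dd n / 2)\<^sup>2"
      unfolding sum_divide_distrib[symmetric]
      by (intro divide_right_mono sum_var_degcount) (use elim in auto)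
    also have "\<dots> = 8 / (\<epsilon>\<^sup>2 * ln n)"
      using elim assms by (simp add: dd_def power_divide power_mult_distrib)
    finally show ?case using elim by linarith
  qed
qed

text \<open>Relative concentration. Of the two terms in \<open>var_degcount\<close>, the first is
  small against the squared mean because the mean is large, the second because neighbouring binomial
  probabilities nearly agree.\<close>

lemma window_var:
  assumes "0 < \<delta>" "\<delta> < 1" "0 < \<eta>"
  shows "\<forall>\<^sub>F n in sequentially. \<forall>i. \<bar>real i - real n / 2\<bar> \<le> (1 - \<delta>) * dd n / 2 + 2 \<longrightarrow>
     K \<le> real n * bp (n - 1) i \<and>
     avg n (\<lambda>G. (real (degcount n G i) - real n * bp (n - 1) i)\<^sup>2) \<le> \<eta> * (real n * bp (n - 1) i)\<^sup>2"
proof -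
  \<comment> \<open>Capped at 1 so that
    \<open>\<theta>^2 \<le> \<theta> \<le> \<eta>\<close>.\<close>
  define \<theta> where "\<theta> = min 1 \<eta>"
  have \<theta>: "0 < \<theta>" "\<theta> \<le> 1" "\<theta> \<le> \<eta>" using assms by (auto simp: \<theta>_def)
  show ?thesis
    \<comment> \<open>The factor 2 pays for passing from \<open>n - 2\<close> to
      \<open>n - 1\<close> trials: \<open>p = (a + b) / 2\<close> only gives
      \<open>p \<ge> a / 2\<close>.\<close>
    using window_lower[OF assms(1,2), of "2 * max K (2 / \<eta>)"] window_ratio[OF \<theta>(1)] eventually_ge_at_top[of 4]
  proof eventually_elim
    case (elim n)
    show ?case
    proof (intro allI impI)
      fix i assume i: "\<bar>real i - real n / 2\<bar> \<le> (1 - \<delta>) * dd n / 2 + 2"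
      have D0: "0 \<le> dd n" using elim by (simp add: dd_def)
      have "(1 - \<delta>) * dd n \<le> 1 * dd n" using assms D0 by (intro mult_right_mono) auto
      then have i3: "\<bar>real i - real n / 2\<bar> \<le> dd n + 3" using i D0 by linarith
      then have "\<bar>real i - real n / 2\<bar> \<le> dd n + 4" by linarith
      then have i4: "4 \<le> i" using elim(2)[rule_format, of i "n - 1"] elim(3) by simp
      define a where "a = bp (n - 2) i"
      define b where "b = bp_pred (n - 2) i"
      define p where "p = bp (n - 1) i"
      have b': "b = bp (n - 2) (i - 1)" using i4 by (simp add: b_def bp_pred_def)
      have pab: "p = (a + b) / 2" unfolding p_def a_def b_def
        using bp_Suc_eq[of "n - 2" i] elim(3) by (simp add: Suc_diff_Suc numeral_2_eq_2)
      have ab0: "0 \<le> a" "0 \<le> b" by (auto simp: a_def b')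
      have im: "\<bar>real (i - 1) - real n / 2\<bar> \<le> dd n + 4" using i3 i4 by (simp add: of_nat_diff)
      have "a \<le> (1 + \<theta>) * b" "b \<le> (1 + \<theta>) * a"
        using elim(2)[rule_format, OF im, of "n - 2"] i4 elim(3) by (auto simp: a_def b')
      then have "\<bar>a - b\<bar> \<le> \<theta> * p"
      proof -
        have "a \<le> b \<Longrightarrow> \<theta> * a \<le> \<theta> * p" "b \<le> a \<Longrightarrow> \<theta> * b \<le> \<theta> * p"
          using \<theta> by (auto simp: pab intro!: mult_left_mono)
        then show ?thesis using \<open>a \<le> (1 + \<theta>) * b\<close> \<open>b \<le> (1 + \<theta>) * a\<close>
          unfolding distrib_right by (cases "a \<le> b") linarith+
      qed
      then have "(a - b)\<^sup>2 \<le> (\<theta> * p)\<^sup>2" by (simp add: abs_le_square_iff[symmetric])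
      also have "\<dots> \<le> \<eta> * p\<^sup>2"
      proof -
        have "\<theta>\<^sup>2 \<le> \<theta>" using \<theta> by (simp add: power2_eq_square mult_left_le)
        then show ?thesis using \<theta> by (auto simp: power_mult_distrib intro!: mult_right_mono)
      qed
      finally have ab: "(a - b)\<^sup>2 \<le> \<eta> * p\<^sup>2" .
      have "2 * max K (2 / \<eta>) \<le> real n * a" using elim(1) i by (simp add: a_def)
      moreover have "real n * a \<le> 2 * (real n * p)" using ab0 by (simp add: pab algebra_simps)
      ultimately have lam: "max K (2 / \<eta>) \<le> real n * p" by linarith
      have "avg n (\<lambda>G. (real (degcount n G i) - real n * bp (n - 1) i)\<^sup>2) \<le> real n * p + (real n)\<^sup>2 / 4 * (a - b)\<^sup>2"
        using var_degcount[of n i] elim(3) by (simp add: a_def b_def p_def)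
      also have "\<dots> \<le> \<eta> / 2 * (real n * p)\<^sup>2 + (real n)\<^sup>2 / 4 * (\<eta> * p\<^sup>2)"
      proof (intro add_mono mult_left_mono ab)
        have "1 \<le> \<eta> / 2 * (real n * p)" using lam assms by (simp add: field_simps)
        then have "1 * (real n * p) \<le> \<eta> / 2 * (real n * p) * (real n * p)"
          using ab0 by (intro mult_right_mono) (auto simp: pab)
        then show "real n * p \<le> \<eta> / 2 * (real n * p)\<^sup>2" by (simp add: power2_eq_square mult.assoc)
      qed auto
      also have "\<dots> = 3 / 4 * \<eta> * (real n * p)\<^sup>2" by (simp add: power_mult_distrib)
      also have "\<dots> \<le> 1 * \<eta> * (real n * p)\<^sup>2" using assms by (intro mult_right_mono) auto
      finally show "K \<le> real n * bp (n - 1) i \<and>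
        avg n (\<lambda>G. (real (degcount n G i) - real n * bp (n - 1) i)\<^sup>2) \<le> \<eta> * (real n * bp (n - 1) i)\<^sup>2"
        using lam by (simp add: p_def)
    qed
  qed
qed

subsection \<open>Ratios of consecutive degree counts\<close>

lemma avg_insert_edge:
  assumes "e \<in> edges_on n"
  shows "avg n (\<lambda>G. of_bool (e \<in> G) * f G) = avg n (\<lambda>G. of_bool (e \<notin> G) * f (insert e G))"
proof -
  have "(\<Sum>G\<in>graphs_on n. of_bool (e \<in> G) * f G) = (\<Sum>G\<in>{G \<in> graphs_on n. e \<in> G}. f G)"
    by (rule sum.mono_neutral_cong_right) auto
  also have "\<dots> = (\<Sum>G\<in>{G \<in> graphs_on n. e \<notin> G}. f (insert e G))"
    by (rule sum.reindex_bij_witness[where i = "insert e" and j = "\<lambda>G. G - {e}"])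
       (use assms in \<open>auto simp: graphs_on_eq insert_absorb\<close>)
  also have "\<dots> = (\<Sum>G\<in>graphs_on n. of_bool (e \<notin> G) * f (insert e G))"
    by (rule sum.mono_neutral_cong_left) auto
  finally show ?thesis by (simp add: avg_def)
qed

lemma degcount_insert_edge:
  assumes "G \<in> graphs_on n" "{u, v} \<notin> G"
  shows "degcount n G i \<le> degcount n (insert {u, v} G) i + 2"
proof -
  let ?H = "insert {u, v} G"
  have "{x \<in> {1..n}. vertex_degree G x = i} \<subseteq> {x \<in> {1..n}. vertex_degree ?H x = i} \<union> {u, v}"
    using vertex_degree_insert[OF graphs_on_finite[OF assms(1)] assms(2)] by auto
  then have "degcount n G i \<le> card ({x \<in> {1..n}. vertex_degree ?H x = i} \<union> {u, v})"
    unfolding degcount_def by (rule card_mono[rotated]) auto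
  also have "\<dots> \<le> degcount n ?H i + card {u, v}" unfolding degcount_def by (rule card_Un_le)
  also have "card {u, v} \<le> 2" by (simp add: card_insert_if)
  finally show ?thesis by simp
qed

lemma degcount_Suc_mult:
  assumes "G \<in> graphs_on n"
  shows "real (degcount n G i) * real i =
    (\<Sum>u\<in>{1..n}. \<Sum>v\<in>{1..n} - {u}. of_bool ({u, v} \<in> G) * of_bool (vertex_degree G u = i))"
proof -
  have "(\<Sum>v\<in>{1..n} - {u}. of_bool ({u, v} \<in> G)) = real (vertex_degree G u)" for u
  proof -
    have "(\<Sum>v\<in>{1..n} - {u}. of_bool ({u, v} \<in> G)) = real (card {v \<in> {1..n} - {u}. {u, v} \<in> G})"
      by (simp add: of_bool_def sum.If_cases Int_def)
    also have "{v \<in> {1..n} - {u}. {u, v} \<in> G} = nbrs G u"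
      using nbrs_subset[OF assms, of u] by (auto simp: nbrs_def)
    finally show ?thesis by (simp add: card_nbrs[OF assms])
  qed
  then have "(\<Sum>u\<in>{1..n}. \<Sum>v\<in>{1..n} - {u}. of_bool ({u, v} \<in> G) * of_bool (vertex_degree G u = i)) =
    (\<Sum>u\<in>{1..n}. real (vertex_degree G u) * of_bool (vertex_degree G u = i))"
    unfolding sum_distrib_right[symmetric] by simp
  also have "\<dots> = (\<Sum>u\<in>{1..n}. of_bool (vertex_degree G u = i) * real i)"
    by (rule sum.cong) auto
  finally show ?thesis by (simp add: degcount_eq_sum sum_distrib_right)
qed

lemma degcount_mult_nonadjacent:
  assumes "G \<in> graphs_on n" "i < n"
  shows "real (degcount n G i) * real (n - 1 - i) =
    (\<Sum>u\<in>{1..n}. \<Sum>v\<in>{1..n} - {u}. of_bool ({u, v} \<notin> G) * of_bool (vertex_degree G u = i))"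
proof -
  have *: "(\<Sum>v\<in>{1..n} - {u}. of_bool ({u, v} \<notin> G)) = real (n - 1 - vertex_degree G u)"
    if u: "u \<in> {1..n}" for u
  proof -
    have "(\<Sum>v\<in>{1..n} - {u}. of_bool ({u, v} \<notin> G)) = real (card {v \<in> {1..n} - {u}. {u, v} \<notin> G})"
      by (simp add: of_bool_def sum.If_cases Int_def)
    also have "{v \<in> {1..n} - {u}. {u, v} \<notin> G} = ({1..n} - {u}) - nbrs G u"
      by (auto simp: nbrs_def)
    also have "card \<dots> = card ({1..n} - {u}) - card (nbrs G u)"
      using nbrs_subset[OF assms(1)] finite_nbrs[OF assms(1)] by (intro card_Diff_subset) auto
    finally show ?thesis using u by (simp add: card_nbrs[OF assms(1)])
  qed
  have "(\<Sum>u\<in>{1..n}. \<Sum>v\<in>{1..n} - {u}. of_bool ({u, v} \<notin> G) * of_bool (vertex_degree G u = i)) =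
    (\<Sum>u\<in>{1..n}. real (n - 1 - vertex_degree G u) * of_bool (vertex_degree G u = i))"
    unfolding sum_distrib_right[symmetric] by (intro sum.cong refl) (simp only: *)
  also have "\<dots> = (\<Sum>u\<in>{1..n}. of_bool (vertex_degree G u = i) * real (n - 1 - i))"
    by (rule sum.cong) auto
  finally show ?thesis by (simp add: degcount_eq_sum sum_distrib_right)
qed

text \<open>Double counting of the pairs \<open>(G, uv)\<close> with \<open>u\<close> of degree \<open>i + 1\<close> in \<open>G\<close>: deleting \<open>uv\<close> makes \<open>u\<close>
  a vertex of degree \<open>i\<close>, and this changes \<open>degcount n G i\<close> by at most two.\<close>

lemma avg_degcount_ratio:
  assumes "i < n"
  shows "avg n (\<lambda>G. of_bool (Q (degcount n G i)) * (real (degcount n G (Suc i)) / (real (degcount n G i) + 1)))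
      * real (Suc i) \<le>
    2 * real (n - 1 - i) * pr n (\<lambda>G. \<exists>m. Q m \<and> degcount n G i \<le> m + 2)"
proof -
  \<comment> \<open>\<open>w\<close> weights a graph that contains \<open>uv\<close>, and
    \<open>w'\<close> bounds this weight from the graph without \<open>uv\<close>. If the latter has
    \<open>N \<ge> 1\<close> vertices of degree \<open>i\<close>, the former has at least
    \<open>N - 2\<close>, and \<open>max 1 (N - 1) \<ge> N / 2\<close>. The condition
    \<open>Q\<close> is loosened by the same two.\<close>
  define w where "w = (\<lambda>G. of_bool (Q (degcount n G i)) / (real (degcount n G i) + 1))"
  define w' where "w' = (\<lambda>G. of_bool (\<exists>m. Q m \<and> degcount n G i \<le> m + 2) * (2 / real (degcount n G i)))"
  have step: "avg n (\<lambda>G. of_bool ({u, v} \<in> G) * (of_bool (vertex_degree G u = Suc i) * w G)) \<le>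
    avg n (\<lambda>G. of_bool ({u, v} \<notin> G) * (of_bool (vertex_degree G u = i) * w' G))"
    if uv: "u \<in> {1..n}" "v \<in> {1..n} - {u}" for u v
  proof -
    have e: "{u, v} \<in> edges_on n" using uv by (auto simp: doubleton_in_edges_on)
    show ?thesis
      unfolding avg_insert_edge[OF e]
    proof (rule avg_mono)
      fix G assume G: "G \<in> graphs_on n"
      let ?H = "insert {u, v} G"
      show "of_bool ({u, v} \<notin> G) * (of_bool (vertex_degree ?H u = Suc i) * w ?H) \<le>
        of_bool ({u, v} \<notin> G) * (of_bool (vertex_degree G u = i) * w' G)"
      proof (cases "{u, v} \<notin> G \<and> vertex_degree G u = i")
        case True
        have "u \<in> {x \<in> {1..n}. vertex_degree G x = i}" using True uv by auto
        then have "0 < degcount n G i" unfolding degcount_def by (subst card_gt_0_iff) auto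
        moreover have le: "degcount n G i \<le> degcount n ?H i + 2"
          using degcount_insert_edge[OF G] True by blast
        ultimately have "real (degcount n G i) / 2 \<le> real (degcount n ?H i) + 1" by linarith
        then have "1 / (real (degcount n ?H i) + 1) \<le> 2 / real (degcount n G i)"
          using \<open>0 < degcount n G i\<close> by (simp add: field_simps)
        moreover have "Q (degcount n ?H i) \<Longrightarrow> \<exists>m. Q m \<and> degcount n G i \<le> m + 2" using le by blast
        ultimately have "w ?H \<le> w' G" unfolding w_def w'_def by (auto simp: of_bool_def)
        moreover have "0 \<le> w' G" by (simp add: w'_def)
        ultimately show ?thesis using True by simp
      next
        case False
        then show ?thesis using vertex_degree_insert[OF graphs_on_finite[OF G], of "{u, v}" u] by auto
      qed
    qed
  qed
  have "avg n (\<lambda>G. of_bool (Q (degcount n G i)) * (real (degcount n G (Suc i)) / (real (degcount n G i) + 1)))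
      * real (Suc i) = avg n (\<lambda>G. (real (degcount n G (Suc i)) * real (Suc i)) * w G)"
    by (subst mult.commute, subst avg_cmult[symmetric]) (rule avg_cong, simp add: w_def)
  also have "\<dots> = avg n (\<lambda>G. \<Sum>u\<in>{1..n}. \<Sum>v\<in>{1..n} - {u}.
      of_bool ({u, v} \<in> G) * (of_bool (vertex_degree G u = Suc i) * w G))"
    by (rule avg_cong) (simp only: degcount_Suc_mult sum_distrib_right mult.assoc)
  also have "\<dots> \<le> avg n (\<lambda>G. \<Sum>u\<in>{1..n}. \<Sum>v\<in>{1..n} - {u}.
      of_bool ({u, v} \<notin> G) * (of_bool (vertex_degree G u = i) * w' G))"
    unfolding avg_sum by (intro sum_mono step)
  also have "\<dots> = avg n (\<lambda>G. (real (degcount n G i) * real (n - 1 - i)) * w' G)"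
    by (rule avg_cong) (simp only: degcount_mult_nonadjacent[OF _ assms] sum_distrib_right mult.assoc)
  also have "\<dots> \<le> avg n (\<lambda>G. (2 * real (n - 1 - i)) * of_bool (\<exists>m. Q m \<and> degcount n G i \<le> m + 2))"
    by (rule avg_mono) (auto simp: w'_def)
  also have "\<dots> = 2 * real (n - 1 - i) * pr n (\<lambda>G. \<exists>m. Q m \<and> degcount n G i \<le> m + 2)"
    unfolding avg_cmult pr_def ..
  finally show ?thesis .
qed

text \<open>The unit in the denominator is more than a guard against empty classes: a switching that
  raises one vertex of degree \<open>i\<close> lowers that count by one, so the count before it is
  the count after it plus one.\<close>

definition rsum :: "nat \<Rightarrow> graph \<Rightarrow> real" where
  "rsum n G = (\<Sum>i<n. real (degcount n G (Suc i)) / (real (degcount n G i) + 1))"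

lemma card_nat_interval_le:
  fixes a b :: real
  assumes "a \<le> b"
  shows "real (card {i::nat. a \<le> real i \<and> real i \<le> b}) \<le> b - a + 1"
proof -
  let ?S = "{i::nat. a \<le> real i \<and> real i \<le> b}"
  have fin: "finite ?S"
    by (rule finite_subset[of _ "{..nat \<lfloor>b\<rfloor>}"]) (auto simp: le_nat_floor)
  show ?thesis
  proof (cases "?S = {}")
    case False
    have "?S \<subseteq> {Min ?S..Max ?S}" using fin by auto
    then have "card ?S \<le> card {Min ?S..Max ?S}" by (rule card_mono[rotated]) auto
    then have "real (card ?S) \<le> real (Max ?S) - real (Min ?S) + 1"
      using Min_le[OF fin Max_in[OF fin False]] by simp
    moreover have "real (Max ?S) \<le> b" "a \<le> real (Min ?S)" using Max_in[OF fin False] Min_in[OF fin False] by auto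
    ultimately show ?thesis by linarith
  next
    case True
    show ?thesis using assms unfolding True by simp
  qed
qed

lemma card_window_le:
  fixes c r :: real
  assumes "0 \<le> r"
  shows "real (card {i. i < n \<and> \<bar>real i - c\<bar> \<le> r}) \<le> 2 * r + 1"
proof -
  have "{i. i < n \<and> \<bar>real i - c\<bar> \<le> r} \<subseteq> {i. c - r \<le> real i \<and> real i \<le> c + r}" by auto
  moreover have "finite {i. c - r \<le> real i \<and> real i \<le> c + r}"
    by (rule finite_subset[of _ "{..nat \<lfloor>c + r\<rfloor>}"]) (auto simp: le_nat_floor)
  ultimately have "card {i. i < n \<and> \<bar>real i - c\<bar> \<le> r} \<le> card {i. c - r \<le> real i \<and> real i \<le> c + r}"
    by (rule card_mono[rotated])
  then show ?thesis using card_nat_interval_le[of "c - r" "c + r"] assms by simp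
qed

lemma card_annulus_le:
  fixes c r s :: real
  assumes "r \<le> s"
  shows "real (card {i. i < n \<and> r < \<bar>real i - c\<bar> \<and> \<bar>real i - c\<bar> \<le> s}) \<le> 2 * (s - r + 1)"
proof -
  let ?A = "{i. c + r \<le> real i \<and> real i \<le> c + s}" and ?B = "{i. c - s \<le> real i \<and> real i \<le> c - r}"
  have fin: "finite ?A" "finite ?B"
    by (rule finite_subset[of _ "{..nat \<lfloor>c + s\<rfloor>}"], auto simp: le_nat_floor)
       (rule finite_subset[of _ "{..nat \<lfloor>c - r\<rfloor>}"], auto simp: le_nat_floor)
  have "{i. i < n \<and> r < \<bar>real i - c\<bar> \<and> \<bar>real i - c\<bar> \<le> s} \<subseteq> ?A \<union> ?B" by auto
  then have "card {i. i < n \<and> r < \<bar>real i - c\<bar> \<and> \<bar>real i - c\<bar> \<le> s} \<le> card (?A \<union> ?B)"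
    by (rule card_mono[rotated]) (use fin in auto)
  also have "\<dots> \<le> card ?A + card ?B" by (rule card_Un_le)
  finally show ?thesis using card_nat_interval_le[of "c + r" "c + s"] card_nat_interval_le[of "c - s" "c - r"] assms
    by simp
qed

text \<open>Beyond the window Hoeffding's exponent is at least \<open>ln n / 2\<close>, so at most
  \<open>2 * sqrt n\<close> vertices are expected there, which is small against
  \<open>dd n\<close>.\<close>

lemma avg_degcount_tail:
  assumes "0 < \<delta>"
  shows "\<forall>\<^sub>F n in sequentially. (\<Sum>i | i < n \<and> (1 + \<delta>) * dd n / 2 < \<bar>real i - real n / 2\<bar>.
     avg n (\<lambda>G. real (degcount n G (Suc i)))) \<le> \<delta> * dd n"
proof -
  \<comment> \<open>Two units of slack: passing from \<open>i\<close> and \<open>n\<close> to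
    \<open>Suc i\<close> and \<open>n - 1\<close> moves the deviation by 3 / 2.\<close>
  define t where "t = (\<lambda>n::nat. (1 + \<delta>) * dd n / 2 - 2)"
  have lim: "(\<lambda>n::nat. 2 * (t n)\<^sup>2 / (real n - 1) / ln n) \<longlonglongrightarrow> (1 + \<delta>)\<^sup>2 / 2"
  proof -
    have "(\<lambda>n::nat. 2 * (c * dd n / 2 - 2)\<^sup>2 / (real n - 1) / ln n) \<longlonglongrightarrow> c\<^sup>2 / 2"
      if "0 < c" for c :: real
      unfolding dd_def using that by (real_asymp simp: field_simps power2_eq_square)
    from this[of "1 + \<delta>"] assms show ?thesis by (simp add: t_def)
  qed
  have "(1 + \<delta>)\<^sup>2 / 2 > 1 / 2" using assms by (simp add: power2_eq_square algebra_simps add_pos_pos)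
  from order_tendstoD(1)[OF lim this]
  have e1: "\<forall>\<^sub>F n in sequentially. 1 / 2 < 2 * (t n)\<^sup>2 / (real n - 1) / ln n" .
  have e2: "\<forall>\<^sub>F n in sequentially. 0 < t n" using assms unfolding t_def dd_def by real_asymp
  have "(\<lambda>n::nat. 2 * n * (1 / sqrt n) / dd n) \<longlonglongrightarrow> 0" unfolding dd_def by real_asymp
  then have e3: "\<forall>\<^sub>F n::nat in sequentially. 2 * n * (1 / sqrt n) / dd n < \<delta>"
    by (rule order_tendstoD) (use assms in auto)
  show ?thesis using e1 e2 e3 eventually_ge_at_top[of 4]
  proof eventually_elim
    case (elim n)
    let ?O = "{i. i < n \<and> (1 + \<delta>) * dd n / 2 < \<bar>real i - real n / 2\<bar>}"
    let ?T = "{k. k \<le> n - 1 \<and> t n \<le> \<bar>real k - real (n - 1) / 2\<bar>}"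
    have D: "dd n > 0" using elim by (simp add: dd_def)
    have n1: "real (n - 1) = real n - 1" using elim by (simp add: of_nat_diff)
    have "(\<Sum>i\<in>?O. avg n (\<lambda>G. real (degcount n G (Suc i)))) = real n * (\<Sum>i\<in>?O. bp (n - 1) (Suc i))"
      by (simp only: avg_degcount sum_distrib_left)
    also have "(\<Sum>i\<in>?O. bp (n - 1) (Suc i)) = (\<Sum>k\<in>Suc ` ?O. bp (n - 1) k)"
      by (simp add: sum.reindex)
    also have "\<dots> = (\<Sum>k\<in>Suc ` ?O \<inter> {..n - 1}. bp (n - 1) k)"
      by (rule sum.mono_neutral_right) (auto simp: bp_def binomial_eq_0)
    also have "\<dots> \<le> (\<Sum>k\<in>?T. bp (n - 1) k)"
    proof (rule sum_mono2)
      show "Suc ` ?O \<inter> {..n - 1} \<subseteq> ?T"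
      proof
        fix k assume "k \<in> Suc ` ?O \<inter> {..n - 1}"
        then obtain i where i: "k = Suc i" "i < n" "(1 + \<delta>) * dd n / 2 < \<bar>real i - real n / 2\<bar>" "k \<le> n - 1" by auto
        have "real k - real (n - 1) / 2 = real i - real n / 2 + 3 / 2" unfolding n1 i(1) by (simp add: field_simps)
        then have "t n \<le> \<bar>real k - real (n - 1) / 2\<bar>" using i(3) unfolding t_def by linarith
        then show "k \<in> ?T" using i by simp
      qed
    qed auto
    also have "\<dots> \<le> 2 * exp (- 2 * (t n)\<^sup>2 / real (n - 1))"
      by (rule bp_tail) (use elim in auto)
    also have "\<dots> \<le> 2 * (1 / sqrt n)"
    proof -
      have ln: "ln (real n) > 0" using elim by simp
      have "ln n / 2 \<le> 2 * (t n)\<^sup>2 / (real n - 1)"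
        using pos_less_divide_eq[THEN iffD1, OF ln elim(1)] by simp
      then have "exp (- (2 * (t n)\<^sup>2 / (real n - 1))) \<le> exp (- (ln n / 2))" by simp
      also have "exp (- (ln (real n) / 2)) = 1 / sqrt n"
        using elim by (simp add: exp_minus powr_half_sqrt[symmetric] powr_def inverse_eq_divide)
      finally show ?thesis unfolding n1 by simp
    qed
    finally have "(\<Sum>i\<in>?O. avg n (\<lambda>G. real (degcount n G (Suc i)))) \<le> real n * (2 * (1 / sqrt n))"
      by (simp add: mult_left_mono)
    also have "\<dots> \<le> \<delta> * dd n"
      using pos_divide_less_eq[THEN iffD1, OF D elim(3)] by (simp add: mult_ac)
    finally show ?case .
  qed
qed

text \<open>\<open>W\<close>, \<open>M\<close> and \<open>X\<close> stand for the window, its border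
  and the outside. In \<open>W\<close> a ratio can be large for two reasons only: a large count of
  degree \<open>i + 1\<close>, measured by its relative deviation, or a small count of degree
  \<open>i\<close>, in which case the whole ratio is put into the error. On \<open>X\<close> the
  denominator is merely at least 1. The constant 3 bounds
  \<open>(1 + \<delta>) / (1 - \<delta>)\<close>.\<close>

lemma rsum_le_window:
  assumes \<delta>: "0 < \<delta>" "\<delta> \<le> 1 / 2"
    and lam: "\<And>i. i \<in> W \<Longrightarrow> 0 < lam i \<and> 0 < lam (Suc i) \<and> lam (Suc i) \<le> (1 + \<delta>) * lam i"
    and fin: "finite W" "finite M" "finite X" and sub: "{..<n} \<subseteq> W \<union> M \<union> X"
    and N: "\<And>i. N i = real (degcount n G i)"
  shows "rsum n G \<le> real (card W) * ((1 + \<delta>) / (1 - \<delta>)) +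
    ((\<Sum>i\<in>W. 3 * (\<bar>N (Suc i) - lam (Suc i)\<bar> / lam (Suc i)) +
        of_bool (N i + 1 < (1 - \<delta>) * lam i) * (N (Suc i) / (N i + 1))) +
     (\<Sum>i\<in>M. N (Suc i) / (N i + 1)) + (\<Sum>i\<in>X. N (Suc i)))"
proof -
  let ?r = "\<lambda>i. N (Suc i) / (N i + 1)"
  have N0: "0 \<le> N i" for i by (simp add: N)
  have r0: "0 \<le> ?r i" for i using N0[of i] N0[of "Suc i"] by simp
  have c3: "(1 + \<delta>) / (1 - \<delta>) \<le> 3" using \<delta> by (simp add: field_simps)
  have c0: "0 \<le> (1 + \<delta>) / (1 - \<delta>)" using \<delta> by simp
  have W: "?r i \<le> (1 + \<delta>) / (1 - \<delta>) + (3 * (\<bar>N (Suc i) - lam (Suc i)\<bar> / lam (Suc i)) +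
        of_bool (N i + 1 < (1 - \<delta>) * lam i) * ?r i)" if i: "i \<in> W" for i
  proof (cases "N i + 1 < (1 - \<delta>) * lam i")
    case True
    have "0 \<le> \<bar>N (Suc i) - lam (Suc i)\<bar> / lam (Suc i)" using lam[OF i] by simp
    then show ?thesis using True c0 by simp
  next
    case False
    let ?x = "\<bar>N (Suc i) - lam (Suc i)\<bar> / lam (Suc i)"
    have "?r i \<le> N (Suc i) / ((1 - \<delta>) * lam i)"
      by (rule divide_left_mono) (use False N0 lam[OF i] \<delta> in \<open>auto intro!: mult_pos_pos add_nonneg_pos\<close>)
    also have "\<dots> \<le> N (Suc i) / ((1 - \<delta>) * (lam (Suc i) / (1 + \<delta>)))"
      by (intro divide_left_mono mult_left_mono mult_pos_pos)
         (use N0 lam[OF i] \<delta> in \<open>auto simp: pos_divide_le_eq mult.commute\<close>)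
    also have "\<dots> = (1 + \<delta>) / (1 - \<delta>) * (N (Suc i) / lam (Suc i))"
      by simp
    also have "\<dots> \<le> (1 + \<delta>) / (1 - \<delta>) * (1 + ?x)"
    proof (rule mult_left_mono[OF _ c0])
      have "N (Suc i) / lam (Suc i) \<le> (lam (Suc i) + \<bar>N (Suc i) - lam (Suc i)\<bar>) / lam (Suc i)"
        by (rule divide_right_mono) (use lam[OF i] in auto)
      then show "N (Suc i) / lam (Suc i) \<le> 1 + ?x" using lam[OF i] by (simp add: add_divide_distrib)
    qed
    also have "\<dots> \<le> (1 + \<delta>) / (1 - \<delta>) + 3 * ?x"
    proof -
      have "(1 + \<delta>) / (1 - \<delta>) * ?x \<le> 3 * ?x" by (rule mult_right_mono[OF c3]) (use lam[OF i] in auto)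
      then show ?thesis unfolding distrib_left mult_1_right by linarith
    qed
    finally show ?thesis using False by simp
  qed
  have X: "?r i \<le> N (Suc i)" for i
    using N0[of i] N0[of "Suc i"] by (simp add: pos_divide_le_eq add_nonneg_pos mult_left_mono distrib_left)
  have "rsum n G = (\<Sum>i<n. ?r i)" by (simp add: rsum_def N)
  also have "\<dots> \<le> (\<Sum>i\<in>W \<union> M \<union> X. ?r i)"
    by (rule sum_mono2) (use fin sub r0 in auto)
  also have "\<dots> \<le> (\<Sum>i\<in>W. ?r i) + (\<Sum>i\<in>M. ?r i) + (\<Sum>i\<in>X. ?r i)"
  proof -
    have "sum ?r (A \<union> B) \<le> sum ?r A + sum ?r B" if "finite A" "finite B" for A B
      using sum.union_inter[OF that, of ?r] sum_nonneg[of "A \<inter> B" ?r] r0 by simp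
    then show ?thesis using fin by (meson add_mono_thms_linordered_semiring(1) finite_UnI order.trans order_refl)
  qed
  also have "(\<Sum>i\<in>W. ?r i) \<le> (\<Sum>i\<in>W. (1 + \<delta>) / (1 - \<delta>) + (3 * (\<bar>N (Suc i) - lam (Suc i)\<bar> / lam (Suc i)) +
        of_bool (N i + 1 < (1 - \<delta>) * lam i) * ?r i))"
    by (rule sum_mono) (rule W)
  also have "(\<Sum>i\<in>X. ?r i) \<le> (\<Sum>i\<in>X. N (Suc i))" by (rule sum_mono) (rule X)
  finally show ?thesis by (simp add: sum.distrib add.assoc)
qed

text \<open>The window contributes its width times a factor near 1. The error terms of
  \<open>rsum_le_window\<close> form \<open>Y\<close>, whose mean is at most
  \<open>13 * \<delta> * D\<close>, and Markov's inequality finishes. As only the mean of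
  \<open>Y\<close> matters, no concentration is required on the border.\<close>

lemma rsum_bound:
  assumes \<epsilon>: "0 < \<epsilon>"
  shows "\<forall>\<^sub>F n in sequentially. pr n (\<lambda>G. (1 + \<epsilon>) * dd n \<le> rsum n G) \<le> \<epsilon>"
proof -
  \<comment> \<open>Makes Markov's bound \<open>26 * \<delta> / \<epsilon>\<close> at most
    \<open>\<epsilon>\<close>; \<open>\<epsilon> / 4\<close> is for the main term.\<close>
  define \<delta> where "\<delta> = min (1 / 2) (min (\<epsilon>\<^sup>2 / 26) (\<epsilon> / 4))"
  have \<delta>: "0 < \<delta>" "\<delta> \<le> 1 / 2" "\<delta> < 1" "\<delta> \<le> \<epsilon>\<^sup>2 / 26" "\<delta> \<le> \<epsilon> / 4" using assms by (auto simp: \<delta>_def)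
  \<comment> \<open>Chebyshev's inequality in \<open>a2\<close> yields
    \<open>16 * \<eta> / \<delta>^2\<close>, which becomes \<open>\<delta>\<close>.\<close>
  define \<eta> where "\<eta> = \<delta> ^ 3 / 16"
  have \<eta>: "0 < \<eta>" using \<delta> by (simp add: \<eta>_def)
  have e0: "\<forall>\<^sub>F n in sequentially. 10 \<le> \<delta> * dd n" using \<delta>(1) unfolding dd_def by real_asymp
  have e5: "\<forall>\<^sub>F n in sequentially. 3 \<le> \<epsilon> / 4 * dd n" using \<epsilon> unfolding dd_def by real_asymp
  show ?thesis
    using window_var[OF \<delta>(1,3) \<eta>, of "2 / \<delta>"] window_ratio[OF \<delta>(1)] avg_degcount_tail[OF \<delta>(1)] e0 e5
      eventually_ge_at_top[of 4]
  proof eventually_elim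
    case (elim n)
    define D where "D = dd n"
    define lam where "lam = (\<lambda>i. real n * bp (n - 1) i)"
    define N where "N = (\<lambda>G i. real (degcount n G i))"
    define W where "W = {i. i < n \<and> \<bar>real i - real n / 2\<bar> \<le> (1 - \<delta>) * D / 2}"
    define M where "M = {i. i < n \<and> (1 - \<delta>) * D / 2 < \<bar>real i - real n / 2\<bar> \<and> \<bar>real i - real n / 2\<bar> \<le> (1 + \<delta>) * D / 2}"
    define X where "X = {i. i < n \<and> (1 + \<delta>) * D / 2 < \<bar>real i - real n / 2\<bar>}"
    have D0: "0 < D" using elim(6) by (simp add: D_def dd_def)
    have bd: "(1 - \<delta>) * D / 2 \<le> D" "(1 + \<delta>) * D / 2 \<le> D"
      using \<delta> D0 mult_right_mono[of "1 - \<delta>" 2 D] mult_right_mono[of "1 + \<delta>" 2 D] by linarith+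
    have cW: "real (card W) \<le> (1 - \<delta>) * D + 1"
      unfolding W_def using card_window_le[of "(1 - \<delta>) * D / 2" n "real n / 2"] \<delta> D0 by simp
    have cM: "real (card M) \<le> 2 * (\<delta> * D + 1)"
    proof -
      have *: "(1 - \<delta>) * D / 2 \<le> (1 + \<delta>) * D / 2" using \<delta> D0 by (simp add: mult_right_mono)
      have "(1 + \<delta>) * D / 2 - (1 - \<delta>) * D / 2 = \<delta> * D" by (simp add: field_simps)
      then show ?thesis unfolding M_def using card_annulus_le[OF *, of n "real n / 2"] by simp
    qed
    have ratio: "real (n - 1 - i) \<le> 2 * real (Suc i) \<and> bp (n - 1) (Suc i) \<le> (1 + \<delta>) * bp (n - 1) i"
      if "\<bar>real i - real n / 2\<bar> \<le> D" for i
    proof -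
      have "\<bar>real i - real n / 2\<bar> \<le> dd n + 4" using that by (simp add: D_def)
      then show ?thesis using elim(2)[rule_format, of i "n - 1"] elim(6) by auto
    qed
    have wv: "2 / \<delta> \<le> lam i \<and> avg n (\<lambda>G. (N G i - lam i)\<^sup>2) \<le> \<eta> * (lam i)\<^sup>2"
      if "\<bar>real i - real n / 2\<bar> \<le> (1 - \<delta>) * D / 2 + 2" for i
      using elim(1)[rule_format, of i] that by (simp add: D_def N_def lam_def)
    have win: "2 / \<delta> \<le> lam i" "avg n (\<lambda>G. (N G i - lam i)\<^sup>2) \<le> \<eta> * (lam i)\<^sup>2"
      "2 / \<delta> \<le> lam (Suc i)" "avg n (\<lambda>G. (N G (Suc i) - lam (Suc i))\<^sup>2) \<le> \<eta> * (lam (Suc i))\<^sup>2"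
      if "i \<in> W" for i
    proof -
      have *: "\<bar>real i - real n / 2\<bar> \<le> (1 - \<delta>) * D / 2" using that by (simp add: W_def)
      have "\<bar>real i - real n / 2\<bar> \<le> (1 - \<delta>) * D / 2 + 2" using * by linarith
      from wv[OF this] show "2 / \<delta> \<le> lam i" "avg n (\<lambda>G. (N G i - lam i)\<^sup>2) \<le> \<eta> * (lam i)\<^sup>2" by auto
      have "\<bar>real (Suc i) - real n / 2\<bar> \<le> (1 - \<delta>) * D / 2 + 2" using * unfolding of_nat_Suc by linarith
      from wv[OF this] show "2 / \<delta> \<le> lam (Suc i)" "avg n (\<lambda>G. (N G (Suc i) - lam (Suc i))\<^sup>2) \<le> \<eta> * (lam (Suc i))\<^sup>2" by auto
    qed
    have pos: "0 < 2 / \<delta>" using \<delta> by simp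
    define Y where "Y = (\<lambda>G. (\<Sum>i\<in>W. 3 * (\<bar>N G (Suc i) - lam (Suc i)\<bar> / lam (Suc i)) +
        of_bool (N G i + 1 < (1 - \<delta>) * lam i) * (N G (Suc i) / (N G i + 1))) +
     (\<Sum>i\<in>M. N G (Suc i) / (N G i + 1)) + (\<Sum>i\<in>X. N G (Suc i)))"
    have lampos: "0 < lam i \<and> 0 < lam (Suc i) \<and> lam (Suc i) \<le> (1 + \<delta>) * lam i" if i: "i \<in> W" for i
    proof -
      have "\<bar>real i - real n / 2\<bar> \<le> D" using i bd by (simp add: W_def)
      then have "lam (Suc i) \<le> (1 + \<delta>) * lam i"
        using ratio[of i] by (simp add: lam_def mult.left_commute mult_left_mono)
      then show ?thesis using win(1,3)[OF i] pos by linarith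
    qed
    have Rle: "rsum n G \<le> real (card W) * ((1 + \<delta>) / (1 - \<delta>)) + Y G" for G
      unfolding Y_def
      by (rule rsum_le_window[where lam = lam, OF \<delta>(1,2)], erule lampos) (auto simp: W_def M_def X_def N_def)
    have a1: "avg n (\<lambda>G. 3 * (\<bar>N G (Suc i) - lam (Suc i)\<bar> / lam (Suc i))) \<le> \<delta>" if i: "i \<in> W" for i
    proof -
      have l: "0 < lam (Suc i)" using lampos[OF i] by simp
      have "(avg n (\<lambda>G. \<bar>N G (Suc i) - lam (Suc i)\<bar>))\<^sup>2 \<le> avg n (\<lambda>G. \<bar>N G (Suc i) - lam (Suc i)\<bar>\<^sup>2)"
        by (rule avg_power2_le)
      also have "\<dots> \<le> \<eta> * (lam (Suc i))\<^sup>2" using win(4)[OF i] by simp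
      also have "\<dots> \<le> (\<delta> / 3 * lam (Suc i))\<^sup>2"
      proof -
        have "\<delta> ^ 3 \<le> \<delta>\<^sup>2" using \<delta> by (simp add: power_decreasing)
        moreover have "(\<delta> / 3)\<^sup>2 = \<delta>\<^sup>2 / 9" by (simp add: power_divide)
        ultimately have "\<eta> \<le> (\<delta> / 3)\<^sup>2" using zero_le_power2[of \<delta>] unfolding \<eta>_def by linarith
        then show ?thesis unfolding power_mult_distrib by (rule mult_right_mono) simp
      qed
      finally have "avg n (\<lambda>G. \<bar>N G (Suc i) - lam (Suc i)\<bar>) \<le> \<delta> / 3 * lam (Suc i)"
        by (rule power2_le_imp_le) (use \<delta> l in auto)
      then have "3 / lam (Suc i) * avg n (\<lambda>G. \<bar>N G (Suc i) - lam (Suc i)\<bar>) \<le> \<delta>"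
        using l by (simp add: field_simps)
      then show ?thesis unfolding avg_cmult[symmetric] by (simp add: mult.commute)
    qed
    have rat: "avg n (\<lambda>G. of_bool (Q (degcount n G i)) * (N G (Suc i) / (N G i + 1))) \<le>
       4 * pr n (\<lambda>G. \<exists>m. Q m \<and> degcount n G i \<le> m + 2)"
      if i: "i < n" "\<bar>real i - real n / 2\<bar> \<le> D" for i Q
    proof -
      let ?a = "avg n (\<lambda>G. of_bool (Q (degcount n G i)) * (N G (Suc i) / (N G i + 1)))"
      let ?p = "pr n (\<lambda>G. \<exists>m. Q m \<and> degcount n G i \<le> m + 2)"
      have "?a * real (Suc i) \<le> 2 * real (n - 1 - i) * ?p"
        unfolding N_def by (rule avg_degcount_ratio[OF i(1)])
      also have "\<dots> \<le> 2 * (2 * real (Suc i)) * ?p"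
        using ratio[OF i(2)] by (intro mult_right_mono mult_left_mono) auto
      also have "\<dots> = (4 * ?p) * real (Suc i)" by simp
      finally show ?thesis by (rule mult_right_le_imp_le) simp
    qed
    \<comment> \<open>A low count is rare, and \<open>avg_degcount_ratio\<close> bounds the mean of
      the ratio on this event by a multiple of a probability, although the ratio itself may be
      huge.\<close>
    have a2: "avg n (\<lambda>G. of_bool (N G i + 1 < (1 - \<delta>) * lam i) * (N G (Suc i) / (N G i + 1))) \<le> \<delta>"
      if i: "i \<in> W" for i
    proof -
      have l: "0 < lam i" "2 \<le> \<delta> * lam i" using lampos[OF i] win(1)[OF i] \<delta> by (auto simp: field_simps)
      have "avg n (\<lambda>G. of_bool (real (degcount n G i) + 1 < (1 - \<delta>) * lam i) * (N G (Suc i) / (N G i + 1))) \<le>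
        4 * pr n (\<lambda>G. \<exists>m. real m + 1 < (1 - \<delta>) * lam i \<and> degcount n G i \<le> m + 2)"
        by (rule rat) (use i bd in \<open>auto simp: W_def\<close>)
      also have "\<dots> \<le> 4 * pr n (\<lambda>G. \<delta> * lam i / 2 \<le> \<bar>N G i - lam i\<bar>)"
      proof (intro mult_left_mono pr_mono)
        fix G assume "\<exists>m. real m + 1 < (1 - \<delta>) * lam i \<and> degcount n G i \<le> m + 2"
        then obtain m where "real m + 1 < lam i - \<delta> * lam i" "real (degcount n G i) \<le> real m + 2"
          by (auto simp: left_diff_distrib)
        then have "N G i \<le> lam i - \<delta> * lam i + 1" unfolding N_def by linarith
        then show "\<delta> * lam i / 2 \<le> \<bar>N G i - lam i\<bar>" using l by linarith
      qed simp
      also have "\<dots> \<le> 4 * (avg n (\<lambda>G. (N G i - lam i)\<^sup>2) / (\<delta> * lam i / 2)\<^sup>2)"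
        by (intro mult_left_mono pr_chebyshev) (use \<delta> l in auto)
      also have "\<dots> \<le> 4 * (\<eta> * (lam i)\<^sup>2 / (\<delta> * lam i / 2)\<^sup>2)"
        by (intro mult_left_mono divide_right_mono win(2)[OF i]) auto
      also have "\<dots> = \<delta>" using l \<delta> by (simp add: \<eta>_def power2_eq_square power3_eq_cube)
      finally show ?thesis by (simp add: N_def)
    qed
    \<comment> \<open>A constant suffices on the border, which has only about
      \<open>2 * \<delta> * D\<close> degrees.\<close>
    have a3: "avg n (\<lambda>G. N G (Suc i) / (N G i + 1)) \<le> 4" if i: "i \<in> M" for i
    proof -
      have "avg n (\<lambda>G. of_bool True * (N G (Suc i) / (N G i + 1))) \<le> 4 * pr n (\<lambda>G. \<exists>m. True \<and> degcount n G i \<le> m + 2)"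
        by (rule rat) (use i bd in \<open>auto simp: M_def\<close>)
      also have "\<dots> \<le> 4 * 1" by (intro mult_left_mono pr_le_1) simp
      finally show ?thesis by simp
    qed
    have a4: "(\<Sum>i\<in>X. avg n (\<lambda>G. N G (Suc i))) \<le> \<delta> * D"
      using elim(3) by (simp add: X_def N_def D_def)
    have "avg n Y = (\<Sum>i\<in>W. avg n (\<lambda>G. 3 * (\<bar>N G (Suc i) - lam (Suc i)\<bar> / lam (Suc i))) +
        avg n (\<lambda>G. of_bool (N G i + 1 < (1 - \<delta>) * lam i) * (N G (Suc i) / (N G i + 1)))) +
     (\<Sum>i\<in>M. avg n (\<lambda>G. N G (Suc i) / (N G i + 1))) + (\<Sum>i\<in>X. avg n (\<lambda>G. N G (Suc i)))"
      unfolding Y_def avg_add avg_sum ..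
    also have "\<dots> \<le> (\<Sum>i\<in>W. \<delta> + \<delta>) + (\<Sum>i\<in>M. 4) + \<delta> * D"
      by (intro add_mono sum_mono a1 a2 a3 a4)
    also have "\<dots> = 2 * \<delta> * real (card W) + 4 * real (card M) + \<delta> * D" by simp
    also have "\<dots> \<le> 2 * \<delta> * D + 4 * (2 * (\<delta> * D + 1)) + \<delta> * D"
    proof -
      have "(1 - \<delta>) * D + 1 \<le> D" using elim(4) by (simp add: D_def algebra_simps)
      then have "real (card W) \<le> D" using cW by linarith
      then have "2 * \<delta> * real (card W) \<le> 2 * \<delta> * D" using \<delta> by (intro mult_left_mono) auto
      then show ?thesis using cM by linarith
    qed
    \<comment> \<open>The left side is \<open>11 * \<delta> * D + 8\<close>, and
      \<open>\<delta> * D\<close> is at least 10.\<close>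
    also have "\<dots> \<le> 13 * \<delta> * D" using elim(4) by (simp add: D_def)
    finally have EY: "avg n Y \<le> 13 * \<delta> * D" .
    have Y0: "0 \<le> Y G" for G
      unfolding Y_def N_def
      by (intro add_nonneg_nonneg sum_nonneg mult_nonneg_nonneg divide_nonneg_nonneg)
         (use lampos in \<open>auto simp: less_imp_le\<close>)
    have Wc: "real (card W) * ((1 + \<delta>) / (1 - \<delta>)) \<le> (1 + \<delta>) * D + 3"
    proof -
      have "real (card W) * ((1 + \<delta>) / (1 - \<delta>)) \<le> ((1 - \<delta>) * D + 1) * ((1 + \<delta>) / (1 - \<delta>))"
        by (rule mult_right_mono[OF cW]) (use \<delta> in auto)
      also have "\<dots> = (1 + \<delta>) * D + (1 + \<delta>) / (1 - \<delta>)" using \<delta> by (simp add: field_simps)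
      also have "(1 + \<delta>) / (1 - \<delta>) \<le> 3" using \<delta> by (simp add: field_simps)
      finally show ?thesis by simp
    qed
    have "pr n (\<lambda>G. (1 + \<epsilon>) * D \<le> rsum n G) \<le> pr n (\<lambda>G. \<epsilon> / 2 * D \<le> Y G)"
    proof (rule pr_mono)
      fix G assume "(1 + \<epsilon>) * D \<le> rsum n G"
      then have "(1 + \<epsilon>) * D \<le> (1 + \<delta>) * D + 3 + Y G" using Rle[of G] Wc by linarith
      moreover have "\<delta> * D \<le> \<epsilon> / 4 * D" using \<delta> D0 by (intro mult_right_mono) auto
      moreover have "3 \<le> \<epsilon> / 4 * D" using elim(5) by (simp add: D_def)
      ultimately show "\<epsilon> / 2 * D \<le> Y G" by (simp add: algebra_simps)
    qed
    also have "\<dots> \<le> avg n Y / (\<epsilon> / 2 * D)"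
      by (rule pr_markov) (use Y0 \<epsilon> D0 in auto)
    also have "\<dots> \<le> (13 * \<delta> * D) / (\<epsilon> / 2 * D)"
      by (rule divide_right_mono[OF EY]) (use \<epsilon> D0 in auto)
    also have "\<dots> = 26 * \<delta> / \<epsilon>" using D0 by simp
    also have "\<dots> \<le> \<epsilon>" using \<delta>(4) \<epsilon> by (simp add: field_simps power2_eq_square)
    finally show ?case by (simp add: D_def)
  qed
qed

subsection \<open>Degrees and codegrees\<close>

text \<open>The trace on \<open>A\<close> of a uniform subset of \<open>W\<close> is a uniform
  subset of \<open>A\<close>, so its size is binomial and \<open>bp_tail\<close> applies.\<close>

lemma sum_half_intersection_le:
  assumes "finite W" "A \<subseteq> W" "0 < t"
  shows "(\<Sum>B\<in>Pow W. of_bool (t \<le> \<bar>real (card (B \<inter> A)) - real (card A) / 2\<bar>))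
    \<le> 2 * exp (- 2 * t\<^sup>2 / real (card A)) * 2 ^ card W"
proof (cases "A = {}")
  case True
  then show ?thesis using assms by simp
next
  case False
  have finA: "finite A" using assms finite_subset by blast
  let ?a = "card A"
  have a0: "0 < ?a" using False finA by (simp add: card_gt_0_iff)
  let ?P = "\<lambda>k. t \<le> \<bar>real k - real ?a / 2\<bar>"
  have W: "W = A \<union> (W - A)" using assms by auto
  have "(\<Sum>B\<in>Pow (A \<union> (W - A)). of_bool (?P (card (B \<inter> A))) :: real) =
     (\<Sum>S\<in>Pow A. \<Sum>B\<in>Pow (W - A). of_bool (?P (card ((S \<union> B) \<inter> A))))"
    by (rule sum_Pow_Un) (use assms finA in auto)
  also have "\<dots> = (\<Sum>S\<in>Pow A. \<Sum>B\<in>Pow (W - A). of_bool (?P (card S)))"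
  proof (intro sum.cong refl)
    fix S B assume "S \<in> Pow A" "B \<in> Pow (W - A)"
    then have "(S \<union> B) \<inter> A = S" by auto
    then show "(of_bool (?P (card ((S \<union> B) \<inter> A))) :: real) = of_bool (?P (card S))" by simp
  qed
  also have "\<dots> = 2 ^ card (W - A) * (\<Sum>S\<in>Pow A. of_bool (?P (card S)))"
    using assms by (simp add: card_Pow sum_distrib_left)
  also have "(\<Sum>S\<in>Pow A. of_bool (?P (card S)) :: real) = (\<Sum>k\<in>{k. k \<le> ?a \<and> ?P k}. real (?a choose k))"
  proof -
    have "(\<Sum>S\<in>Pow A. of_bool (?P (card S)) :: real) = real (card {S \<in> Pow A. ?P (card S)})"
      using finA by (simp add: of_bool_def sum.If_cases Int_def)
    also have "{S \<in> Pow A. ?P (card S)} = (\<Union>k\<in>{k. k \<le> ?a \<and> ?P k}. {S. S \<subseteq> A \<and> card S = k})"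
      using card_mono[OF finA] by auto
    also have "card \<dots> = (\<Sum>k\<in>{k. k \<le> ?a \<and> ?P k}. card {S. S \<subseteq> A \<and> card S = k})"
    proof (rule card_UN_disjoint)
      show "\<forall>k\<in>{k. k \<le> ?a \<and> ?P k}. finite {S. S \<subseteq> A \<and> card S = k}"
        using finA by (auto intro: finite_subset[of _ "Pow A"])
    qed auto
    finally show ?thesis using finA by (simp add: n_subsets)
  qed
  also have "\<dots> = 2 ^ ?a * (\<Sum>k\<in>{k. k \<le> ?a \<and> ?P k}. bp ?a k)"
    by (simp add: bp_def sum_distrib_left)
  also have "2 ^ card (W - A) * (2 ^ ?a * (\<Sum>k\<in>{k. k \<le> ?a \<and> ?P k}. bp ?a k)) \<le>
      2 ^ card (W - A) * (2 ^ ?a * (2 * exp (- 2 * t\<^sup>2 / real ?a)))"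
    by (intro mult_left_mono bp_tail) (use a0 assms in auto)
  also have "\<dots> = 2 * exp (- 2 * t\<^sup>2 / real ?a) * 2 ^ card W"
  proof -
    have "card W = card (W - A) + ?a"
      using assms finA card_mono[OF assms(1,2)] by (simp add: card_Diff_subset)
    then show ?thesis by (simp add: power_add)
  qed
  finally show ?thesis using W by simp
qed

text \<open>Expose first the edges not at \<open>v\<close>. By \<open>dep\<close> they determine
  \<open>A G\<close>, a set of edges at \<open>v\<close>, which is then hit by an independent
  uniform subset of the star.\<close>

lemma pr_star_half:
  assumes v: "v \<in> {1..n}" and t: "0 < t"
    and A: "\<And>G. G \<in> graphs_on n \<Longrightarrow> A G \<subseteq> star n {v} v"
    and dep: "\<And>G. G \<in> graphs_on n \<Longrightarrow> A G = A (G - star n {v} v)"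
  shows "pr n (\<lambda>G. t \<le> \<bar>real (card (G \<inter> A G)) - real (card (A G)) / 2\<bar>) \<le> 2 * exp (- 2 * t\<^sup>2 / real n)"
proof -
  let ?R = "star n {v} v"
  define C where "C = edges_on n - ?R"
  have R: "?R \<subseteq> edges_on n" using v by (intro star_subset) auto
  have E: "edges_on n = C \<union> ?R" "C \<inter> ?R = {}" using R by (auto simp: C_def)
  let ?P = "\<lambda>G. t \<le> \<bar>real (card (G \<inter> A G)) - real (card (A G)) / 2\<bar>"
  have bound: "(\<Sum>B\<in>Pow ?R. of_bool (?P (S \<union> B))) \<le> 2 * exp (- 2 * t\<^sup>2 / real n) * 2 ^ card ?R"
    if S: "S \<in> Pow C" for S
  proof -
    have SG: "S \<in> graphs_on n" using S E by (auto simp: graphs_on_eq)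
    have eq: "(\<Sum>B\<in>Pow ?R. of_bool (?P (S \<union> B)) :: real) =
      (\<Sum>B\<in>Pow ?R. of_bool (t \<le> \<bar>real (card (B \<inter> A S)) - real (card (A S)) / 2\<bar>))"
    proof (rule sum.cong[OF refl])
      fix B assume B: "B \<in> Pow ?R"
      have "S \<union> B \<in> graphs_on n" using S B E by (auto simp: graphs_on_eq)
      moreover have "(S \<union> B) - ?R = S" using S B E by auto
      ultimately have AS: "A (S \<union> B) = A S" using dep by metis
      moreover have "(S \<union> B) \<inter> A S = B \<inter> A S" using S A[OF SG] E by auto
      ultimately show "(of_bool (?P (S \<union> B)) :: real) =
          of_bool (t \<le> \<bar>real (card (B \<inter> A S)) - real (card (A S)) / 2\<bar>)" by simp
    qed
    note eq
    also have "(\<Sum>B\<in>Pow ?R. of_bool (t \<le> \<bar>real (card (B \<inter> A S)) - real (card (A S)) / 2\<bar>)) \<le>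
       2 * exp (- 2 * t\<^sup>2 / real (card (A S))) * 2 ^ card ?R"
      by (rule sum_half_intersection_le) (use t A[OF SG] in auto)
    finally have main: "(\<Sum>B\<in>Pow ?R. of_bool (?P (S \<union> B))) \<le> 2 * exp (- 2 * t\<^sup>2 / real (card (A S))) * 2 ^ card ?R" .
    show ?thesis
    proof (cases "A S = {}")
      case True
      then show ?thesis unfolding eq using t by simp
    next
      case False
      have "card (A S) \<le> card ?R" by (rule card_mono) (use A[OF SG] in auto)
      also have "\<dots> \<le> n" using v by (simp add: card_star)
      finally have "card (A S) \<le> n" .
      moreover have "0 < card (A S)" using False A[OF SG] finite_subset finite_star by (metis card_gt_0_iff)
      ultimately have "2 * t\<^sup>2 / real n \<le> 2 * t\<^sup>2 / real (card (A S))" by (intro divide_left_mono) auto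
      then have "2 * exp (- 2 * t\<^sup>2 / real (card (A S))) * 2 ^ card ?R \<le> 2 * exp (- 2 * t\<^sup>2 / real n) * 2 ^ card ?R"
        by simp
      then show ?thesis using main by linarith
    qed
  qed
  have "(\<Sum>G\<in>graphs_on n. of_bool (?P G) :: real) = (\<Sum>S\<in>Pow C. \<Sum>B\<in>Pow ?R. of_bool (?P (S \<union> B)))"
    unfolding graphs_on_eq E(1) by (rule sum_Pow_Un) (use E in \<open>auto simp: C_def\<close>)
  also have "\<dots> \<le> (\<Sum>S\<in>Pow C. 2 * exp (- 2 * t\<^sup>2 / real n) * 2 ^ card ?R)"
    by (rule sum_mono) (rule bound)
  also have "\<dots> = 2 * exp (- 2 * t\<^sup>2 / real n) * 2 ^ (card C + card ?R)"
    by (simp add: card_Pow C_def power_add)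
  also have "card C + card ?R = n choose 2"
    unfolding card_edges_on[symmetric] E(1) using E by (subst card_Un_disjoint) (auto simp: C_def)
  finally show ?thesis unfolding pr_def avg_def by (simp add: field_simps)
qed

definition codegree :: "graph \<Rightarrow> nat \<Rightarrow> nat \<Rightarrow> nat" where
  "codegree G x v = card (nbrs G x \<inter> nbrs G v)"

text \<open>These quantities determine the number of switchings at any pair of vertices up to a
  factor near 1, see \<open>card_up_ge\<close> and \<open>card_down_le\<close>.\<close>

definition pseudorandom :: "nat \<Rightarrow> real \<Rightarrow> graph \<Rightarrow> bool" where
  "pseudorandom n \<delta> G \<longleftrightarrow>
     (\<forall>v\<in>{1..n}. \<bar>real (vertex_degree G v) - real n / 2\<bar> \<le> \<delta> * n) \<and>
     (\<forall>x\<in>{1..n}. \<forall>v\<in>{1..n}. x \<noteq> v \<longrightarrow> \<bar>real (codegree G x v) - real n / 4\<bar> \<le> \<delta> * n)"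

lemma pr_degree_far:
  assumes "v \<in> {1..n}" "0 < t"
  shows "pr n (\<lambda>G. t \<le> \<bar>real (vertex_degree G v) - real (n - 1) / 2\<bar>) \<le> 2 * exp (- 2 * t\<^sup>2 / real n)"
proof -
  have "pr n (\<lambda>G. t \<le> \<bar>real (vertex_degree G v) - real (n - 1) / 2\<bar>) =
    pr n (\<lambda>G. t \<le> \<bar>real (card (G \<inter> star n {v} v)) - real (card (star n {v} v)) / 2\<bar>)"
    by (rule pr_cong) (use assms vertex_degree_split[of _ n "{v}" v] in \<open>simp add: inner_degree_singleton card_star\<close>)
  also have "\<dots> \<le> 2 * exp (- 2 * t\<^sup>2 / real n)"
    by (rule pr_star_half[OF assms, of "\<lambda>_. star n {v} v"]) auto
  finally show ?thesis .
qed

text \<open>The edges away from \<open>v\<close> fix the neighbours of \<open>x\<close> other than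
  \<open>v\<close>, and each of these is joined to \<open>v\<close> with probability 1 / 2.\<close>

lemma pr_codegree_far:
  assumes "v \<in> {1..n}" "x \<noteq> v" "0 < t"
  shows "pr n (\<lambda>G. t \<le> \<bar>real (codegree G x v) - real (card (nbrs G x - {v})) / 2\<bar>)
    \<le> 2 * exp (- 2 * t\<^sup>2 / real n)"
proof -
  define A where "A = (\<lambda>G. (\<lambda>w. {v, w}) ` (nbrs G x - {v}))"
  have inj: "inj_on (\<lambda>w. {v, w}) S" for S by (rule inj_onI) (auto simp: doubleton_eq_iff)
  have "pr n (\<lambda>G. t \<le> \<bar>real (codegree G x v) - real (card (nbrs G x - {v})) / 2\<bar>) =
    pr n (\<lambda>G. t \<le> \<bar>real (card (G \<inter> A G)) - real (card (A G)) / 2\<bar>)"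
  proof (rule pr_cong)
    fix G assume G: "G \<in> graphs_on n"
    have "G \<inter> A G = (\<lambda>w. {v, w}) ` (nbrs G x \<inter> nbrs G v)"
      using nbrs_subset[OF G, of v] by (auto simp: A_def nbrs_def)
    then have "card (G \<inter> A G) = codegree G x v" by (simp add: card_image[OF inj] codegree_def)
    moreover have "card (A G) = card (nbrs G x - {v})" by (simp add: A_def card_image[OF inj])
    ultimately show "(t \<le> \<bar>real (codegree G x v) - real (card (nbrs G x - {v})) / 2\<bar>) =
        (t \<le> \<bar>real (card (G \<inter> A G)) - real (card (A G)) / 2\<bar>)" by simp
  qed
  also have "\<dots> \<le> 2 * exp (- 2 * t\<^sup>2 / real n)"
  proof (rule pr_star_half[OF assms(1,3)])
    fix G assume G: "G \<in> graphs_on n"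
    show "A G \<subseteq> star n {v} v" using nbrs_subset[OF G, of x] by (auto simp: A_def star_def)
    have "nbrs G x - {v} = nbrs (G - star n {v} v) x - {v}"
      using assms(2) by (auto simp: nbrs_def star_def doubleton_eq_iff)
    then show "A G = A (G - star n {v} v)" by (simp add: A_def)
  qed
  finally show ?thesis .
qed

lemma pseudorandom_whp:
  assumes "0 < \<delta>"
  shows "\<forall>\<^sub>F n in sequentially. pr n (\<lambda>G. \<not> pseudorandom n \<delta> G) \<le> \<delta>"
proof -
  have "(\<lambda>n::nat. (real n + (real n)\<^sup>2) * (2 * exp (- 2 * (\<delta> * n / 4)\<^sup>2 / n))) \<longlonglongrightarrow> 0"
    using assms by real_asymp
  then have e1: "\<forall>\<^sub>F n::nat in sequentially. (real n + (real n)\<^sup>2) * (2 * exp (- 2 * (\<delta> * n / 4)\<^sup>2 / n)) < \<delta>"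
    by (rule order_tendstoD) (use assms in auto)
  have e2: "\<forall>\<^sub>F n::nat in sequentially. 4 \<le> \<delta> * n" using assms by real_asymp
  show ?thesis using e1 e2 eventually_ge_at_top[of 1]
  proof eventually_elim
    case (elim n)
    \<comment> \<open>Error budget: degrees are within \<open>2 * t\<close> of \<open>n / 2\<close>;
      a codegree adds its own \<open>t\<close> to about half of a degree error, in all at most
      \<open>4 * t = \<delta> * n\<close>.\<close>
    define t where "t = \<delta> * real n / 4"
    have t: "0 < t" "1 \<le> t" using elim assms by (auto simp: t_def)
    let ?P1 = "\<lambda>G. \<exists>v\<in>{1..n}. t \<le> \<bar>real (vertex_degree G v) - real (n - 1) / 2\<bar>"
    let ?Q = "\<lambda>p G. fst p \<noteq> snd p \<and> t \<le> \<bar>real (codegree G (fst p) (snd p)) - real (card (nbrs G (fst p) - {snd p})) / 2\<bar>"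
    let ?P2 = "\<lambda>G. \<exists>p\<in>{1..n} \<times> {1..n}. ?Q p G"
    have "pr n (\<lambda>G. \<not> pseudorandom n \<delta> G) \<le> pr n (\<lambda>G. ?P1 G \<or> ?P2 G)"
    proof (rule pr_mono)
      fix G assume G: "G \<in> graphs_on n" and np: "\<not> pseudorandom n \<delta> G"
      show "?P1 G \<or> ?P2 G"
      proof (rule ccontr)
        assume neg: "\<not> (?P1 G \<or> ?P2 G)"
        have d: "\<bar>real (vertex_degree G v) - real n / 2\<bar> \<le> 2 * t" if "v \<in> {1..n}" for v
        proof -
          have "\<bar>real (vertex_degree G v) - real (n - 1) / 2\<bar> < t" using neg that by force
          moreover have "real (n - 1) / 2 = real n / 2 - 1 / 2" using elim(3) by (simp add: of_nat_diff diff_divide_distrib)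
          ultimately show ?thesis using t by linarith
        qed
        have c: "\<bar>real (codegree G x v) - real n / 4\<bar> \<le> 4 * t" if "x \<in> {1..n}" "v \<in> {1..n}" "x \<noteq> v" for x v
        proof -
          have 1: "\<bar>real (codegree G x v) - real (card (nbrs G x - {v})) / 2\<bar> < t" using neg that by force
          have "card (nbrs G x) - 1 \<le> card (nbrs G x - {v})" using finite_nbrs[OF G] by (simp add: card_Diff_singleton_if)
          moreover have "card (nbrs G x - {v}) \<le> card (nbrs G x)" using finite_nbrs[OF G] by (intro card_mono) auto
          ultimately have 2: "real (vertex_degree G x) - 1 \<le> real (card (nbrs G x - {v}))"
             "real (card (nbrs G x - {v})) \<le> real (vertex_degree G x)" unfolding card_nbrs[OF G] by linarith+
          show ?thesis using 1 2 d[OF that(1)] t by (simp add: abs_le_iff abs_less_iff)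
        qed
        have "pseudorandom n \<delta> G"
          unfolding pseudorandom_def
        proof (intro conjI ballI impI)
          fix v assume "v \<in> {1..n}"
          from d[OF this] show "\<bar>real (vertex_degree G v) - real n / 2\<bar> \<le> \<delta> * n" using t by (simp add: t_def)
        next
          fix x v assume "x \<in> {1..n}" "v \<in> {1..n}" "x \<noteq> v"
          from c[OF this] show "\<bar>real (codegree G x v) - real n / 4\<bar> \<le> \<delta> * n" by (simp add: t_def)
        qed
        then show False using np by simp
      qed
    qed
    also have "\<dots> \<le> pr n ?P1 + pr n ?P2" by (rule pr_disj_le)
    also have "pr n ?P1 \<le> (\<Sum>v\<in>{1..n}. pr n (\<lambda>G. t \<le> \<bar>real (vertex_degree G v) - real (n - 1) / 2\<bar>))"
      by (rule pr_Bex_le) simp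
    also have "\<dots> \<le> (\<Sum>v\<in>{1..n}. 2 * exp (- 2 * t\<^sup>2 / real n))"
      by (rule sum_mono) (rule pr_degree_far[OF _ t(1)])
    also have "pr n ?P2 \<le> (\<Sum>p\<in>{1..n} \<times> {1..n}. pr n (?Q p))"
      by (rule pr_Bex_le) simp
    also have "\<dots> \<le> (\<Sum>p\<in>{1..n} \<times> {1..n}. 2 * exp (- 2 * t\<^sup>2 / real n))"
    proof (rule sum_mono)
      fix p assume "p \<in> {1..n} \<times> {1..n}"
      then show "pr n (?Q p) \<le> 2 * exp (- 2 * t\<^sup>2 / real n)"
        using pr_codegree_far[of "snd p" n "fst p" t] t by (cases "fst p = snd p") auto
    qed
    finally have "pr n (\<lambda>G. \<not> pseudorandom n \<delta> G) \<le> (real n + (real n)\<^sup>2) * (2 * exp (- 2 * t\<^sup>2 / real n))"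
      by (simp add: power2_eq_square algebra_simps)
    then show ?case using elim(1) unfolding t_def by linarith
  qed
qed

subsection \<open>Switchings\<close>

definition pairs :: "nat \<Rightarrow> graph \<Rightarrow> nat \<Rightarrow> nat \<Rightarrow> (nat \<times> nat) set" where
  "pairs n G i j = {(u, v). u \<in> {1..n} \<and> v \<in> {1..n} \<and> u \<noteq> v \<and> vertex_degree G u = i \<and> vertex_degree G v = j}"

text \<open>The switchings available at \<open>p = (u, v)\<close>: the edge \<open>xy\<close> is to
  be replaced by \<open>ux\<close> and \<open>vy\<close>. \<open>down\<close> lists the reverse
  moves.\<close>

definition up :: "graph \<Rightarrow> nat \<times> nat \<Rightarrow> nat \<Rightarrow> (nat \<times> nat) set" where
  "up G p n = {(x, y). x \<in> {1..n} \<and> y \<in> {1..n} \<and> fst p \<noteq> x \<and> snd p \<noteq> y \<and>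
     {fst p, x} \<notin> G \<and> {snd p, y} \<notin> G \<and> {x, y} \<in> G}"

definition down :: "graph \<Rightarrow> nat \<times> nat \<Rightarrow> nat \<Rightarrow> (nat \<times> nat) set" where
  "down G p n = {(x, y). x \<in> {1..n} \<and> y \<in> {1..n} \<and> x \<noteq> y \<and>
     {fst p, x} \<in> G \<and> {snd p, y} \<in> G \<and> {x, y} \<notin> G}"

text \<open>A switching raises the degrees of \<open>u\<close> and \<open>v\<close> by one and keeps all others. Unlike the number of edges
  between two degree classes, the number of switchings for given \<open>u\<close> and \<open>v\<close> is nearly constant.\<close>

definition switch :: "graph \<Rightarrow> (nat \<times> nat) \<times> (nat \<times> nat) \<Rightarrow> graph" where
  "switch G t = (case t of ((u, v), (x, y)) \<Rightarrow> insert {u, x} (insert {v, y} (G - {{x, y}})))"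

definition unswitch :: "graph \<Rightarrow> (nat \<times> nat) \<times> (nat \<times> nat) \<Rightarrow> graph" where
  "unswitch H t = (case t of ((u, v), (x, y)) \<Rightarrow> insert {x, y} (H - {{u, x}, {v, y}}))"

lemma switch_props:
  assumes G: "G \<in> graphs_on n" and uv: "u \<in> {1..n}" "v \<in> {1..n}" "u \<noteq> v"
    and xy: "(x, y) \<in> up G (u, v) n"
  shows "switch G ((u, v), (x, y)) \<in> graphs_on n"
    and "(x, y) \<in> down (switch G ((u, v), (x, y))) (u, v) n"
    and "unswitch (switch G ((u, v), (x, y))) ((u, v), (x, y)) = G"
    and "vertex_degree (switch G ((u, v), (x, y))) w = vertex_degree G w + of_bool (w = u \<or> w = v)"
proof -
  let ?H = "switch G ((u, v), (x, y))"
  have a: "x \<in> {1..n}" "y \<in> {1..n}" "u \<noteq> x" "v \<noteq> y" "{u, x} \<notin> G" "{v, y} \<notin> G" "{x, y} \<in> G"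
    using xy by (auto simp: up_def)
  \<comment> \<open>\<open>x = v\<close> would make \<open>xy\<close> and \<open>vy\<close> the same
    pair, an edge and a non-edge at once; likewise \<open>y = u\<close>.\<close>
  have b: "x \<noteq> y" "x \<noteq> v" "y \<noteq> u"
    using graphs_on_doubleton[OF G a(7)] a by (auto simp: insert_commute)
  show "?H \<in> graphs_on n"
    using G a b uv by (auto simp: switch_def graphs_on_eq doubleton_in_edges_on)
  show "(x, y) \<in> down ?H (u, v) n"
    using a b uv by (auto simp: down_def switch_def doubleton_eq_iff)
  show "unswitch ?H ((u, v), (x, y)) = G"
    using a b uv by (auto simp: unswitch_def switch_def doubleton_eq_iff)
  have fin: "finite G" by (rule graphs_on_finite[OF G])
  have "vertex_degree ?H w = vertex_degree (insert {v, y} (G - {{x, y}})) w + of_bool (w \<in> {u, x})"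
    unfolding switch_def prod.case by (rule vertex_degree_insert) (use fin a b uv in \<open>auto simp: doubleton_eq_iff\<close>)
  also have "vertex_degree (insert {v, y} (G - {{x, y}})) w = vertex_degree (G - {{x, y}}) w + of_bool (w \<in> {v, y})"
    by (rule vertex_degree_insert) (use fin a in auto)
  finally have "vertex_degree ?H w = vertex_degree (G - {{x, y}}) w + of_bool (w \<in> {v, y}) + of_bool (w \<in> {u, x})" .
  moreover have "vertex_degree G w = vertex_degree (G - {{x, y}}) w + of_bool (w \<in> {x, y})"
    by (rule vertex_degree_remove[OF fin a(7)])
  ultimately show "vertex_degree ?H w = vertex_degree G w + of_bool (w = u \<or> w = v)"
    using a b uv by (auto simp: of_bool_def)
qed

text \<open>Additions on both sides avoid truncated subtraction, and the identity also covers equal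
  or consecutive degrees of \<open>u\<close> and \<open>v\<close>.\<close>

lemma degcount_raise:
  assumes uv: "u \<in> {1..n}" "v \<in> {1..n}" "u \<noteq> v"
    and deg: "\<And>w. w \<in> {1..n} \<Longrightarrow> vertex_degree H w = vertex_degree G w + of_bool (w = u \<or> w = v)"
  shows "degcount n H k + of_bool (k = vertex_degree G u) + of_bool (k = vertex_degree G v) =
    degcount n G k + of_bool (k = Suc (vertex_degree G u)) + of_bool (k = Suc (vertex_degree G v))"
proof -
  have "real (degcount n H k) - real (degcount n G k) =
     (\<Sum>w\<in>{1..n}. of_bool (vertex_degree H w = k) - of_bool (vertex_degree G w = k))"
    by (simp add: degcount_eq_sum sum_subtractf)
  also have "\<dots> = (\<Sum>w\<in>{u, v}. of_bool (vertex_degree H w = k) - of_bool (vertex_degree G w = k))"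
    by (rule sum.mono_neutral_right) (use uv deg in auto)
  also have "\<dots> = of_bool (k = Suc (vertex_degree G u)) + of_bool (k = Suc (vertex_degree G v))
      - of_bool (k = vertex_degree G u) - of_bool (k = vertex_degree G v)"
    using uv deg by (auto simp: of_bool_def)
  finally have "real (degcount n H k + of_bool (k = vertex_degree G u) + of_bool (k = vertex_degree G v)) =
    real (degcount n G k + of_bool (k = Suc (vertex_degree G u)) + of_bool (k = Suc (vertex_degree G v)))"
    by simp
  then show ?thesis by (simp only: of_nat_eq_iff)
qed

lemma degcount_raise_le:
  assumes uv: "u \<in> {1..n}" "v \<in> {1..n}" "u \<noteq> v"
    and deg: "\<And>w. w \<in> {1..n} \<Longrightarrow> vertex_degree H w = vertex_degree G w + of_bool (w = u \<or> w = v)"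
  shows "degcount n H k \<le> degcount n G k + 2"
  using degcount_raise[OF assms, of k] by (auto simp: of_bool_def split: if_splits)

text \<open>At most four counts change, so at most six ratios do, and each new ratio is at most its
  numerator, hence at most \<open>K + 2\<close>.\<close>

lemma rsum_raise:
  assumes uv: "u \<in> {1..n}" "v \<in> {1..n}" "u \<noteq> v"
    and deg: "\<And>w. w \<in> {1..n} \<Longrightarrow> vertex_degree H w = vertex_degree G w + of_bool (w = u \<or> w = v)"
    and K: "\<And>i. real (degcount n G i) \<le> K"
  shows "rsum n H \<le> rsum n G + 6 * (K + 2)"
proof -
  let ?a = "vertex_degree G u" and ?b = "vertex_degree G v"
  define X where "X = {?a - 1, ?a, Suc ?a, ?b - 1, ?b, Suc ?b}"
  let ?r = "\<lambda>G i. real (degcount n G (Suc i)) / (real (degcount n G i) + 1)"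
  have X6: "card X \<le> 6" unfolding X_def by (simp add: card_insert_if)
  have K0: "0 \<le> K" using K[of 0] by linarith
  have same: "degcount n H k = degcount n G k" if "k \<noteq> ?a" "k \<noteq> Suc ?a" "k \<noteq> ?b" "k \<noteq> Suc ?b" for k
    using degcount_raise[OF uv deg, of k] that by simp
  have eq: "?r H i = ?r G i" if "i \<notin> X" for i
  proof -
    have "degcount n H i = degcount n G i" by (rule same) (use that in \<open>auto simp: X_def\<close>)
    moreover have "degcount n H (Suc i) = degcount n G (Suc i)" by (rule same) (use that in \<open>auto simp: X_def\<close>)
    ultimately show ?thesis by simp
  qed
  have le: "?r H i \<le> ?r G i + (K + 2) * of_bool (i \<in> X)" for i
  proof (cases "i \<in> X")
    case True
    have "?r H i \<le> real (degcount n H (Suc i))"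
      by (simp add: pos_divide_le_eq add_nonneg_pos mult_left_mono distrib_left)
    also have "\<dots> \<le> K + 2" using degcount_raise_le[OF uv deg, of "Suc i"] K[of "Suc i"] by linarith
    also have "\<dots> \<le> ?r G i + (K + 2)" by simp
    finally show ?thesis using True by simp
  qed (simp add: eq)
  have "rsum n H \<le> (\<Sum>i<n. ?r G i + (K + 2) * of_bool (i \<in> X))"
    unfolding rsum_def by (rule sum_mono) (rule le)
  also have "\<dots> = rsum n G + (K + 2) * real (card ({..<n} \<inter> X))"
    by (simp add: sum.distrib rsum_def sum_distrib_left[symmetric] of_bool_def sum.If_cases)
  also have "\<dots> \<le> rsum n G + (K + 2) * 6"
  proof -
    have "card ({..<n} \<inter> X) \<le> card X" by (rule card_mono) (auto simp: X_def)
    then show ?thesis using X6 K0 by (intro add_left_mono mult_left_mono) auto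
  qed
  finally show ?thesis by simp
qed

text \<open>Neighbourhoods change only by elements of \<open>{u, v, x, y}\<close>, so codegrees move
  by at most 4 and degrees by at most 1; the second \<open>\<delta> * n\<close> absorbs
  this.\<close>

lemma pseudorandom_switch:
  assumes G: "G \<in> graphs_on n" "pseudorandom n \<delta> G" and uv: "u \<in> {1..n}" "v \<in> {1..n}" "u \<noteq> v"
    and xy: "(x, y) \<in> up G (u, v) n" and n: "4 \<le> \<delta> * n"
  shows "pseudorandom n (2 * \<delta>) (switch G ((u, v), (x, y)))"
proof -
  let ?H = "switch G ((u, v), (x, y))" and ?S = "{u, v, x, y}"
  note sw = switch_props[OF G(1) uv xy]
  have S4: "card ?S \<le> 4" by (simp add: card_insert_if)
  have nb: "nbrs ?H w \<subseteq> nbrs G w \<union> ?S" "nbrs G w \<subseteq> nbrs ?H w \<union> ?S" for w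
    by (auto simp: nbrs_def switch_def doubleton_eq_iff)
  have cod: "codegree G1 a b \<le> codegree G2 a b + 4"
    if "nbrs G1 a \<subseteq> nbrs G2 a \<union> ?S" "nbrs G1 b \<subseteq> nbrs G2 b \<union> ?S" "G2 \<in> graphs_on n" for G1 G2 a b
  proof -
    have "nbrs G1 a \<inter> nbrs G1 b \<subseteq> (nbrs G2 a \<inter> nbrs G2 b) \<union> ?S" using that by blast
    then have "codegree G1 a b \<le> card ((nbrs G2 a \<inter> nbrs G2 b) \<union> ?S)"
      unfolding codegree_def by (rule card_mono[rotated]) (use finite_nbrs[OF that(3)] in auto)
    also have "\<dots> \<le> codegree G2 a b + card ?S" unfolding codegree_def by (rule card_Un_le)
    finally show ?thesis using S4 by linarith
  qed
  show ?thesis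
    unfolding pseudorandom_def
  proof (intro conjI ballI impI)
    fix w assume "w \<in> {1..n}"
    then have "\<bar>real (vertex_degree G w) - real n / 2\<bar> \<le> \<delta> * n" using G(2) by (simp add: pseudorandom_def)
    moreover have "real (vertex_degree ?H w) = real (vertex_degree G w) + of_bool (w = u \<or> w = v)"
      using sw(4)[of w] by simp
    moreover have "0 \<le> (of_bool (w = u \<or> w = v) :: real)" "(of_bool (w = u \<or> w = v) :: real) \<le> 1" by auto
    ultimately show "\<bar>real (vertex_degree ?H w) - real n / 2\<bar> \<le> 2 * \<delta> * n" using n by linarith
  next
    fix a b assume "a \<in> {1..n}" "b \<in> {1..n}" "a \<noteq> b"
    then have "\<bar>real (codegree G a b) - real n / 4\<bar> \<le> \<delta> * n" using G(2) by (simp add: pseudorandom_def)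
    moreover have "codegree G a b \<le> codegree ?H a b + 4" "codegree ?H a b \<le> codegree G a b + 4"
      using cod[OF nb(1) nb(1) G(1)] cod[OF nb(2) nb(2) sw(1)] by blast+
    ultimately show "\<bar>real (codegree ?H a b) - real n / 4\<bar> \<le> 2 * \<delta> * n" using n by linarith
  qed
qed

lemma card_nbrs_Diff:
  assumes "G \<in> graphs_on n"
  shows "real (card (nbrs G x - nbrs G v)) = real (vertex_degree G x) - real (codegree G x v)"
proof -
  have "card (nbrs G x - nbrs G v) = card (nbrs G x) - card (nbrs G x \<inter> nbrs G v)"
    by (rule card_Diff_subset_Int) (use finite_nbrs[OF assms] in auto)
  moreover have "card (nbrs G x \<inter> nbrs G v) \<le> card (nbrs G x)"
    by (rule card_mono) (use finite_nbrs[OF assms] in auto)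
  ultimately show ?thesis by (simp add: codegree_def card_nbrs[OF assms] of_nat_diff)
qed

lemma finite_up [simp]: "finite (up G p n)"
  by (rule finite_subset[of _ "{1..n} \<times> {1..n}"]) (auto simp: up_def)

lemma finite_down [simp]: "finite (down G p n)"
  by (rule finite_subset[of _ "{1..n} \<times> {1..n}"]) (auto simp: down_def)

lemma finite_pairs [simp]: "finite (pairs n G i j)"
  by (rule finite_subset[of _ "{1..n} \<times> {1..n}"]) (auto simp: pairs_def)

text \<open>There are about \<open>n / 2\<close> non-neighbours \<open>x\<close> of
  \<open>u\<close>, and each has about \<open>n / 2 - n / 4\<close> neighbours \<open>y\<close>
  outside the neighbourhood of \<open>v\<close>; the codegree gives the second number.\<close>

lemma card_up_ge:
  assumes G: "G \<in> graphs_on n" "pseudorandom n \<delta> G" and uv: "u \<in> {1..n}" "v \<in> {1..n}" "u \<noteq> v"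
    and \<delta>: "0 < \<delta>" "\<delta> \<le> 1 / 12" and n: "4 \<le> \<delta> * n"
  shows "(1 - 12 * \<delta>) * (real n)\<^sup>2 / 8 \<le> real (card (up G (u, v) n))"
proof -
  define X where "X = {1..n} - {u, v} - nbrs G u"
  let ?Y = "\<lambda>x. nbrs G x - nbrs G v - {v}"
  have sub: "(SIGMA x:X. ?Y x) \<subseteq> up G (u, v) n"
  proof
    fix t assume "t \<in> (SIGMA x:X. ?Y x)"
    then obtain x y where t: "t = (x, y)" and x: "x \<in> X" and y: "y \<in> nbrs G x" "y \<notin> nbrs G v" "y \<noteq> v" by auto
    have "y \<in> {1..n}" using nbrs_subset[OF G(1), of x] y by auto
    then show "t \<in> up G (u, v) n" using x y t by (auto simp: up_def X_def nbrs_def)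
  qed
  have finX: "finite X" by (simp add: X_def)
  have dn: "\<delta> * n \<le> real n / 12" using \<delta> mult_right_mono[of \<delta> "1/12" "real n"] by simp
  have cX: "real n / 2 - 3 / 2 * (\<delta> * n) \<le> real (card X)"
  proof -
    have "card ({1..n} - {u, v}) = n - 2" using uv by (simp add: card_Diff_subset)
    moreover have "card ({1..n} - {u, v}) \<le> card (X \<union> nbrs G u)"
      by (rule card_mono) (use finX finite_nbrs[OF G(1)] in \<open>auto simp: X_def\<close>)
    moreover have "card (X \<union> nbrs G u) \<le> card X + vertex_degree G u"
      using card_Un_le[of X "nbrs G u"] by (simp add: card_nbrs[OF G(1)])
    ultimately have "real n - 2 \<le> real (card X) + real (vertex_degree G u)" by linarith
    moreover have "\<bar>real (vertex_degree G u) - real n / 2\<bar> \<le> \<delta> * n" using G(2) uv by (simp add: pseudorandom_def)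
    ultimately show ?thesis using n by linarith
  qed
  have cY: "real n / 4 - 9 / 4 * (\<delta> * n) \<le> real (card (?Y x))" if x: "x \<in> X" for x
  proof -
    have "card (nbrs G x - nbrs G v) - 1 \<le> card (?Y x)"
      using finite_nbrs[OF G(1)] by (simp add: card_Diff_singleton_if)
    then have "real (card (nbrs G x - nbrs G v)) - 1 \<le> real (card (?Y x))" by linarith
    moreover have "\<bar>real (vertex_degree G x) - real n / 2\<bar> \<le> \<delta> * n" "\<bar>real (codegree G x v) - real n / 4\<bar> \<le> \<delta> * n"
      using G(2) uv x by (auto simp: pseudorandom_def X_def)
    ultimately show ?thesis using card_nbrs_Diff[OF G(1), of x v] n by linarith
  qed
  have "(1 - 12 * \<delta>) * (real n)\<^sup>2 / 8 \<le> (real n / 2 - 3 / 2 * (\<delta> * n)) * (real n / 4 - 9 / 4 * (\<delta> * n))"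
  proof -
    have "(real n / 2 - 3 / 2 * (\<delta> * n)) * (real n / 4 - 9 / 4 * (\<delta> * n)) =
       (1 - 12 * \<delta>) * (real n)\<^sup>2 / 8 + 27 / 8 * (\<delta> * n)\<^sup>2"
      by (simp add: power2_eq_square field_simps)
    then show ?thesis by simp
  qed
  also have "\<dots> \<le> real (card X) * (real n / 4 - 9 / 4 * (\<delta> * n))"
    by (rule mult_right_mono[OF cX]) (use dn in linarith)
  also have "\<dots> \<le> (\<Sum>x\<in>X. real (card (?Y x)))"
    using sum_bounded_below[of X "real n / 4 - 9 / 4 * (\<delta> * n)" "\<lambda>x. real (card (?Y x))"] cY by simp
  also have "\<dots> = real (card (SIGMA x:X. ?Y x))"
    by (subst card_SigmaI) (use finX finite_nbrs[OF G(1)] in auto)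
  also have "\<dots> \<le> real (card (up G (u, v) n))"
    using card_mono[OF _ sub] by simp
  finally show ?thesis .
qed

text \<open>For a reverse move, \<open>x\<close> is a neighbour of \<open>u\<close> and
  \<open>y\<close> a neighbour of \<open>v\<close> not adjacent to \<open>x\<close>. The leading
  constant 1 / 8 is that of \<open>card_up_ge\<close>, so it cancels in the double counting.\<close>

lemma card_down_le:
  assumes G: "G \<in> graphs_on n" "pseudorandom n \<delta> G" and uv: "u \<in> {1..n}" "v \<in> {1..n}" "u \<noteq> v"
    and \<delta>: "0 < \<delta>" "\<delta> \<le> 1 / 8"
  shows "real (card (down G (u, v) n)) \<le> (1 + 12 * \<delta>) * (real n)\<^sup>2 / 8"
proof -
  let ?X = "nbrs G u - {v}"
  let ?Y = "\<lambda>x. nbrs G v - nbrs G x"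
  have sub: "down G (u, v) n \<subseteq> (SIGMA x:?X. ?Y x)"
    by (auto simp: down_def nbrs_def)
  have cX: "real (card ?X) \<le> real n / 2 + \<delta> * n"
  proof -
    have "card ?X \<le> card (nbrs G u)" by (rule card_mono) (use finite_nbrs[OF G(1)] in auto)
    then have "card ?X \<le> vertex_degree G u" by (simp add: card_nbrs[OF G(1)])
    moreover have "\<bar>real (vertex_degree G u) - real n / 2\<bar> \<le> \<delta> * n" using G(2) uv by (simp add: pseudorandom_def)
    ultimately show ?thesis by linarith
  qed
  have cY: "real (card (?Y x)) \<le> real n / 4 + 2 * (\<delta> * n)" if x: "x \<in> ?X" for x
  proof -
    have "\<bar>real (vertex_degree G v) - real n / 2\<bar> \<le> \<delta> * n" "\<bar>real (codegree G v x) - real n / 4\<bar> \<le> \<delta> * n"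
      using G(2) uv x nbrs_subset[OF G(1), of u] by (auto simp: pseudorandom_def)
    then show ?thesis using card_nbrs_Diff[OF G(1), of v x] by linarith
  qed
  have "real (card (down G (u, v) n)) \<le> real (card (SIGMA x:?X. ?Y x))"
    by (intro of_nat_mono card_mono[OF _ sub]) (use finite_nbrs[OF G(1)] in auto)
  also have "\<dots> = (\<Sum>x\<in>?X. real (card (?Y x)))"
    by (subst card_SigmaI) (use finite_nbrs[OF G(1)] in auto)
  also have "\<dots> \<le> real (card ?X) * (real n / 4 + 2 * (\<delta> * n))"
    using sum_bounded_above[of ?X "\<lambda>x. real (card (?Y x))" "real n / 4 + 2 * (\<delta> * n)"] cY by simp
  also have "\<dots> \<le> (real n / 2 + \<delta> * n) * (real n / 4 + 2 * (\<delta> * n))"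
    by (rule mult_right_mono[OF cX]) (use \<delta> in auto)
  also have "\<dots> = (1 + 10 * \<delta> + 16 * \<delta>\<^sup>2) * (real n)\<^sup>2 / 8"
    by (simp add: power2_eq_square field_simps)
  also have "\<dots> \<le> (1 + 12 * \<delta>) * (real n)\<^sup>2 / 8"
  proof -
    have "16 * \<delta>\<^sup>2 \<le> 2 * \<delta>" using \<delta> by (simp add: power2_eq_square)
    then show ?thesis by (intro divide_right_mono mult_right_mono) auto
  qed
  finally show ?thesis .
qed

lemma card_pairs_le: "card (pairs n G i j) \<le> degcount n G i * degcount n G j"
proof -
  have "pairs n G i j \<subseteq> {v \<in> {1..n}. vertex_degree G v = i} \<times> {v \<in> {1..n}. vertex_degree G v = j}"
    by (auto simp: pairs_def)
  then have "card (pairs n G i j) \<le> card ({v \<in> {1..n}. vertex_degree G v = i} \<times> {v \<in> {1..n}. vertex_degree G v = j})"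
    by (rule card_mono[rotated]) auto
  then show ?thesis by (simp only: card_cartesian_product degcount_def)
qed

lemma card_pairs_ge:
  "real (degcount n G i) * real (degcount n G j) - (if i = j then real (degcount n G i) else 0) \<le> real (card (pairs n G i j))"
proof -
  let ?V = "\<lambda>i. {v \<in> {1..n}. vertex_degree G v = i}"
  let ?D = "if i = j then (\<lambda>v. (v, v)) ` ?V i else {}"
  have "?V i \<times> ?V j \<subseteq> pairs n G i j \<union> ?D" by (auto simp: pairs_def)
  then have "card (?V i \<times> ?V j) \<le> card (pairs n G i j \<union> ?D)" by (rule card_mono[rotated]) auto
  also have "\<dots> \<le> card (pairs n G i j) + card ?D" by (rule card_Un_le)
  also have "card ?D = (if i = j then degcount n G i else 0)"
    by (auto simp: degcount_def card_image inj_on_def)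
  finally have "degcount n G i * degcount n G j \<le> card (pairs n G i j) + (if i = j then degcount n G i else 0)"
    by (simp only: card_cartesian_product degcount_def)
  then have "real (degcount n G i * degcount n G j) \<le> real (card (pairs n G i j) + (if i = j then degcount n G i else 0))"
    by (simp only: of_nat_le_iff)
  then show ?thesis by (simp split: if_splits)
qed

text \<open>Half the square counts unordered pairs once. The diagonal and the doubled entries
  \<open>j = Suc i\<close> contribute at most \<open>K\<close> times the sum, a lower-order term in
  the application.\<close>

lemma sum_upper_triangle_le:
  fixes r :: "nat \<Rightarrow> real"
  assumes r: "\<And>i. 0 \<le> r i" "\<And>i. r i \<le> K"
  shows "(\<Sum>i<n. \<Sum>j<n. of_bool (i \<le> j) * ((if j = Suc i then 2 else 1) * (r i * r j))) \<le>
    (\<Sum>i<n. r i)\<^sup>2 / 2 + 3 / 2 * (K * (\<Sum>i<n. r i))"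
proof -
  let ?f = "\<lambda>i j. r i * r j"
  let ?T = "\<Sum>i<n. \<Sum>j<n. of_bool (i \<le> j) * ?f i j"
  have sym: "?T = (\<Sum>i<n. \<Sum>j<n. of_bool (j \<le> i) * ?f i j)"
    by (subst sum.swap) (simp add: mult.commute)
  have "2 * ?T = (\<Sum>i<n. \<Sum>j<n. of_bool (i \<le> j) * ?f i j) + (\<Sum>i<n. \<Sum>j<n. of_bool (j \<le> i) * ?f i j)"
    using sym by simp
  also have "\<dots> = (\<Sum>i<n. \<Sum>j<n. ?f i j + of_bool (i = j) * ?f i j)"
    unfolding sum.distrib[symmetric] by (intro sum.cong refl) auto
  also have "\<dots> = (\<Sum>i<n. r i)\<^sup>2 + (\<Sum>i<n. r i * r i)"
    by (simp add: sum.distrib power2_eq_square sum_product of_bool_def if_distrib[of "\<lambda>x. x * _"] sum.delta cong: if_cong)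
  also have "(\<Sum>i<n. r i * r i) \<le> (\<Sum>i<n. K * r i)"
    by (intro sum_mono mult_right_mono r)
  finally have T: "2 * ?T \<le> (\<Sum>i<n. r i)\<^sup>2 + K * (\<Sum>i<n. r i)" by (simp add: sum_distrib_left)
  have adj: "(\<Sum>i<n. \<Sum>j<n. of_bool (j = Suc i) * ?f i j) \<le> K * (\<Sum>i<n. r i)"
  proof -
    have "(\<Sum>j<n. of_bool (j = Suc i) * ?f i j) \<le> K * r i" for i
    proof -
      have "(\<Sum>j<n. of_bool (j = Suc i) * ?f i j) = (if Suc i < n then r i * r (Suc i) else 0)"
        by (simp add: of_bool_def if_distrib[of "\<lambda>x. x * _"] sum.delta cong: if_cong)
      also have "\<dots> \<le> K * r i"
        using r(1)[of i] r(2)[of "Suc i"] r(1)[of 0] r(2)[of 0] by (auto simp: mult.commute[of "r i"] intro!: mult_right_mono mult_nonneg_nonneg)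
      finally show ?thesis .
    qed
    then show ?thesis unfolding sum_distrib_left by (rule sum_mono)
  qed
  have "(\<Sum>i<n. \<Sum>j<n. of_bool (i \<le> j) * ((if j = Suc i then 2 else 1) * ?f i j)) =
    ?T + (\<Sum>i<n. \<Sum>j<n. of_bool (j = Suc i) * ?f i j)"
    unfolding sum.distrib[symmetric] by (intro sum.cong refl) (auto simp: of_bool_def)
  then show ?thesis using T adj by linarith
qed

subsection \<open>The lower bound\<close>

text \<open>The form of \<open>degree_expressible\<close> for a single \<open>n\<close>, in terms of
  counts instead of multisets; \<open>degree_closed_iff\<close> links the two.\<close>

definition degree_closed :: "nat \<Rightarrow> graph set \<Rightarrow> bool" where
  "degree_closed n A \<longleftrightarrow> A \<subseteq> graphs_on n \<and> (\<forall>G\<in>graphs_on n. \<forall>H\<in>graphs_on n.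
     (\<forall>i. degcount n G i = degcount n H i) \<longrightarrow> G \<in> A \<longrightarrow> H \<in> A)"

text \<open>Weighted double counting. Each graph of \<open>B\<close> picks one type
  \<open>i \<le> j\<close> of successful addition and spreads unit mass evenly over all its
  switchings of that type. They end in \<open>A\<close>, because they produce the same degree counts
  as the successful addition. The mass arriving at a graph is then bounded by its own degree counts;
  as the picked types are arbitrary, the bound sums over all of them.\<close>

lemma card_up_moves_le:
  assumes A: "degree_closed n A"
    and T: "\<And>G. G \<in> T \<Longrightarrow> G \<in> graphs_on n" "\<And>G. G \<in> T \<Longrightarrow> pseudorandom n \<delta> G"
      "\<And>G. G \<in> T \<Longrightarrow> rsum n G \<le> R" "\<And>G i. G \<in> T \<Longrightarrow> real (degcount n G i) \<le> K"
    and \<delta>: "0 < \<delta>" "\<delta> \<le> 1 / 24" and n: "4 \<le> \<delta> * n" and R: "0 \<le> R" and K: "0 \<le> K"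
  shows "real (card {G \<in> T. \<exists>a b. {a, b} \<in> edges_on n \<and> {a, b} \<notin> G \<and> insert {a, b} G \<in> A}) \<le>
    real (card A) * ((1 + 24 * \<delta>) / (1 - 12 * \<delta>) *
      ((R + 6 * (K + 2))\<^sup>2 / 2 + 3 / 2 * ((K + 2) * (R + 6 * (K + 2)))))"
proof -
  define B where "B = {G \<in> T. \<exists>a b. {a, b} \<in> edges_on n \<and> {a, b} \<notin> G \<and> insert {a, b} G \<in> A}"
  define Lo where "Lo = (1 - 12 * \<delta>) * (real n)\<^sup>2 / 8"
  define Hi where "Hi = (1 + 24 * \<delta>) * (real n)\<^sup>2 / 8"
  define K' where "K' = K + 2"
  define R' where "R' = R + 6 * (K + 2)"
  have n0: "0 < n" using n \<delta> by (cases n) auto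
  have Lo0: "0 < Lo" using n0 \<delta> by (simp add: Lo_def)
  have Hi0: "0 < Hi" using n0 \<delta> by (simp add: Hi_def)
  have BT: "G \<in> T" if "G \<in> B" for G using that by (simp add: B_def)
  have BG: "G \<in> graphs_on n" if "G \<in> B" for G using that T(1) by (simp add: B_def)
  \<comment> \<open>Ordering the two degrees leaves one type for each unordered pair; this produces
    the 1 / 2 in front of the square.\<close>
  have "\<forall>G\<in>B. \<exists>q. fst q \<le> snd q \<and> (\<exists>a b. a \<in> {1..n} \<and> b \<in> {1..n} \<and> a \<noteq> b \<and> {a, b} \<notin> G \<and>
     insert {a, b} G \<in> A \<and> vertex_degree G a = fst q \<and> vertex_degree G b = snd q)"
  proof
    fix G assume "G \<in> B"
    then obtain a b where ab: "{a, b} \<in> edges_on n" "{a, b} \<notin> G" "insert {a, b} G \<in> A" by (auto simp: B_def)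
    have ab': "a \<in> {1..n}" "b \<in> {1..n}" "a \<noteq> b" using ab(1) by (auto simp: doubleton_in_edges_on)
    show "\<exists>q. fst q \<le> snd q \<and> (\<exists>a b. a \<in> {1..n} \<and> b \<in> {1..n} \<and> a \<noteq> b \<and> {a, b} \<notin> G \<and>
     insert {a, b} G \<in> A \<and> vertex_degree G a = fst q \<and> vertex_degree G b = snd q)"
    proof (cases "vertex_degree G a \<le> vertex_degree G b")
      case True
      then show ?thesis using ab ab' by (intro exI[of _ "(vertex_degree G a, vertex_degree G b)"] conjI) auto
    next
      case False
      have ba: "{b, a} = {a, b}" by auto
      show ?thesis using False ab ab'
        by (intro exI[of _ "(vertex_degree G b, vertex_degree G a)"] conjI exI[of _ b] exI[of _ a]) (auto simp: ba)
    qed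
  qed
  then obtain q where q: "\<And>G. G \<in> B \<Longrightarrow> fst (q G) \<le> snd (q G)"
    "\<And>G. G \<in> B \<Longrightarrow> \<exists>a b. a \<in> {1..n} \<and> b \<in> {1..n} \<and> a \<noteq> b \<and> {a, b} \<notin> G \<and>
     insert {a, b} G \<in> A \<and> vertex_degree G a = fst (q G) \<and> vertex_degree G b = snd (q G)"
    by metis
  define U where "U = (\<lambda>G. SIGMA p:pairs n G (fst (q G)) (snd (q G)). up G p n)"
  have finU: "finite (U G)" for G by (simp add: U_def)
  have cardU: "real (card (pairs n G (fst (q G)) (snd (q G)))) * Lo \<le> real (card (U G))" if G: "G \<in> B" for G
  proof -
    have "real (card (pairs n G (fst (q G)) (snd (q G)))) * Lo \<le>
       (\<Sum>p\<in>pairs n G (fst (q G)) (snd (q G)). real (card (up G p n)))"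
    proof (rule sum_bounded_below)
      fix p assume "p \<in> pairs n G (fst (q G)) (snd (q G))"
      then obtain u v where p: "p = (u, v)" "u \<in> {1..n}" "v \<in> {1..n}" "u \<noteq> v" by (auto simp: pairs_def)
      show "Lo \<le> real (card (up G p n))" unfolding p(1) Lo_def
        by (rule card_up_ge) (use BG[OF G] T(2)[OF BT[OF G]] p \<delta> n in auto)
    qed
    also have "\<dots> = real (card (U G))" unfolding U_def by (subst card_SigmaI) auto
    finally show ?thesis .
  qed
  have pairs1: "1 \<le> card (pairs n G (fst (q G)) (snd (q G)))" if G: "G \<in> B" for G
  proof -
    obtain a b where "(a, b) \<in> pairs n G (fst (q G)) (snd (q G))" using q(2)[OF G] by (auto simp: pairs_def)
    then have "pairs n G (fst (q G)) (snd (q G)) \<noteq> {}" by auto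
    then show ?thesis by (simp add: Suc_le_eq card_gt_0_iff)
  qed
  have U0: "0 < real (card (U G))" if "G \<in> B" for G
  proof -
    have "0 < real (card (pairs n G (fst (q G)) (snd (q G)))) * Lo" using pairs1[OF that] Lo0 by simp
    then show ?thesis using cardU[OF that] by linarith
  qed
  define Z where "Z = (SIGMA G:B. U G)"
  \<comment> \<open>Keeping the switching data next to the result makes the map injective, with
    inverse \<open>unswitch\<close>.\<close>
  define \<psi> where "\<psi> = (\<lambda>(G, t). (switch G t, t))"
  have finB: "finite B" by (rule finite_subset[of _ "graphs_on n"]) (use BG in auto)
  have finZ: "finite Z" using finB finU by (simp add: Z_def)
  have Zfacts: "G \<in> graphs_on n \<and> u \<in> {1..n} \<and> v \<in> {1..n} \<and> u \<noteq> v \<and> (x, y) \<in> up G (u, v) n \<and>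
      vertex_degree G u = fst (q G) \<and> vertex_degree G v = snd (q G)"
    if "G \<in> B" "((u, v), (x, y)) \<in> U G" for G u v x y
    using that BG[OF that(1)] by (auto simp: U_def pairs_def)
  have inj: "inj_on \<psi> Z"
  proof (rule inj_on_inverseI[where g = "\<lambda>(H, t). (unswitch H t, t)"])
    fix z assume "z \<in> Z"
    then obtain G u v x y where z: "z = (G, ((u, v), (x, y)))" "G \<in> B" "((u, v), (x, y)) \<in> U G"
      by (auto simp: Z_def)
    then show "(\<lambda>(H, t). (unswitch H t, t)) (\<psi> z) = z"
      using switch_props(3)[of G n u v x y] Zfacts[OF z(2,3)] by (simp add: \<psi>_def)
  qed
  \<comment> \<open>Bounds one over the number of pairs in \<open>G\<close> through counts of the
    result \<open>H\<close>. For \<open>j = Suc i\<close> class \<open>j\<close> loses one vertex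
    and gains one, so its count in \<open>G\<close> equals that in \<open>H\<close> and is not one
    more; the factor 2 compensates.\<close>
  define w where "w = (\<lambda>H i j. (if j = Suc i then 2 else 1) / ((real (degcount n H i) + 1) * (real (degcount n H j) + 1)))"
  define W where "W = (\<lambda>(H, t :: (nat \<times> nat) \<times> (nat \<times> nat)).
     w H (vertex_degree H (fst (fst t)) - 1) (vertex_degree H (snd (fst t)) - 1) / Lo)"
  have w0: "0 \<le> w H i j" for H i j by (simp add: w_def)
  have W0: "0 \<le> W z" for z using w0 Lo0 by (simp add: W_def case_prod_unfold)
  have Wge: "1 / real (card (U G)) \<le> W (\<psi> (G, t))" if Gt: "G \<in> B" "t \<in> U G" for G t
  proof -
    obtain u v x y where t: "t = ((u, v), (x, y))" by (metis surj_pair)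
    note f = Zfacts[OF Gt(1) Gt(2)[unfolded t]]
    define H where "H = switch G t"
    define i where "i = fst (q G)"
    define j where "j = snd (q G)"
    have deg: "vertex_degree H z = vertex_degree G z + of_bool (z = u \<or> z = v)" for z
      unfolding H_def t using switch_props(4)[of G n u v x y z] f by blast
    have ij: "i \<le> j" "vertex_degree G u = i" "vertex_degree G v = j" using q(1)[OF Gt(1)] f by (auto simp: i_def j_def)
    have Ni: "degcount n G i = degcount n H i + 1 + of_bool (i = j)"
      using degcount_raise[of u n v H G i] deg f ij by (auto simp: of_bool_def split: if_splits)
    have Nj: "degcount n G j + of_bool (j = Suc i) = degcount n H j + 1 + of_bool (i = j)"
      using degcount_raise[of u n v H G j] deg f ij by (auto simp: of_bool_def split: if_splits)
    let ?a = "real (degcount n H i)" and ?b = "real (degcount n H j)"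
    \<comment> \<open>For \<open>i = j\<close> the class had two more vertices, hence
      \<open>(?a + 2) * (?a + 1)\<close> ordered pairs. For \<open>j = Suc i\<close> class
      \<open>j\<close> contains \<open>v\<close>, so \<open>?b \<ge> 1\<close> and
      \<open>?b + 1 \<le> 2 * ?b\<close>.\<close>
    have P: "(?a + 1) * (?b + 1) \<le> (if j = Suc i then 2 else 1) * real (card (pairs n G i j))"
    proof -
      consider "i = j" | "j = Suc i" | "i \<noteq> j" "j \<noteq> Suc i" by blast
      then show ?thesis
      proof cases
        case 1
        then have N: "real (degcount n G i) = ?a + 2" using Ni by simp
        have "(?a + 1) * (?a + 1) \<le> (?a + 2) * (?a + 2) - (?a + 2)" by (simp add: algebra_simps)
        then show ?thesis using card_pairs_ge[of n G i j] 1 N by simp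
      next
        case 2
        have N: "real (degcount n G i) = ?a + 1" "real (degcount n G j) = ?b" using Ni Nj 2 by auto
        have "1 \<le> degcount n G j"
        proof -
          have "v \<in> {z \<in> {1..n}. vertex_degree G z = j}" using f ij by simp
          then have "{z \<in> {1..n}. vertex_degree G z = j} \<noteq> {}" by blast
          then show ?thesis unfolding degcount_def by (simp add: Suc_le_eq card_gt_0_iff)
        qed
        then have "?b + 1 \<le> 2 * ?b" using N by linarith
        then have "(?a + 1) * (?b + 1) \<le> (?a + 1) * (2 * ?b)" by (intro mult_left_mono) auto
        also have "\<dots> = 2 * ((?a + 1) * ?b)" by simp
        also have "(?a + 1) * ?b \<le> real (card (pairs n G i j))" using card_pairs_ge[of n G i j] 2 N by simp
        finally show ?thesis unfolding if_P[OF 2] by simp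
      next
        case 3
        then have "real (degcount n G i) = ?a + 1" "real (degcount n G j) = ?b + 1" using Ni Nj by auto
        then show ?thesis using card_pairs_ge[of n G i j] 3 by simp
      qed
    qed
    have "1 / real (card (U G)) \<le> 1 / (real (card (pairs n G i j)) * Lo)"
      using cardU[OF Gt(1)] pairs1[OF Gt(1)] Lo0 U0[OF Gt(1)] by (intro divide_left_mono) (auto simp: i_def j_def)
    also have "\<dots> \<le> w H i j / Lo"
    proof -
      have pp: "0 < real (card (pairs n G i j))" using pairs1[OF Gt(1)] by (simp add: i_def j_def)
      have "1 / real (card (pairs n G i j)) \<le> w H i j"
        unfolding w_def using P pp by (simp add: divide_simps split: if_splits)
      then have "1 / real (card (pairs n G i j)) / Lo \<le> w H i j / Lo" using Lo0 by (intro divide_right_mono) auto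
      then show ?thesis by simp
    qed
    also have "\<dots> = W (\<psi> (G, t))" using deg[of u] deg[of v] ij by (simp add: W_def \<psi>_def H_def[symmetric]) (simp add: t)
    finally show ?thesis .
  qed
  have "real (card B) = (\<Sum>G\<in>B. \<Sum>t\<in>U G. 1 / real (card (U G)))"
  proof -
    have "(\<Sum>t\<in>U G. 1 / real (card (U G))) = 1" if "G \<in> B" for G
      using U0[OF that] by simp
    then have "(\<Sum>G\<in>B. \<Sum>t\<in>U G. 1 / real (card (U G))) = (\<Sum>G\<in>B. 1)" by (rule sum.cong[OF refl])
    then show ?thesis by simp
  qed
  also have "\<dots> = (\<Sum>(G, t)\<in>Z. 1 / real (card (U G)))"
    unfolding Z_def by (rule sum.Sigma) (use finB finU in auto)
  also have "\<dots> \<le> (\<Sum>z\<in>Z. W (\<psi> z))"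
    by (rule sum_mono) (use Wge in \<open>auto simp: Z_def\<close>)
  also have "\<dots> = (\<Sum>z\<in>\<psi> ` Z. W z)" by (simp add: sum.reindex[OF inj])
  finally have main1: "real (card B) \<le> (\<Sum>z\<in>\<psi> ` Z. W z)" .
  \<comment> \<open>Only the graphs that are hit: for these, pseudorandomness and the bounds on
    counts follow from a preimage in \<open>T\<close>, while nothing is known about the rest of
    \<open>A\<close>.\<close>
  define A' where "A' = fst ` \<psi> ` Z"
  define IJ where "IJ = {(i, j). i \<le> j \<and> i < n \<and> j < n}"
  define DD where "DD = (\<lambda>H (i, j). SIGMA p:pairs n H (Suc i) (Suc j). down H p n)"
  have finDD: "finite (DD H ij)" for H ij by (simp add: DD_def case_prod_unfold)
  have IJ: "finite IJ" "IJ \<subseteq> {..<n} \<times> {..<n}"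
    by (rule finite_subset[of _ "{..<n} \<times> {..<n}"]) (auto simp: IJ_def)
  have A'A: "A' \<subseteq> A"
  proof
    fix H assume "H \<in> A'"
    then obtain G u v x y where z: "G \<in> B" "((u, v), (x, y)) \<in> U G" "H = switch G ((u, v), (x, y))"
      by (auto simp: A'_def Z_def \<psi>_def)
    note f = Zfacts[OF z(1,2)]
    note sw = switch_props[of G n u v x y, folded z(3)]
    obtain a b where ab: "a \<in> {1..n}" "b \<in> {1..n}" "a \<noteq> b" "{a, b} \<notin> G" "insert {a, b} G \<in> A"
       "vertex_degree G a = fst (q G)" "vertex_degree G b = snd (q G)" using q(2)[OF z(1)] by blast
    \<comment> \<open>The switching and the added edge raise vertices of the same two degrees, so
      \<open>degcount_raise\<close> gives the same counts.\<close>
    have "degcount n (insert {a, b} G) k = degcount n H k" for k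
    proof -
      have "vertex_degree (insert {a, b} G) z = vertex_degree G z + of_bool (z = a \<or> z = b)" for z
        using vertex_degree_insert[OF graphs_on_finite[OF BG[OF z(1)]] ab(4), of z] by simp
      then have "degcount n (insert {a, b} G) k + of_bool (k = vertex_degree G a) + of_bool (k = vertex_degree G b) =
          degcount n G k + of_bool (k = Suc (vertex_degree G a)) + of_bool (k = Suc (vertex_degree G b))"
        using ab by (intro degcount_raise) auto
      moreover have "degcount n H k + of_bool (k = vertex_degree G u) + of_bool (k = vertex_degree G v) =
          degcount n G k + of_bool (k = Suc (vertex_degree G u)) + of_bool (k = Suc (vertex_degree G v))"
        using f sw(4) by (intro degcount_raise) auto
      ultimately show ?thesis using f ab by simp
    qed
    moreover have "H \<in> graphs_on n" using f sw(1) by blast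
    ultimately show "H \<in> A" using A ab(5) unfolding degree_closed_def by blast
  qed
  have finA: "finite A" using A finite_subset[OF _ finite_graphs_on] unfolding degree_closed_def by blast
  have finA': "finite A'" using A'A finA finite_subset by blast
  have Z'sub: "\<psi> ` Z \<subseteq> (SIGMA H:A'. \<Union>ij\<in>IJ. DD H ij)"
  proof
    fix z assume z: "z \<in> \<psi> ` Z"
    then obtain G u v x y where g: "G \<in> B" "((u, v), (x, y)) \<in> U G" "z = (switch G ((u, v), (x, y)), ((u, v), (x, y)))"
      by (auto simp: Z_def \<psi>_def)
    let ?H = "switch G ((u, v), (x, y))"
    note f = Zfacts[OF g(1,2)]
    note sw = switch_props[of G n u v x y]
    have Hg: "?H \<in> graphs_on n" using sw(1) f by blast
    have du: "vertex_degree ?H u = Suc (fst (q G))" "vertex_degree ?H v = Suc (snd (q G))" using sw(4) f by auto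
    have "(fst (q G), snd (q G)) \<in> IJ"
      using q(1)[OF g(1)] vertex_degree_le[OF Hg, of u] vertex_degree_le[OF Hg, of v] du f by (auto simp: IJ_def)
    moreover have "((u, v), (x, y)) \<in> DD ?H (fst (q G), snd (q G))"
      using sw(2) f du by (auto simp: DD_def pairs_def)
    moreover have "?H \<in> A'" using imageI[OF z, of fst, folded A'_def] g(3) by simp
    ultimately show "z \<in> (SIGMA H:A'. \<Union>ij\<in>IJ. DD H ij)" using g(3) by blast
  qed
  have perH: "(\<Sum>t\<in>(\<Union>ij\<in>IJ. DD H ij). W (H, t)) \<le> Hi / Lo * (R'\<^sup>2 / 2 + 3 / 2 * (K' * R'))" if H: "H \<in> A'" for H
  proof -
    obtain G u v x y where z: "G \<in> B" "((u, v), (x, y)) \<in> U G" "H = switch G ((u, v), (x, y))"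
      using H by (auto simp: A'_def Z_def \<psi>_def)
    note f = Zfacts[OF z(1,2)]
    note sw = switch_props[of G n u v x y, folded z(3)]
    have Hg: "H \<in> graphs_on n" using f sw(1) by blast
    have deg: "vertex_degree H z = vertex_degree G z + of_bool (z = u \<or> z = v)" for z using sw(4) f by blast
    have Hp: "pseudorandom n (2 * \<delta>) H"
      unfolding z(3) by (rule pseudorandom_switch) (use f T(2)[OF BT[OF z(1)]] n in auto)
    have Hr: "rsum n H \<le> R'"
      using rsum_raise[of u n v H G K] f deg T(4)[OF BT[OF z(1)]] T(3)[OF BT[OF z(1)]] by (force simp: R'_def)
    have Hk: "real (degcount n H i) \<le> K'" for i
      using degcount_raise_le[of u n v H G i] f deg T(4)[OF BT[OF z(1)], of i] by (force simp: K'_def)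
    let ?N = "\<lambda>i. real (degcount n H i)"
    let ?r = "\<lambda>i. ?N (Suc i) / (?N i + 1)"
    have sumDD: "(\<Sum>t\<in>DD H (i, j). W (H, t)) \<le> Hi / Lo * ((if j = Suc i then 2 else 1) * (?r i * ?r j))" for i j
    proof -
      have "(\<Sum>t\<in>DD H (i, j). W (H, t)) = (\<Sum>t\<in>DD H (i, j). w H i j / Lo)"
        by (rule sum.cong) (auto simp: W_def DD_def pairs_def)
      also have "\<dots> = real (card (DD H (i, j))) * (w H i j / Lo)" by simp
      \<comment> \<open>The pairs of degrees \<open>Suc i\<close> and \<open>Suc j\<close> in
        \<open>H\<close> supply the numerators and \<open>w\<close> the denominators of a product of
        two ratios.\<close>
      also have "\<dots> \<le> (?N (Suc i) * ?N (Suc j) * Hi) * (w H i j / Lo)"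
      proof (rule mult_right_mono)
        have "real (card (DD H (i, j))) = (\<Sum>p\<in>pairs n H (Suc i) (Suc j). real (card (down H p n)))"
          unfolding DD_def prod.case by (subst card_SigmaI) auto
        also have "\<dots> \<le> real (card (pairs n H (Suc i) (Suc j))) * Hi"
        proof (rule sum_bounded_above)
          fix p assume "p \<in> pairs n H (Suc i) (Suc j)"
          then obtain u v where p: "p = (u, v)" "u \<in> {1..n}" "v \<in> {1..n}" "u \<noteq> v" by (auto simp: pairs_def)
          show "real (card (down H p n)) \<le> Hi"
            using card_down_le[OF Hg Hp p(2-4)] \<delta> unfolding p(1) Hi_def by simp
        qed
        also have "\<dots> \<le> (?N (Suc i) * ?N (Suc j)) * Hi"
          using card_pairs_le[of n H "Suc i" "Suc j"] Hi0
          by (intro mult_right_mono) (auto simp flip: of_nat_mult)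
        finally show "real (card (DD H (i, j))) \<le> ?N (Suc i) * ?N (Suc j) * Hi" .
      qed (use w0 Lo0 in auto)
      also have "\<dots> = Hi / Lo * ((if j = Suc i then 2 else 1) * (?r i * ?r j))"
        by (simp add: w_def mult_ac)
      finally show ?thesis .
    qed
    have r0: "0 \<le> ?r i" for i by simp
    have rK: "?r i \<le> K'" for i
    proof -
      have "?r i \<le> ?N (Suc i)" by (simp add: pos_divide_le_eq add_nonneg_pos mult_left_mono distrib_left)
      then show ?thesis using Hk[of "Suc i"] by linarith
    qed
    have "(\<Sum>t\<in>(\<Union>ij\<in>IJ. DD H ij). W (H, t)) = (\<Sum>ij\<in>IJ. \<Sum>t\<in>DD H ij. W (H, t))"
      by (rule sum.UNION_disjoint) (use IJ finDD in \<open>auto simp: DD_def pairs_def\<close>)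
    also have "\<dots> \<le> (\<Sum>(i, j)\<in>IJ. Hi / Lo * ((if j = Suc i then 2 else 1) * (?r i * ?r j)))"
      by (rule sum_mono) (use sumDD in auto)
    also have "\<dots> = (\<Sum>(i, j)\<in>{..<n} \<times> {..<n}. of_bool (i \<le> j) * (Hi / Lo * ((if j = Suc i then 2 else 1) * (?r i * ?r j))))"
      by (rule sum.mono_neutral_cong_left) (use IJ in \<open>auto simp: IJ_def\<close>)
    also have "\<dots> = Hi / Lo * (\<Sum>i<n. \<Sum>j<n. of_bool (i \<le> j) * ((if j = Suc i then 2 else 1) * (?r i * ?r j)))"
      by (simp add: sum.cartesian_product[symmetric] sum_distrib_left mult.left_commute)
    also have "\<dots> \<le> Hi / Lo * ((\<Sum>i<n. ?r i)\<^sup>2 / 2 + 3 / 2 * (K' * (\<Sum>i<n. ?r i)))"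
      by (intro mult_left_mono sum_upper_triangle_le r0 rK) (use Hi0 Lo0 in auto)
    also have "\<dots> \<le> Hi / Lo * (R'\<^sup>2 / 2 + 3 / 2 * (K' * R'))"
    proof -
      have s: "(\<Sum>i<n. ?r i) \<le> R'" "0 \<le> (\<Sum>i<n. ?r i)" using Hr by (auto simp: rsum_def intro!: sum_nonneg)
      have "0 \<le> K'" using K by (simp add: K'_def)
      then show ?thesis
        using s Hi0 Lo0 by (intro mult_left_mono add_mono divide_right_mono power_mono) auto
    qed
    finally show ?thesis .
  qed
  have "(\<Sum>z\<in>\<psi> ` Z. W z) \<le> (\<Sum>z\<in>(SIGMA H:A'. \<Union>ij\<in>IJ. DD H ij). W z)"
    by (rule sum_mono2) (use Z'sub W0 finA' IJ finDD in auto)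
  also have "\<dots> = (\<Sum>H\<in>A'. \<Sum>t\<in>(\<Union>ij\<in>IJ. DD H ij). W (H, t))"
    by (subst sum.Sigma) (use finA' IJ finDD in auto)
  also have "\<dots> \<le> real (card A') * (Hi / Lo * (R'\<^sup>2 / 2 + 3 / 2 * (K' * R')))"
    by (rule sum_bounded_above) (rule perH)
  also have "\<dots> \<le> real (card A) * (Hi / Lo * (R'\<^sup>2 / 2 + 3 / 2 * (K' * R')))"
  proof (rule mult_right_mono)
    show "real (card A') \<le> real (card A)" using card_mono[OF finA A'A] by simp
    have "0 \<le> R'" "0 \<le> K'" using R K by (auto simp: R'_def K'_def)
    then show "0 \<le> Hi / Lo * (R'\<^sup>2 / 2 + 3 / 2 * (K' * R'))" using Hi0 Lo0 by simp
  qed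
  also have "Hi / Lo = (1 + 24 * \<delta>) / (1 - 12 * \<delta>)" using n0 by (simp add: Hi_def Lo_def)
  finally show ?thesis using main1 unfolding B_def R'_def K'_def by linarith
qed

section \<open>Degree multisets, complements and single flips\<close>

lemma count_degree_multiset: "count (degree_multiset n G) i = degcount n G i"
proof -
  have "count (degree_multiset n G) i = card {v \<in> {1..n}. i = vertex_degree G v}"
    unfolding degree_multiset_def
    by (subst count_image_mset_eq_card_vimage) (auto intro!: arg_cong[where f = card])
  also have "{v \<in> {1..n}. i = vertex_degree G v} = {v \<in> {1..n}. vertex_degree G v = i}" by auto
  finally show ?thesis by (simp add: degcount_def)
qed

lemma degree_multiset_eq_iff:
  "degree_multiset n G = degree_multiset n H \<longleftrightarrow> (\<forall>i. degcount n G i = degcount n H i)"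
  by (simp add: multiset_eq_iff count_degree_multiset)

lemma degree_closed_iff:
  assumes "\<And>n. A n \<subseteq> graphs_on n"
  shows "degree_expressible A \<longleftrightarrow> (\<forall>n. degree_closed n (A n))"
proof
  assume "degree_expressible A"
  then show "\<forall>n. degree_closed n (A n)"
    using assms unfolding degree_expressible_def degree_closed_def degree_multiset_eq_iff by blast
next
  assume *: "\<forall>n. degree_closed n (A n)"
  have "G \<in> A n \<Longrightarrow> H \<in> A n"
    if "G \<in> graphs_on n" "H \<in> graphs_on n" "\<forall>i. degcount n G i = degcount n H i" for n G H
    using * that unfolding degree_closed_def by blast
  then show "degree_expressible A"
    unfolding degree_expressible_def degree_multiset_eq_iff by (metis (no_types, lifting))
qed

lemma vertex_degree_compl:
  assumes "G \<in> graphs_on n" "v \<in> {1..n}"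
  shows "vertex_degree (edges_on n - G) v = n - 1 - vertex_degree G v"
proof -
  have H: "edges_on n - G \<in> graphs_on n" by (auto simp: graphs_on_eq)
  have "nbrs (edges_on n - G) v = ({1..n} - {v}) - nbrs G v"
    using assms(2) by (auto simp: nbrs_def doubleton_in_edges_on)
  then have "card (nbrs (edges_on n - G) v) = card ({1..n} - {v}) - card (nbrs G v)"
    using nbrs_subset[OF assms(1)] finite_nbrs[OF assms(1)] by (simp add: card_Diff_subset)
  then show ?thesis using assms(2) by (simp add: card_nbrs[OF H] card_nbrs[OF assms(1)])
qed

lemma degcount_compl:
  assumes "G \<in> graphs_on n" "i < n"
  shows "degcount n (edges_on n - G) i = degcount n G (n - 1 - i)"
proof -
  have "vertex_degree (edges_on n - G) v = i \<longleftrightarrow> vertex_degree G v = n - 1 - i" if "v \<in> {1..n}" for v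
    using vertex_degree_compl[OF assms(1) that] vertex_degree_le[OF assms(1) that] assms(2) by auto
  then have "{v \<in> {1..n}. vertex_degree (edges_on n - G) v = i} = {v \<in> {1..n}. vertex_degree G v = n - 1 - i}"
    by auto
  then show ?thesis by (simp add: degcount_def)
qed

lemma compl_compl: "G \<in> graphs_on n \<Longrightarrow> edges_on n - (edges_on n - G) = G"
  by (auto simp: graphs_on_eq)

lemma compl_in_graphs_on [simp]: "edges_on n - G \<in> graphs_on n"
  by (auto simp: graphs_on_eq)

lemma degree_closed_compl:
  assumes "degree_closed n A"
  shows "degree_closed n ((\<lambda>G. edges_on n - G) ` A)"
  unfolding degree_closed_def
proof (intro conjI ballI impI)
  show "(\<lambda>G. edges_on n - G) ` A \<subseteq> graphs_on n" by auto
  fix G H assume G: "G \<in> graphs_on n" and H: "H \<in> graphs_on n" and eq: "\<forall>i. degcount n G i = degcount n H i"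
    and "G \<in> (\<lambda>G. edges_on n - G) ` A"
  then obtain G' where G': "G' \<in> A" "G = edges_on n - G'" by blast
  have AG: "A \<subseteq> graphs_on n" using assms by (simp add: degree_closed_def)
  have "edges_on n - G = G'" using compl_compl[of G' n] G' AG by auto
  moreover have "degcount n (edges_on n - G) i = degcount n (edges_on n - H) i" for i
  proof (cases "i < n")
    case True
    then show ?thesis using degcount_compl[OF G True] degcount_compl[OF H True] eq by simp
  next
    case False
    then show ?thesis by (simp add: degcount_eq_0)
  qed
  moreover have "X \<in> graphs_on n \<Longrightarrow> Y \<in> graphs_on n \<Longrightarrow> \<forall>i. degcount n X i = degcount n Y i \<Longrightarrow> X \<in> A \<Longrightarrow> Y \<in> A"
    for X Y using assms unfolding degree_closed_def by blast
  note this[of "edges_on n - G" "edges_on n - H"]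
  ultimately have "edges_on n - H \<in> A" using G'(1) AG by auto
  then show "H \<in> (\<lambda>G. edges_on n - G) ` A"
    by (rule image_eqI[rotated]) (simp add: compl_compl[OF H])
qed

lemma one_flip_cases:
  assumes "G \<in> graphs_on n" "H \<in> graphs_on n" "card (sym_diff G H) \<le> 1"
  obtains "H = G" | a b where "{a, b} \<in> edges_on n" "{a, b} \<notin> G" "H = insert {a, b} G"
    | a b where "{a, b} \<in> edges_on n" "{a, b} \<in> G" "H = G - {{a, b}}"
proof -
  have fin: "finite (sym_diff G H)" using graphs_on_finite[OF assms(1)] graphs_on_finite[OF assms(2)] by simp
  show ?thesis
  proof (cases "sym_diff G H = {}")
    case True
    then have "H = G" by auto
    then show ?thesis by (rule that(1))
  next
    case False
    then have "card (sym_diff G H) = 1" using assms(3) fin card_gt_0_iff[of "sym_diff G H"] by simp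
    then obtain e where e: "sym_diff G H = {e}" by (auto simp: card_1_singleton_iff)
    have m: "(x \<in> G \<and> x \<notin> H) \<or> (x \<in> H \<and> x \<notin> G) \<longleftrightarrow> x = e" for x using eqset_imp_iff[OF e, of x] by simp
    have "e \<in> edges_on n" using m[of e] assms by (auto simp: graphs_on_eq)
    then obtain a b where ab: "e = {a, b}" by (rule edges_onE)
    show ?thesis
    proof (cases "e \<in> G")
      case True
      have "x \<in> H \<longleftrightarrow> x \<in> G - {e}" for x using m[of x] True by auto
      then have "H = G - {e}" by auto
      then show ?thesis using that(3)[of a b] True \<open>e \<in> edges_on n\<close> ab by simp
    next
      case False
      have "x \<in> H \<longleftrightarrow> x \<in> insert e G" for x using m[of x] False by auto
      then have "H = insert e G" by auto
      then show ?thesis using that(2)[of a b] False \<open>e \<in> edges_on n\<close> ab by simp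
    qed
  qed
qed

text \<open>A removal in \<open>G\<close> is an addition in the complement of \<open>G\<close>, so
  \<open>card_up_moves_le\<close> is applied to \<open>A\<close> and to the set of complements of
  its members. Membership in \<open>T\<close> is required of \<open>G\<close> and of its complement,
  hence the factor 2 in the first term.\<close>

lemma flips_le:
  assumes A: "degree_closed n A"
    and f: "\<And>G. G \<in> graphs_on n \<Longrightarrow> f G \<in> graphs_on n \<and> card (sym_diff G (f G)) \<le> 1"
    and T: "\<And>G. G \<in> T \<Longrightarrow> G \<in> graphs_on n" "\<And>G. G \<in> T \<Longrightarrow> pseudorandom n \<delta> G"
      "\<And>G. G \<in> T \<Longrightarrow> rsum n G \<le> R" "\<And>G i. G \<in> T \<Longrightarrow> real (degcount n G i) \<le> K"
    and \<delta>: "0 < \<delta>" "\<delta> \<le> 1 / 24" and n: "4 \<le> \<delta> * n" and R: "0 \<le> R" and K: "0 \<le> K"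
  shows "pr n (\<lambda>G. f G \<in> A) \<le> 2 * pr n (\<lambda>G. G \<notin> T) + pr n (\<lambda>G. G \<in> A) *
    (1 + 2 * ((1 + 24 * \<delta>) / (1 - 12 * \<delta>) *
      ((R + 6 * (K + 2))\<^sup>2 / 2 + 3 / 2 * ((K + 2) * (R + 6 * (K + 2))))))"
proof -
  define M where "M = (1 + 24 * \<delta>) / (1 - 12 * \<delta>) *
      ((R + 6 * (K + 2))\<^sup>2 / 2 + 3 / 2 * ((K + 2) * (R + 6 * (K + 2))))"
  let ?c = "\<lambda>G. edges_on n - G"
  let ?Q = "\<lambda>A G. \<exists>a b. {a, b} \<in> edges_on n \<and> {a, b} \<notin> G \<and> insert {a, b} G \<in> A"
  have AG: "A \<subseteq> graphs_on n" using A by (simp add: degree_closed_def)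
  have up: "pr n (\<lambda>G. G \<in> T \<and> ?Q A' G) \<le> M * pr n (\<lambda>G. G \<in> A')" if A': "degree_closed n A'" for A'
  proof -
    have "{G \<in> graphs_on n. G \<in> T \<and> ?Q A' G} = {G \<in> T. ?Q A' G}" using T(1) by auto
    moreover have "{G \<in> graphs_on n. G \<in> A'} = A'" using A' by (auto simp: degree_closed_def)
    moreover have "real (card {G \<in> T. ?Q A' G}) \<le> real (card A') * M"
      unfolding M_def by (rule card_up_moves_le[OF A' _ _ _ _ \<delta> n R K]) (erule T)+
    ultimately show ?thesis
      using divide_right_mono[of "real (card {G \<in> T. ?Q A' G})" "real (card A') * M" "2 ^ (n choose 2)"]
      unfolding pr_eq_card by (simp add: mult.commute)
  qed
  have "pr n (\<lambda>G. f G \<in> A) \<le> pr n (\<lambda>G. (G \<notin> T \<or> ?c G \<notin> T) \<or> (G \<in> A \<or> (G \<in> T \<and> ?Q A G) \<or> (?c G \<in> T \<and> ?Q (?c ` A) (?c G))))"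
  proof (rule pr_mono)
    fix G assume G: "G \<in> graphs_on n" and fA: "f G \<in> A"
    show "(G \<notin> T \<or> ?c G \<notin> T) \<or> (G \<in> A \<or> (G \<in> T \<and> ?Q A G) \<or> (?c G \<in> T \<and> ?Q (?c ` A) (?c G)))"
      using G conjunct1[OF f[OF G]] conjunct2[OF f[OF G]]
    proof (cases rule: one_flip_cases)
      case (3 a b)
      have "insert {a, b} (?c G) = ?c (f G)" using 3 by auto
      then have "?Q (?c ` A) (?c G)" using 3 fA by blast
      then show ?thesis by blast
    qed (use fA in auto)
  qed
  also have "\<dots> \<le> pr n (\<lambda>G. G \<notin> T \<or> ?c G \<notin> T) +
     pr n (\<lambda>G. G \<in> A \<or> (G \<in> T \<and> ?Q A G) \<or> (?c G \<in> T \<and> ?Q (?c ` A) (?c G)))" by (rule pr_disj_le)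
  also have "pr n (\<lambda>G. G \<notin> T \<or> ?c G \<notin> T) \<le> pr n (\<lambda>G. G \<notin> T) + pr n (\<lambda>G. ?c G \<notin> T)" by (rule pr_disj_le)
  also have "pr n (\<lambda>G. ?c G \<notin> T) = pr n (\<lambda>G. G \<notin> T)" by (rule pr_compl)
  also have "pr n (\<lambda>G. G \<in> A \<or> (G \<in> T \<and> ?Q A G) \<or> (?c G \<in> T \<and> ?Q (?c ` A) (?c G))) \<le>
     pr n (\<lambda>G. G \<in> A) + pr n (\<lambda>G. (G \<in> T \<and> ?Q A G) \<or> (?c G \<in> T \<and> ?Q (?c ` A) (?c G)))" by (rule pr_disj_le)
  also have "pr n (\<lambda>G. (G \<in> T \<and> ?Q A G) \<or> (?c G \<in> T \<and> ?Q (?c ` A) (?c G))) \<le>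
     pr n (\<lambda>G. G \<in> T \<and> ?Q A G) + pr n (\<lambda>G. ?c G \<in> T \<and> ?Q (?c ` A) (?c G))" by (rule pr_disj_le)
  also have "pr n (\<lambda>G. G \<in> T \<and> ?Q A G) \<le> M * pr n (\<lambda>G. G \<in> A)" by (rule up[OF A])
  also have "pr n (\<lambda>G. ?c G \<in> T \<and> ?Q (?c ` A) (?c G)) = pr n (\<lambda>G. G \<in> T \<and> ?Q (?c ` A) G)"
    by (rule pr_compl[of n "\<lambda>G. G \<in> T \<and> ?Q (?c ` A) G"])
  also have "\<dots> \<le> M * pr n (\<lambda>G. G \<in> ?c ` A)" by (rule up[OF degree_closed_compl[OF A]])
  also have "pr n (\<lambda>G. G \<in> ?c ` A) = pr n (\<lambda>G. ?c G \<in> ?c ` A)" by (rule pr_compl[symmetric])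
  also have "\<dots> = pr n (\<lambda>G. G \<in> A)"
  proof (rule pr_cong)
    fix G assume G: "G \<in> graphs_on n"
    have "G \<in> A" if "?c G = ?c H" "H \<in> A" for H
      using that compl_compl[OF G] compl_compl[of H n] AG by auto
    then show "(?c G \<in> ?c ` A) = (G \<in> A)" by blast
  qed
  finally show ?thesis unfolding M_def[symmetric] by (simp add: algebra_simps)
qed

lemma eventually_pr_good:
  assumes "0 < \<delta>"
  shows "\<forall>\<^sub>F n in sequentially. pr n (\<lambda>G. G \<notin> {G \<in> graphs_on n. pseudorandom n \<delta> G \<and>
     rsum n G \<le> (1 + \<delta>) * dd n \<and> (\<forall>i. real (degcount n G i) \<le> \<delta> * dd n)}) \<le> 3 * \<delta>"
  using pseudorandom_whp[OF assms] rsum_bound[OF assms] degcount_max[OF assms]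
proof eventually_elim
  case (elim n)
  have "pr n (\<lambda>G. G \<notin> {G \<in> graphs_on n. pseudorandom n \<delta> G \<and>
     rsum n G \<le> (1 + \<delta>) * dd n \<and> (\<forall>i. real (degcount n G i) \<le> \<delta> * dd n)}) \<le>
    pr n (\<lambda>G. \<not> pseudorandom n \<delta> G \<or> (1 + \<delta>) * dd n \<le> rsum n G \<or> (\<exists>i. \<delta> * dd n \<le> real (degcount n G i)))"
    by (rule pr_mono) (auto simp: not_le intro: less_imp_le)
  also have "\<dots> \<le> pr n (\<lambda>G. \<not> pseudorandom n \<delta> G) +
     pr n (\<lambda>G. (1 + \<delta>) * dd n \<le> rsum n G \<or> (\<exists>i. \<delta> * dd n \<le> real (degcount n G i)))" by (rule pr_disj_le)
  also have "\<dots> \<le> pr n (\<lambda>G. \<not> pseudorandom n \<delta> G) + (pr n (\<lambda>G. (1 + \<delta>) * dd n \<le> rsum n G) +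
     pr n (\<lambda>G. \<exists>i. \<delta> * dd n \<le> real (degcount n G i)))" by (intro add_left_mono pr_disj_le)
  finally show ?case using elim by linarith
qed

text \<open>Additions and removals contribute \<open>D^2 / 2\<close> each, with
  \<open>D^2 = n * ln n\<close>, and every correction in \<open>flips_le\<close> is of the form
  \<open>\<delta> * D^2\<close> up to a constant.\<close>

lemma flips_lower_bound:
  assumes A: "\<And>n. degree_closed n (A n)" and f: "adversary f"
    and lim: "(\<lambda>n. pr n (\<lambda>G. f n G \<in> A n)) \<longlonglongrightarrow> 1" and \<epsilon>: "0 < \<epsilon>"
  shows "\<forall>\<^sub>F n in sequentially. (1 - \<epsilon>) / (real n * ln n) \<le> pr n (\<lambda>G. G \<in> A n)"
proof -
  \<comment> \<open>The factor in front of \<open>D^2\<close>: 13 is 1 from the ratio sum and 12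
    from \<open>6 * (K + 2) \<le> 12 * \<delta> * D\<close>, and the final \<open>\<delta>\<close>
    absorbs the 1 for graphs already in \<open>A\<close>.\<close>
  define g where "g = (\<lambda>\<delta>::real. (1 + 24 * \<delta>) / (1 - 12 * \<delta>) * ((1 + 13 * \<delta>)\<^sup>2 + 6 * \<delta> * (1 + 13 * \<delta>)) + \<delta>)"
  have "((\<lambda>\<delta>. (1 - 7 * \<delta>) / g \<delta>) \<longlongrightarrow> 1) (at_right 0)" unfolding g_def by real_asymp
  then have "\<forall>\<^sub>F \<delta> in at_right 0. 1 - \<epsilon> < (1 - 7 * \<delta>) / g \<delta>" by (rule order_tendstoD) (use \<epsilon> in auto)
  moreover have "\<forall>\<^sub>F \<delta> in at_right (0::real). \<delta> < 1 / 24" by real_asymp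
  ultimately have "\<forall>\<^sub>F \<delta> in at_right (0::real). 0 < \<delta> \<and> \<delta> < 1 / 24 \<and> 1 - \<epsilon> < (1 - 7 * \<delta>) / g \<delta>"
    using eventually_at_right_less[of 0] by eventually_elim auto
  then obtain \<delta> where \<delta>: "0 < \<delta>" "\<delta> < 1 / 24" "1 - \<epsilon> < (1 - 7 * \<delta>) / g \<delta>"
    using eventually_happens[of _ "at_right (0::real)"] by (auto simp: trivial_limit_at_right_real)
  have g0: "0 < g \<delta>" unfolding g_def using \<delta> by (intro add_nonneg_pos mult_nonneg_nonneg) auto
  have e1: "\<forall>\<^sub>F n::nat in sequentially. 4 \<le> \<delta> * n" using \<delta>(1) by real_asymp
  have e2: "\<forall>\<^sub>F n in sequentially. 2 \<le> \<delta> * dd n" using \<delta>(1) unfolding dd_def by real_asymp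
  have e3: "\<forall>\<^sub>F n::nat in sequentially. 1 \<le> \<delta> * (real n * ln n)" using \<delta>(1) by real_asymp
  have e4: "\<forall>\<^sub>F n in sequentially. 1 - \<delta> < pr n (\<lambda>G. f n G \<in> A n)"
    by (rule order_tendstoD[OF lim]) (use \<delta> in auto)
  show ?thesis
    using e1 e2 e3 e4 eventually_pr_good[OF \<delta>(1)] eventually_ge_at_top[of 2]
  proof eventually_elim
    case (elim n)
    define D where "D = dd n"
    define p where "p = pr n (\<lambda>G. G \<in> A n)"
    define T where "T = {G \<in> graphs_on n. pseudorandom n \<delta> G \<and>
       rsum n G \<le> (1 + \<delta>) * dd n \<and> (\<forall>i. real (degcount n G i) \<le> \<delta> * dd n)}"
    define R' where "R' = (1 + \<delta>) * D + 6 * (\<delta> * D + 2)"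
    have D2: "D\<^sup>2 = real n * ln n" using elim(6) by (simp add: D_def dd_def)
    have D0: "0 \<le> D" using elim(6) by (simp add: D_def dd_def)
    have nl: "0 < real n * ln n" using elim(6) by simp
    have p0: "0 \<le> p" by (simp add: p_def)
    have K2: "\<delta> * D + 2 \<le> 2 * \<delta> * D" using elim(2) by (simp add: D_def)
    have R': "R' \<le> (1 + 13 * \<delta>) * D" "0 \<le> R'"
      using K2 \<delta> D0 by (auto simp: R'_def algebra_simps)
    have main: "pr n (\<lambda>G. f n G \<in> A n) \<le> 2 * pr n (\<lambda>G. G \<notin> T) + p *
      (1 + 2 * ((1 + 24 * \<delta>) / (1 - 12 * \<delta>) * (R'\<^sup>2 / 2 + 3 / 2 * ((\<delta> * D + 2) * R'))))"
      unfolding p_def R'_def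
      by (rule flips_le[OF A]) (use f \<delta> elim(1) D0 in \<open>auto simp: adversary_def T_def D_def\<close>)
    have "R'\<^sup>2 / 2 + 3 / 2 * ((\<delta> * D + 2) * R') \<le> ((1 + 13 * \<delta>) * D)\<^sup>2 / 2 + 3 / 2 * ((2 * \<delta> * D) * ((1 + 13 * \<delta>) * D))"
      by (intro add_mono divide_right_mono power_mono mult_left_mono mult_mono) (use R' K2 \<delta> D0 in auto)
    also have "\<dots> = ((1 + 13 * \<delta>)\<^sup>2 + 6 * \<delta> * (1 + 13 * \<delta>)) * D\<^sup>2 / 2"
      by (simp add: power2_eq_square algebra_simps)
    finally have "(1 + 24 * \<delta>) / (1 - 12 * \<delta>) * (R'\<^sup>2 / 2 + 3 / 2 * ((\<delta> * D + 2) * R')) \<le>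
      (1 + 24 * \<delta>) / (1 - 12 * \<delta>) * (((1 + 13 * \<delta>)\<^sup>2 + 6 * \<delta> * (1 + 13 * \<delta>)) * D\<^sup>2 / 2)"
      by (rule mult_left_mono) (use \<delta> in auto)
    also have "\<dots> = (g \<delta> - \<delta>) * D\<^sup>2 / 2" by (simp add: g_def)
    finally have "1 + 2 * ((1 + 24 * \<delta>) / (1 - 12 * \<delta>) * (R'\<^sup>2 / 2 + 3 / 2 * ((\<delta> * D + 2) * R'))) \<le> g \<delta> * D\<^sup>2"
      using elim(3) by (simp add: D2 left_diff_distrib)
    then have "p * (1 + 2 * ((1 + 24 * \<delta>) / (1 - 12 * \<delta>) * (R'\<^sup>2 / 2 + 3 / 2 * ((\<delta> * D + 2) * R')))) \<le> p * (g \<delta> * D\<^sup>2)"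
      using p0 by (rule mult_left_mono)
    moreover have "pr n (\<lambda>G. G \<notin> T) \<le> 3 * \<delta>" using elim(5) by (simp add: T_def)
    \<comment> \<open>One \<open>\<delta>\<close> for the failures of the adversary and twice the
      \<open>3 * \<delta>\<close> of \<open>eventually_pr_good\<close>.\<close>
    ultimately have "1 - 7 * \<delta> \<le> p * (g \<delta> * D\<^sup>2)" using main elim(4) by linarith
    then have "(1 - 7 * \<delta>) / g \<delta> \<le> p * D\<^sup>2" using g0 by (simp add: pos_divide_le_eq mult_ac)
    then have "1 - \<epsilon> \<le> p * (real n * ln n)" using \<delta>(3) D2 by simp
    then show ?case using nl by (simp add: p_def pos_divide_le_eq)
  qed
qed

subsection \<open>Pairs of vertices with prescribed degrees\<close>

text \<open>By Pascal's rule, used twice, \<open>bp (n - 2) k\<close> is the mean of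
  \<open>bp (n - 4)\<close> at \<open>k - 2\<close>, \<open>k - 1\<close>, \<open>k\<close> with
  weights 1/4, 1/2, 1/4, and these values nearly agree. For \<open>n - 3\<close> a crude factor is
  enough, since triples of vertices only enter lower-order terms.\<close>

lemma window_shift:
  assumes "0 < \<eta>"
  shows "\<forall>\<^sub>F n in sequentially. \<forall>k. \<bar>real k - real n / 2\<bar> \<le> dd n + 2 \<longrightarrow> (\<forall>s\<le>2.
     bp (n - 4) (k - s) \<le> (1 + \<eta>) * bp (n - 2) k \<and> bp (n - 3) (k - s) \<le> 2 * bp (n - 2) k)"
proof -
  define \<theta> where "\<theta> = min (1 / 2) (\<eta> / 3)"
  have \<theta>: "0 < \<theta>" "\<theta> \<le> 1 / 2" "3 * \<theta> \<le> \<eta>" using assms by (auto simp: \<theta>_def)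
  show ?thesis using window_ratio[OF \<theta>(1)] eventually_ge_at_top[of 8]
  proof eventually_elim
    case (elim n)
    show ?case
    proof (intro allI impI)
      fix k s :: nat assume k: "\<bar>real k - real n / 2\<bar> \<le> dd n + 2" and s: "s \<le> 2"
      have "4 \<le> k" using elim(1)[rule_format, of k "n - 1"] k elim(2) by simp
      then obtain j where j: "k = Suc (Suc j)" using that[of "k - 2"] by simp
      have w: "bp N (Suc l) \<le> (1 + \<theta>) * bp N l \<and> bp N l \<le> (1 + \<theta>) * bp N (Suc l)"
        if "l = j \<or> l = Suc j" "n \<le> N + 4" "N < n" for l N
      proof -
        have "\<bar>real l - real n / 2\<bar> \<le> dd n + 4" using k that(1) by (auto simp: j)
        then show ?thesis using elim(1) that by blast
      qed
      define a where "a = (\<lambda>l. bp (n - 4) l)"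
      define b where "b = (\<lambda>l. bp (n - 3) l)"
      have n3: "n - 3 = Suc (n - 4)" and n2: "n - 2 = Suc (n - 3)" using elim(2) by auto
      have bk: "bp (n - 2) k = (b (Suc j) + b k) / 2" unfolding n2 j b_def by (rule bp_Suc_Suc)
      have b1: "b k = (a (Suc j) + a k) / 2" "b (Suc j) = (a j + a (Suc j)) / 2"
        unfolding n3 j a_def b_def by (rule bp_Suc_Suc)+
      have a0: "0 \<le> a l" "0 \<le> b l" for l by (auto simp: a_def b_def)
      have wa: "a (Suc j) \<le> (1 + \<theta>) * a j" "a j \<le> (1 + \<theta>) * a (Suc j)" "a k \<le> (1 + \<theta>) * a (Suc j)" "a (Suc j) \<le> (1 + \<theta>) * a k"
        using w[of j "n - 4"] w[of "Suc j" "n - 4"] elim(2) by (auto simp: a_def j)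
      have wb: "b (Suc j) \<le> (1 + \<theta>) * b j" "b j \<le> (1 + \<theta>) * b (Suc j)" "b k \<le> (1 + \<theta>) * b (Suc j)" "b (Suc j) \<le> (1 + \<theta>) * b k"
        using w[of j "n - 3"] w[of "Suc j" "n - 3"] elim(2) by (auto simp: b_def j)
      have th2: "(1 + \<theta>) * (1 + \<theta>) \<le> 1 + \<eta>"
      proof -
        have "\<theta> * \<theta> \<le> 1 * \<theta>" using \<theta> by (intro mult_right_mono) auto
        moreover have "(1 + \<theta>) * (1 + \<theta>) = 1 + 2 * \<theta> + \<theta> * \<theta>" by (simp add: algebra_simps)
        ultimately show ?thesis using \<theta> by linarith
      qed
      have up: "x \<le> (1 + \<eta>) * y" if "x \<le> (1 + \<theta>) * z" "z \<le> (1 + \<theta>) * y" "0 \<le> y" for x y z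
      proof -
        have "x \<le> (1 + \<theta>) * ((1 + \<theta>) * y)" using that(1) mult_left_mono[OF that(2), of "1 + \<theta>"] \<theta> by linarith
        also have "\<dots> \<le> (1 + \<eta>) * y" using mult_right_mono[OF th2 that(3)] by (simp add: mult.assoc)
        finally show ?thesis .
      qed
      have up1: "x \<le> (1 + \<eta>) * y" if "x \<le> (1 + \<theta>) * y" "0 \<le> y" for x y
        using that \<theta> mult_right_mono[of \<theta> \<eta> y] by (simp add: distrib_right)
      have up0: "x \<le> (1 + \<eta>) * x" if "0 \<le> x" for x using that assms by (simp add: distrib_right)
      have avg4: "(1 + \<eta>) * bp (n - 2) k = ((1 + \<eta>) * a j + 2 * ((1 + \<eta>) * a (Suc j)) + (1 + \<eta>) * a k) / 4"
        unfolding bk b1 by (simp add: field_simps)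
      have 1: "a (k - s) \<le> (1 + \<eta>) * bp (n - 2) k"
      proof -
        consider "s = 0" | "s = 1" | "s = 2" using s by linarith
        then show ?thesis
        proof cases
          case 1
          have "a k \<le> (1 + \<eta>) * a j" "a k \<le> (1 + \<eta>) * a (Suc j)" "a k \<le> (1 + \<eta>) * a k"
            using up[OF wa(3) wa(1) a0(1)] up1[OF wa(3) a0(1)] up0[OF a0(1)] by auto
          then show ?thesis unfolding avg4 1 by simp
        next
          case 2
          have "a (Suc j) \<le> (1 + \<eta>) * a j" "a (Suc j) \<le> (1 + \<eta>) * a (Suc j)" "a (Suc j) \<le> (1 + \<eta>) * a k"
            using up1[OF wa(1) a0(1)] up1[OF wa(4) a0(1)] up0[OF a0(1)] by auto
          then show ?thesis unfolding avg4 2 by (simp add: j)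
        next
          case 3
          have "a j \<le> (1 + \<eta>) * a j" "a j \<le> (1 + \<eta>) * a (Suc j)" "a j \<le> (1 + \<eta>) * a k"
            using up[OF wa(2) wa(4) a0(1)] up1[OF wa(2) a0(1)] up0[OF a0(1)] by auto
          then show ?thesis unfolding avg4 3 by (simp add: j)
        qed
      qed
      have 2: "b (k - s) \<le> 2 * bp (n - 2) k"
      proof -
        consider "s = 0" | "s = 1" | "s = 2" using s by linarith
        then show ?thesis
        proof cases
          case 3
          have "\<theta> * b (Suc j) \<le> 1 / 2 * b (Suc j)" using \<theta> a0 by (intro mult_right_mono) auto
          moreover have "b (Suc j) \<le> 2 * b k" using wb(4) mult_right_mono[of "1 + \<theta>" 2 "b k"] \<theta> a0(2)[of k] by linarith
          ultimately show ?thesis using wb(2) unfolding bk 3 by (simp add: j distrib_right)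
        next
          case 1
          show ?thesis using a0(2)[of "Suc j"] unfolding bk 1 by simp
        next
          case 2
          show ?thesis using a0(2)[of k] unfolding bk 2 by (simp add: j)
        qed
      qed
      show "bp (n - 4) (k - s) \<le> (1 + \<eta>) * bp (n - 2) k \<and> bp (n - 3) (k - s) \<le> 2 * bp (n - 2) k"
        using 1 2 by (simp add: a_def b_def)
    qed
  qed
qed

lemma inner_degree_eq_nbrs:
  assumes "G \<in> graphs_on n" "x \<in> S"
  shows "inner_degree S G x = card (nbrs G x \<inter> S)"
proof -
  have "bij_betw (\<lambda>w. {x, w}) (nbrs G x \<inter> S) {e \<in> G. x \<in> e \<and> e \<subseteq> S}"
  proof (rule bij_betw_imageI)
    show "inj_on (\<lambda>w. {x, w}) (nbrs G x \<inter> S)" by (rule inj_onI) (auto simp: doubleton_eq_iff)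
    have "e \<in> (\<lambda>w. {x, w}) ` (nbrs G x \<inter> S)" if "e \<in> G" "x \<in> e" "e \<subseteq> S" for e
    proof -
      have "e \<in> edges_on n" using that assms by (auto simp: graphs_on_eq)
      then obtain a b where "e = {a, b}" by (rule edges_onE)
      then have "e = {x, b} \<or> e = {x, a}" using that by auto
      then show ?thesis using that by (auto simp: nbrs_def)
    qed
    then show "(\<lambda>w. {x, w}) ` (nbrs G x \<inter> S) = {e \<in> G. x \<in> e \<and> e \<subseteq> S}" using assms(2) by (auto simp: nbrs_def)
  qed
  then show ?thesis by (simp add: bij_betw_same_card inner_degree_def)
qed

lemma inner_degree_le:
  assumes "G \<in> graphs_on n" "x \<in> S" "finite S" "Z \<subseteq> S - {x}" "Z \<inter> nbrs G x = {}"
  shows "inner_degree S G x \<le> card S - 1 - card Z"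
proof -
  have "card (nbrs G x \<inter> S) \<le> card (S - {x} - Z)"
    by (rule card_mono) (use assms nbrs_subset[OF assms(1), of x] in auto)
  also have "\<dots> = card S - 1 - card Z" using assms finite_subset[of Z "S - {x}"] by (simp add: card_Diff_subset)
  finally show ?thesis by (simp add: inner_degree_eq_nbrs[OF assms(1,2)])
qed

definition nonadj :: "nat \<Rightarrow> nat \<Rightarrow> nat \<times> nat \<Rightarrow> graph \<Rightarrow> bool" where
  "nonadj i j p G \<longleftrightarrow> {fst p, snd p} \<notin> G \<and> vertex_degree G (fst p) = i \<and> vertex_degree G (snd p) = j"

text \<open>Each vertex has one of the three others excluded as a neighbour, so inner degrees are at
  most 2. The factor 1 / 4 has to be exact, because disjoint pairs carry the main term of the second
  moment.\<close>

lemma pr_nonadj_disjoint: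
  assumes "u \<in> {1..n}" "v \<in> {1..n}" "u' \<in> {1..n}" "v' \<in> {1..n}" "distinct [u, v, u', v']"
    and B: "\<And>s. s \<le> 2 \<Longrightarrow> bp (n - 4) (i - s) \<le> x" "\<And>s. s \<le> 2 \<Longrightarrow> bp (n - 4) (j - s) \<le> y" "0 \<le> x" "0 \<le> y"
  shows "pr n (\<lambda>G. nonadj i j (u, v) G \<and> nonadj i j (u', v') G) \<le> 1 / 4 * (x * y * (x * y))"
proof -
  let ?S = "{u, v, u', v'}"
  let ?F = "\<lambda>G. G \<inter> {{u, v}, {u', v'}} = {}"
  let ?k = "\<lambda>z. if z = u \<or> z = u' then i else j"
  let ?B = "\<lambda>z. if z = u \<or> z = u' then x else y"
  have c4: "card ?S = 4" using assms by simp
  have "pr n (\<lambda>G. nonadj i j (u, v) G \<and> nonadj i j (u', v') G) = pr n (\<lambda>G. ?F G \<and> (\<forall>z\<in>?S. vertex_degree G z = ?k z))"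
    by (rule pr_cong) (use assms in \<open>auto simp: nonadj_def\<close>)
  also have "\<dots> \<le> pr n ?F * (\<Prod>z\<in>?S. ?B z)"
  proof (rule joint_degrees_le)
    show "?S \<subseteq> {1..n}" using assms by auto
    fix G H assume "G \<inter> Pow ?S = H \<inter> Pow ?S"
    then have "{u, v} \<in> G \<longleftrightarrow> {u, v} \<in> H" "{u', v'} \<in> G \<longleftrightarrow> {u', v'} \<in> H"
      using eqset_imp_iff[of "G \<inter> Pow ?S" "H \<inter> Pow ?S" "{u, v}"] eqset_imp_iff[of "G \<inter> Pow ?S" "H \<inter> Pow ?S" "{u', v'}"] by auto
    then show "?F G = ?F H" by auto
  next
    fix G z assume G: "G \<in> graphs_on n" and F: "?F G" and z: "z \<in> ?S"
    have nb: "v \<notin> nbrs G u" "u \<notin> nbrs G v" "v' \<notin> nbrs G u'" "u' \<notin> nbrs G v'"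
      using F by (auto simp: nbrs_def insert_commute)
    have "inner_degree ?S G z \<le> card ?S - 1 - 1"
    proof -
      define t where "t = (if z = u then v else if z = v then u else if z = u' then v' else u')"
      have "t \<in> ?S - {z}" "t \<notin> nbrs G z" using z nb assms(5) by (auto simp: t_def)
      then show ?thesis using inner_degree_le[OF G z, of "{t}"] by simp
    qed
    then have "inner_degree ?S G z \<le> 2" using c4 by simp
    then show "bp (n - card ?S) (?k z - inner_degree ?S G z) \<le> ?B z" using B c4 by auto
  next
    show "0 \<le> ?B z" for z using B by auto
  qed
  also have "pr n ?F = 1 / 2 ^ card {{u, v}, {u', v'}}"
    by (rule pr_avoid_edges) (use assms in \<open>auto simp: doubleton_in_edges_on\<close>)
  also have "card {{u, v}, {u', v'}} = 2" using assms(5) by (auto simp: doubleton_eq_iff)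
  also have "(\<Prod>z\<in>?S. ?B z) = x * y * (x * y)" using assms(5) by auto
  finally show ?thesis by simp
qed

text \<open>Non-adjacency is dropped: triples are fewer than quadruples by a factor of order
  \<open>n\<close>, so constant factors do no harm.\<close>

lemma pr_nonadj_triple:
  assumes S: "u \<in> {1..n}" "v \<in> {1..n}" "w \<in> {1..n}" "distinct [u, v, w]"
    and B: "\<And>s. s \<le> 2 \<Longrightarrow> bp (n - 3) (i - s) \<le> x" "\<And>s. s \<le> 2 \<Longrightarrow> bp (n - 3) (j - s) \<le> y" "0 \<le> x" "0 \<le> y"
  shows "pr n (\<lambda>G. vertex_degree G u = i \<and> vertex_degree G v = j \<and> vertex_degree G w = j) \<le> x * y * y"
proof -
  let ?S = "{u, v, w}"
  let ?k = "\<lambda>z. if z = u then i else j"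
  let ?B = "\<lambda>z. if z = u then x else y"
  have c3: "card ?S = 3" using assms by simp
  have "pr n (\<lambda>G. vertex_degree G u = i \<and> vertex_degree G v = j \<and> vertex_degree G w = j) =
     pr n (\<lambda>G. True \<and> (\<forall>z\<in>?S. vertex_degree G z = ?k z))"
    by (rule pr_cong) (use assms in auto)
  also have "\<dots> \<le> pr n (\<lambda>_. True) * (\<Prod>z\<in>?S. ?B z)"
  proof (rule joint_degrees_le)
    show "?S \<subseteq> {1..n}" using assms by auto
  next
    fix G z assume G: "G \<in> graphs_on n" and z: "z \<in> ?S"
    have "inner_degree ?S G z \<le> 2" using inner_degree_le[OF G z, of "{}"] c3 by simp
    then show "bp (n - card ?S) (?k z - inner_degree ?S G z) \<le> ?B z" using B c3 by auto
  next
    show "0 \<le> ?B z" for z using B by auto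
  qed simp
  also have "(\<Prod>z\<in>?S. ?B z) = x * y * y" using S by auto
  finally show ?thesis by simp
qed

text \<open>Chebyshev's inequality for the number \<open>X\<close> of suitable ordered pairs. Two
  such pairs coincide, share a vertex in the same role, or are disjoint; a vertex in both roles is
  impossible as \<open>i \<noteq> j\<close>. Overlapping pairs contribute little because the
  expected counts exceed \<open>K\<close>.\<close>

lemma nonadj_second_moment:
  assumes n: "4 \<le> n" and ij: "i \<noteq> j"
    and B: "\<And>k s. k \<in> {i, j} \<Longrightarrow> s \<le> 2 \<Longrightarrow>
      bp (n - 4) (k - s) \<le> (1 + \<eta>) * bp (n - 2) k \<and> bp (n - 3) (k - s) \<le> 2 * bp (n - 2) k"
    and \<eta>: "0 < \<eta>" "\<eta> \<le> 1" and K: "1 \<le> K" "K \<le> real n * bp (n - 2) i" "K \<le> real n * bp (n - 2) j"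
  shows "pr n (\<lambda>G. \<not> (\<exists>u\<in>{1..n}. \<exists>v\<in>{1..n}. u \<noteq> v \<and> nonadj i j (u, v) G)) \<le>
    real n / (real n - 1) * (1 + 15 * \<eta> + 66 / K) - 1"
proof -
  define P where "P = {p \<in> {1..n} \<times> {1..n}. fst p \<noteq> snd p}"
  define a where "a = bp (n - 2) i"
  define b where "b = bp (n - 2) j"
  define X where "X = (\<lambda>G. \<Sum>p\<in>P. (of_bool (nonadj i j p G) :: real))"
  have n0: "0 < real n" "0 < real n - 1" using n by auto
  have pos: "0 < x" if "K \<le> real n * x" "0 \<le> x" for x using that K(1) by (cases "x = 0") auto
  have a: "0 < a" "0 \<le> a" "K \<le> real n * a" and b: "0 < b" "0 \<le> b" "K \<le> real n * b"
    using K pos[of a] pos[of b] by (auto simp: a_def b_def)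
  have finP: "finite P" by (rule finite_subset[of _ "{1..n} \<times> {1..n}"]) (auto simp: P_def)
  have cardP: "real (card P) = real n * (real n - 1)"
  proof -
    have "P = (SIGMA u:{1..n}. {1..n} - {u})" by (auto simp: P_def)
    then have "card P = (\<Sum>u\<in>{1..n}. card ({1..n} - {u}))" by simp
    also have "\<dots> = (\<Sum>u\<in>{1..n}. n - 1)" by (rule sum.cong) auto
    finally show ?thesis using n by (simp add: of_nat_diff)
  qed
  have p1: "pr n (nonadj i j p) = a * b / 2" if "p \<in> P" for p
    using pr_degree_nonadjacent[of "fst p" n "snd p" i j] that
    by (auto simp: P_def a_def b_def nonadj_def[abs_def])
  have EX: "avg n X = real n * (real n - 1) * (a * b / 2)"
  proof -
    have "avg n X = (\<Sum>p\<in>P. pr n (nonadj i j p))" unfolding X_def avg_sum pr_def ..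
    also have "\<dots> = (\<Sum>p\<in>P. a * b / 2)" by (rule sum.cong[OF refl p1])
    finally show ?thesis by (simp add: cardP)
  qed
  define t1 where "t1 = a * b / 2"
  define t2 where "t2 = 8 * a * b * b"
  define t3 where "t3 = 8 * b * a * a"
  define t4 where "t4 = 1 / 4 * ((1 + \<eta>) * a * ((1 + \<eta>) * b) * ((1 + \<eta>) * a * ((1 + \<eta>) * b)))"
  have nn: "0 \<le> t1" "0 \<le> t2" "0 \<le> t3" "0 \<le> t4" using a b \<eta> by (auto simp: t1_def t2_def t3_def t4_def)
  \<comment> \<open>A majorant with one term for each kind of overlap, summed below over all of
    \<open>{1..n} \<times> {1..n}\<close>; this enlargement causes the factor
    \<open>n / (n - 1)\<close>.\<close>
  define bd where "bd = (\<lambda>(p :: nat \<times> nat) q. of_bool (q = p) * t1 + of_bool (fst q = fst p) * t2 +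
      of_bool (snd q = snd p) * t3 + t4)"
  have bij: "bp (n - 4) (i - s) \<le> (1 + \<eta>) * a" "bp (n - 4) (j - s) \<le> (1 + \<eta>) * b"
     "bp (n - 3) (i - s) \<le> 2 * a" "bp (n - 3) (j - s) \<le> 2 * b" if "s \<le> 2" for s
    using B that by (auto simp: a_def b_def)
  have p2: "pr n (\<lambda>G. nonadj i j p G \<and> nonadj i j q G) \<le> bd p q" if p: "p \<in> P" and q: "q \<in> P" for p q
  proof -
    obtain u v where p': "p = (u, v)" "u \<in> {1..n}" "v \<in> {1..n}" "u \<noteq> v" using p by (auto simp: P_def)
    obtain u' v' where q': "q = (u', v')" "u' \<in> {1..n}" "v' \<in> {1..n}" "u' \<noteq> v'" using q by (auto simp: P_def)
    consider "u = v' \<or> v = u'" | "p = q" | "u = u'" "v \<noteq> v'" | "v = v'" "u \<noteq> u'" |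
       "u \<noteq> v'" "v \<noteq> u'" "u \<noteq> u'" "v \<noteq> v'" using p' q' by auto
    then show ?thesis
    proof cases
      case 1
      then have "pr n (\<lambda>G. nonadj i j p G \<and> nonadj i j q G) = pr n (\<lambda>_. False)"
        using ij by (intro pr_cong) (auto simp: nonadj_def p' q')
      then show ?thesis using nn by (simp add: bd_def)
    next
      case 2
      then have "pr n (\<lambda>G. nonadj i j p G \<and> nonadj i j q G) = t1" using p1[OF p] by (simp add: t1_def)
      moreover have "bd p q = t1 + t2 + t3 + t4" using 2 by (simp add: bd_def)
      ultimately show ?thesis using nn by linarith
    next
      case 3
      have "pr n (\<lambda>G. nonadj i j p G \<and> nonadj i j q G) \<le>
        pr n (\<lambda>G. vertex_degree G u = i \<and> vertex_degree G v = j \<and> vertex_degree G v' = j)"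
        by (rule pr_mono) (auto simp: nonadj_def p' q')
      also have "\<dots> \<le> (2 * a) * (2 * b) * (2 * b)"
        by (rule pr_nonadj_triple) (use p' q' 3 bij a b in auto)
      also have "\<dots> = t2" by (simp add: t2_def)
      finally show ?thesis using nn 3 by (simp add: bd_def p' q')
    next
      case 4
      have "pr n (\<lambda>G. nonadj i j p G \<and> nonadj i j q G) \<le>
        pr n (\<lambda>G. vertex_degree G v = j \<and> vertex_degree G u = i \<and> vertex_degree G u' = i)"
        by (rule pr_mono) (auto simp: nonadj_def p' q')
      also have "\<dots> \<le> (2 * b) * (2 * a) * (2 * a)"
        by (rule pr_nonadj_triple) (use p' q' 4 bij a b in auto)
      also have "\<dots> = t3" by (simp add: t3_def)
      finally show ?thesis using nn 4 by (simp add: bd_def p' q')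
    next
      case 5
      have "pr n (\<lambda>G. nonadj i j p G \<and> nonadj i j q G) \<le> t4"
        unfolding p' q' t4_def by (rule pr_nonadj_disjoint) (use p' q' 5 bij a b \<eta> in auto)
      then show ?thesis using nn 5 by (simp add: bd_def p' q')
    qed
  qed
  let ?c = "t1 + real n * t2 + real n * t3 + (real n)\<^sup>2 * t4"
  have sumbd: "(\<Sum>q\<in>P. bd p q) \<le> ?c" if p: "p \<in> P" for p
  proof -
    have p': "p \<in> {1..n} \<times> {1..n}" "fst p \<in> {1..n}" "snd p \<in> {1..n}" using p by (auto simp: P_def)
    have "(\<Sum>q\<in>P. bd p q) \<le> (\<Sum>q\<in>{1..n} \<times> {1..n}. bd p q)"
      by (rule sum_mono2) (use nn in \<open>auto simp: P_def bd_def\<close>)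
    also have "\<dots> = ?c"
    proof -
      have 1: "(\<Sum>q\<in>{1..n} \<times> {1..n}. of_bool (q = p) :: real) = 1"
        using p'(1) by (simp add: of_bool_def)
      have f1: "(\<Sum>u\<in>{1..n}. (of_bool (u = z) :: real)) = 1" if "z \<in> {1..n}" for z :: nat
        using that by (simp add: of_bool_def sum.delta)
      have 2: "(\<Sum>q\<in>{1..n} \<times> {1..n}. (of_bool (fst q = fst p) :: real)) = real n"
      proof -
        have "(\<Sum>q\<in>{1..n} \<times> {1..n}. (of_bool (fst q = fst p) :: real)) =
           (\<Sum>u\<in>{1..n}. \<Sum>v\<in>{1..n}. of_bool (u = fst p))"
          by (simp only: sum.cartesian_product case_prod_unfold)
        also have "\<dots> = real n * (\<Sum>u\<in>{1..n}. of_bool (u = fst p))" by (simp add: sum_distrib_left)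
        finally show ?thesis using f1[OF p'(2)] by simp
      qed
      have 3: "(\<Sum>q\<in>{1..n} \<times> {1..n}. (of_bool (snd q = snd p) :: real)) = real n"
      proof -
        have "(\<Sum>q\<in>{1..n} \<times> {1..n}. (of_bool (snd q = snd p) :: real)) =
           (\<Sum>u\<in>{1..n}. \<Sum>v\<in>{1..n}. of_bool (v = snd p))"
          by (simp only: sum.cartesian_product case_prod_unfold)
        also have "\<dots> = real n" using f1[OF p'(3)] by simp
        finally show ?thesis .
      qed
      show ?thesis
        unfolding bd_def sum.distrib sum_distrib_right[symmetric] 1 2 3
        by (simp add: power2_eq_square)
    qed
    finally show ?thesis .
  qed
  have "avg n (\<lambda>G. (X G)\<^sup>2) = (\<Sum>p\<in>P. \<Sum>q\<in>P. pr n (\<lambda>G. nonadj i j p G \<and> nonadj i j q G))"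
  proof -
    have "(X G)\<^sup>2 = (\<Sum>p\<in>P. \<Sum>q\<in>P. of_bool (nonadj i j p G \<and> nonadj i j q G))" for G
      unfolding X_def power2_eq_square sum_product by (intro sum.cong refl) auto
    then show ?thesis unfolding pr_def by (simp only: avg_sum)
  qed
  also have "\<dots> \<le> (\<Sum>p\<in>P. \<Sum>q\<in>P. bd p q)" by (intro sum_mono p2)
  also have "\<dots> \<le> (\<Sum>p\<in>P. ?c)" by (intro sum_mono sumbd)
  also have "\<dots> = real n * (real n - 1) * ?c" by (simp add: cardP)
  finally have EX2: "avg n (\<lambda>G. (X G)\<^sup>2) \<le> real n * (real n - 1) * ?c" .
  define m where "m = avg n X"
  have m0: "0 < m" unfolding m_def EX using n0 a b by simp
  have "pr n (\<lambda>G. \<not> (\<exists>u\<in>{1..n}. \<exists>v\<in>{1..n}. u \<noteq> v \<and> nonadj i j (u, v) G)) \<le> pr n (\<lambda>G. m \<le> \<bar>X G - m\<bar>)"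
  proof (rule pr_mono)
    fix G assume no: "\<not> (\<exists>u\<in>{1..n}. \<exists>v\<in>{1..n}. u \<noteq> v \<and> nonadj i j (u, v) G)"
    have "\<not> nonadj i j p G" if "p \<in> P" for p
    proof -
      obtain u v where "p = (u, v)" "u \<in> {1..n}" "v \<in> {1..n}" "u \<noteq> v" using \<open>p \<in> P\<close> by (auto simp: P_def)
      then show ?thesis using no by blast
    qed
    then have "X G = 0" by (simp add: X_def)
    then show "m \<le> \<bar>X G - m\<bar>" by simp
  qed
  also have "\<dots> \<le> avg n (\<lambda>G. (X G - m)\<^sup>2) / m\<^sup>2" by (rule pr_chebyshev[OF m0])
  also have "avg n (\<lambda>G. (X G - m)\<^sup>2) = avg n (\<lambda>G. (X G)\<^sup>2) - m\<^sup>2"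
  proof -
    have "avg n (\<lambda>G. (X G - m)\<^sup>2) = avg n (\<lambda>G. (X G)\<^sup>2 - (2 * m) * X G + m\<^sup>2)"
      by (rule avg_cong) (simp add: power2_eq_square algebra_simps)
    also have "\<dots> = avg n (\<lambda>G. (X G)\<^sup>2) - m\<^sup>2"
      unfolding avg_add avg_diff avg_cmult m_def[symmetric] by (simp add: power2_eq_square)
    finally show ?thesis .
  qed
  also have "(avg n (\<lambda>G. (X G)\<^sup>2) - m\<^sup>2) / m\<^sup>2 = avg n (\<lambda>G. (X G)\<^sup>2) / m\<^sup>2 - 1"
    using m0 by (simp add: diff_divide_distrib)
  also have "avg n (\<lambda>G. (X G)\<^sup>2) / m\<^sup>2 \<le> real n * (real n - 1) * ?c / m\<^sup>2"
    by (rule divide_right_mono[OF EX2]) simp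
  also have "\<dots> = real n / (real n - 1) * (2 / (real n * a * (real n * b)) + 32 / (real n * a) + 32 / (real n * b) + (1 + \<eta>) ^ 4)"
  proof -
    have "N * M * (a * b / 2 + N * (8 * a * b * b) + N * (8 * b * a * a) +
        N\<^sup>2 * (1 / 4 * (e * a * (e * b) * (e * a * (e * b))))) / (N * M * (a * b / 2))\<^sup>2 =
      N / M * (2 / (N * a * (N * b)) + 32 / (N * a) + 32 / (N * b) + e ^ 4)"
      if "0 < N" "0 < M" for N M e :: real
      using that a(1) b(1) by (simp add: divide_simps power2_eq_square power4_eq_xxxx) (simp add: algebra_simps)
    from this[OF n0] show ?thesis unfolding m_def EX t1_def t2_def t3_def t4_def .
  qed
  \<comment> \<open>Here 66 arises as 2 + 32 + 32, and 15 from applying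
    \<open>(1 + \<eta>)^2 \<le> 1 + 3 * \<eta>\<close> and squaring.\<close>
  also have "\<dots> \<le> real n / (real n - 1) * (2 / K + 32 / K + 32 / K + (1 + 15 * \<eta>))"
  proof (intro mult_left_mono add_mono)
    have "K * 1 \<le> real n * a * (real n * b)" using a(3) b(3) K(1) by (intro mult_mono) auto
    then show "2 / (real n * a * (real n * b)) \<le> 2 / K" using K(1) by (intro divide_left_mono) auto
    show "32 / (real n * a) \<le> 32 / K" "32 / (real n * b) \<le> 32 / K"
      using a b K(1) n0 by (auto intro!: divide_left_mono)
    have "(1 + \<eta>)\<^sup>2 \<le> 1 + 3 * \<eta>" using \<eta> by (simp add: power2_eq_square algebra_simps mult_left_le)
    then have "((1 + \<eta>)\<^sup>2)\<^sup>2 \<le> (1 + 3 * \<eta>)\<^sup>2" using \<eta> by (intro power_mono) auto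
    also have "\<dots> \<le> 1 + 15 * \<eta>" using \<eta> by (simp add: power2_eq_square algebra_simps mult_left_le)
    finally show "(1 + \<eta>) ^ 4 \<le> 1 + 15 * \<eta>" by (simp add: power_mult[symmetric])
  qed (use n0 in auto)
  finally show ?thesis by (simp add: add.commute add.left_commute add_divide_distrib[symmetric])
qed

lemma nonadj_exists_whp:
  assumes \<delta>: "0 < \<delta>" "\<delta> < 1" and \<epsilon>: "0 < \<epsilon>"
  shows "\<forall>\<^sub>F n in sequentially. \<forall>i j. i \<noteq> j \<longrightarrow> \<bar>real i - real n / 2\<bar> \<le> (1 - \<delta>) * dd n / 2 + 2 \<longrightarrow>
     \<bar>real j - real n / 2\<bar> \<le> (1 - \<delta>) * dd n / 2 + 2 \<longrightarrow>
     pr n (\<lambda>G. \<not> (\<exists>u\<in>{1..n}. \<exists>v\<in>{1..n}. u \<noteq> v \<and> nonadj i j (u, v) G)) \<le> \<epsilon>"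
proof -
  define \<theta> where "\<theta> = min \<epsilon> 1"
  have \<theta>: "0 < \<theta>" "\<theta> \<le> 1" "\<theta> \<le> \<epsilon>" using \<epsilon> by (auto simp: \<theta>_def)
  \<comment> \<open>With \<open>K\<close> below, \<open>15 * \<eta>\<close> and
    \<open>66 / K\<close> both equal \<open>\<theta> / 4\<close>; the cap on \<open>\<theta>\<close>
    ensures \<open>\<eta> \<le> 1 \<le> K\<close>.\<close>
  define \<eta> where "\<eta> = \<theta> / 60"
  define K where "K = 264 / \<theta>"
  have \<eta>: "0 < \<eta>" "\<eta> \<le> 1" using \<theta> by (auto simp: \<eta>_def)
  have K1: "1 \<le> K" using \<theta> by (simp add: K_def field_simps)
  have "(\<lambda>n::nat. real n / (real n - 1) * (1 + \<theta> / 2)) \<longlonglongrightarrow> 1 + \<theta> / 2" by real_asymp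
  then have e: "\<forall>\<^sub>F n::nat in sequentially. real n / (real n - 1) * (1 + \<theta> / 2) < 1 + \<theta>"
    by (rule order_tendstoD) (use \<theta> in auto)
  show ?thesis using window_lower[OF \<delta>, of K] window_shift[OF \<eta>(1)] e eventually_ge_at_top[of 4]
  proof eventually_elim
    case (elim n)
    show ?case
    proof (intro allI impI)
      fix i j :: nat
      assume ij: "i \<noteq> j" "\<bar>real i - real n / 2\<bar> \<le> (1 - \<delta>) * dd n / 2 + 2" "\<bar>real j - real n / 2\<bar> \<le> (1 - \<delta>) * dd n / 2 + 2"
      have D0: "0 \<le> dd n" using elim(4) by (simp add: dd_def)
      have "(1 - \<delta>) * dd n \<le> 1 * dd n" using \<delta> D0 by (intro mult_right_mono) auto
      then have w: "\<bar>real k - real n / 2\<bar> \<le> dd n + 2" if "k \<in> {i, j}" for k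
        using ij D0 that by auto
      have "pr n (\<lambda>G. \<not> (\<exists>u\<in>{1..n}. \<exists>v\<in>{1..n}. u \<noteq> v \<and> nonadj i j (u, v) G)) \<le>
        real n / (real n - 1) * (1 + 15 * \<eta> + 66 / K) - 1"
      proof (rule nonadj_second_moment[OF elim(4) ij(1) _ \<eta> K1])
        fix k s :: nat assume "k \<in> {i, j}" "s \<le> 2"
        then show "bp (n - 4) (k - s) \<le> (1 + \<eta>) * bp (n - 2) k \<and> bp (n - 3) (k - s) \<le> 2 * bp (n - 2) k"
          using elim(2)[rule_format, OF w] by blast
      next
        show "K \<le> real n * bp (n - 2) i" "K \<le> real n * bp (n - 2) j" using elim(1) ij by blast+
      qed
      also have "1 + 15 * \<eta> + 66 / K = 1 + \<theta> / 2" by (simp add: \<eta>_def K_def)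
      finally show "pr n (\<lambda>G. \<not> (\<exists>u\<in>{1..n}. \<exists>v\<in>{1..n}. u \<noteq> v \<and> nonadj i j (u, v) G)) \<le> \<epsilon>"
        using elim(3) \<theta>(3) by linarith
    qed
  qed
qed

subsection \<open>The construction\<close>

text \<open>\<open>h\<close> is the discrete derivative of the vertex function, so an added edge
  changes the potential by \<open>h\<close> at the old degrees of its two ends.\<close>

definition potential :: "nat \<Rightarrow> (nat \<Rightarrow> nat) \<Rightarrow> graph \<Rightarrow> nat" where
  "potential n h G = (\<Sum>v\<in>{1..n}. \<Sum>l<vertex_degree G v. h l)"

lemma potential_cong:
  assumes "\<forall>i. degcount n G i = degcount n H i"
  shows "potential n h G = potential n h H"
proof -
  have "potential n h G = (\<Sum>d\<in>#degree_multiset n G. \<Sum>l<d. h l)" for G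
    unfolding potential_def sum_unfold_sum_mset degree_multiset_def by (simp add: image_mset.compositionality o_def)
  then show ?thesis using assms by (simp add: degree_multiset_eq_iff[symmetric])
qed

lemma potential_insert:
  assumes G: "G \<in> graphs_on n" and uv: "u \<in> {1..n}" "v \<in> {1..n}" "u \<noteq> v" "{u, v} \<notin> G"
  shows "potential n h (insert {u, v} G) = potential n h G + h (vertex_degree G u) + h (vertex_degree G v)"
proof -
  let ?g = "\<lambda>d. \<Sum>l<d. h l"
  have "?g (vertex_degree (insert {u, v} G) w) = ?g (vertex_degree G w) + (if w = u \<or> w = v then h (vertex_degree G w) else 0)" for w
    using vertex_degree_insert[OF graphs_on_finite[OF G] uv(4), of w] by simp
  then have "potential n h (insert {u, v} G) = potential n h G + (\<Sum>w\<in>{1..n}. if w = u \<or> w = v then h (vertex_degree G w) else 0)"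
    unfolding potential_def by (simp only: sum.distrib)
  also have "(\<Sum>w\<in>{1..n}. if w = u \<or> w = v then h (vertex_degree G w) else 0) = (\<Sum>w\<in>{u, v}. h (vertex_degree G w))"
    by (rule sum.mono_neutral_cong_right) (use uv in auto)
  finally show ?thesis using uv by simp
qed

text \<open>An adjacent pair of degrees \<open>i + 1\<close>, \<open>j + 1\<close> is a non-adjacent
  pair of degrees \<open>n - 2 - i\<close>, \<open>n - 2 - j\<close> of the complement, so removals
  need no second-moment argument of their own.\<close>

lemma nonadj_swap_compl:
  assumes "G \<in> graphs_on n" "i + 2 \<le> n" "j + 2 \<le> n"
    and "u \<in> {1..n}" "v \<in> {1..n}" "u \<noteq> v" "nonadj (n - 2 - i) (n - 2 - j) (u, v) (edges_on n - G)"
  shows "{u, v} \<in> G \<and> vertex_degree G u = Suc i \<and> vertex_degree G v = Suc j"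
proof -
  have "{u, v} \<in> G" using assms by (auto simp: nonadj_def doubleton_in_edges_on)
  moreover have "vertex_degree G u = Suc i" "vertex_degree G v = Suc j"
    using assms vertex_degree_compl[OF assms(1,4)] vertex_degree_compl[OF assms(1,5)]
      vertex_degree_le[OF assms(1,4)] vertex_degree_le[OF assms(1,5)]
    by (auto simp: nonadj_def)
  ultimately show ?thesis by simp
qed

definition reachable :: "nat \<Rightarrow> graph set \<Rightarrow> graph \<Rightarrow> bool" where
  "reachable n A G \<longleftrightarrow> (\<exists>H\<in>A. H \<in> graphs_on n \<and> card (sym_diff G H) \<le> 1)"

text \<open>\<open>c - m + a\<close> and \<open>c + b\<close> are degrees at which an added edge raises the potential by \<open>a + b * m\<close>.\<close>

definition step :: "nat \<Rightarrow> nat \<Rightarrow> nat \<Rightarrow> nat" where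
  "step c m k = (if c - m \<le> k \<and> k < c then k - (c - m) else if c \<le> k \<and> k < c + m then (k - c) * m else 0)"

text \<open>Let \<open>t\<close> be the distance upwards from the present residue to
  \<open>r\<close>. If it is below \<open>m^2\<close>, an added edge raises the potential by
  \<open>t\<close>; otherwise \<open>s = M - t\<close> is below \<open>m^2\<close> and a removed
  edge lowers it by \<open>s\<close>. The amount is written in base \<open>m\<close>, its low digit
  realised by a lower degree and its high digit by an upper one.\<close>

lemma reachable_residue:
  assumes G: "G \<in> graphs_on n" and m: "1 \<le> m" "m \<le> c" and r: "r < 2 * m\<^sup>2 - 1"
    and good: "\<And>a b. a < m \<Longrightarrow> b < m \<Longrightarrow> int r = (int (potential n (step c m) G) + int (a + b * m)) mod int (2 * m\<^sup>2 - 1) \<Longrightarrow>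
      \<exists>u\<in>{1..n}. \<exists>v\<in>{1..n}. u \<noteq> v \<and> nonadj (c - m + a) (c + b) (u, v) G"
    and good': "\<And>a b. a < m \<Longrightarrow> b < m \<Longrightarrow> int r = (int (potential n (step c m) G) - int (a + b * m)) mod int (2 * m\<^sup>2 - 1) \<Longrightarrow>
      \<exists>u\<in>{1..n}. \<exists>v\<in>{1..n}. u \<noteq> v \<and> {u, v} \<in> G \<and> vertex_degree G u = Suc (c - m + a) \<and> vertex_degree G v = Suc (c + b)"
  shows "reachable n {G \<in> graphs_on n. potential n (step c m) G mod (2 * m\<^sup>2 - 1) = r} G"
proof -
  let ?h = "step c m"
  define M where "M = 2 * m\<^sup>2 - 1"
  define F where "F = potential n ?h G"
  have m2: "1 \<le> m\<^sup>2" using m by simp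
  have M0: "0 < M" "m\<^sup>2 \<le> M" "M < 2 * m\<^sup>2" using m2 by (auto simp: M_def)
  have st: "?h (c - m + a) = a" "?h (c + b) = b * m" if "a < m" "b < m" for a b
    using that m by (auto simp: step_def)
  have ab: "\<exists>a b. a < m \<and> b < m \<and> s = a + b * m" if "s < m\<^sup>2" for s
  proof (intro exI conjI)
    show "s mod m < m" using m by simp
    show "s div m < m" using that m by (simp add: power2_eq_square less_mult_imp_div_less)
    show "s = s mod m + (s div m) * m" by simp
  qed
  have in_graphs: "{u, v} \<in> edges_on n" if "u \<in> {1..n}" "v \<in> {1..n}" "u \<noteq> v" for u v
    using that by (simp add: doubleton_in_edges_on)
  define t where "t = nat ((int r - int F) mod int M)"
  have t: "int t = (int r - int F) mod int M" using M0 by (simp add: t_def)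
  have tM: "t < M"
  proof -
    have "int t < int M" unfolding t using M0 by simp
    then show ?thesis by simp
  qed
  have rM: "int r = int r mod int M" using r[folded M_def] by simp
  show ?thesis
  proof (cases "t < m\<^sup>2")
    case True
    then obtain a b where s: "a < m" "b < m" "t = a + b * m" using ab by blast
    have "(int F + int t) mod int M = int r"
      unfolding t using rM by (simp add: mod_add_right_eq)
    then have r': "int r = (int F + int (a + b * m)) mod int M" using s by simp
    then obtain u v where uv: "u \<in> {1..n}" "v \<in> {1..n}" "u \<noteq> v" "nonadj (c - m + a) (c + b) (u, v) G"
      using good[OF s(1,2)] unfolding F_def M_def by blast
    let ?H = "insert {u, v} G"
    have nG: "{u, v} \<notin> G" using uv by (simp add: nonadj_def)
    have "potential n ?h ?H = F + (a + b * m)"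
      using potential_insert[OF G uv(1-3) nG, of ?h] uv(4) st[OF s(1,2)] by (simp add: nonadj_def F_def)
    then have "int (potential n ?h ?H mod M) = int r" using r' by (simp add: zmod_int)
    then have "potential n ?h ?H mod M = r" by simp
    moreover have "?H \<in> graphs_on n" using G in_graphs[OF uv(1-3)] by (auto simp: graphs_on_eq)
    moreover have "sym_diff G ?H = {{u, v}}" using nG by auto
    ultimately show ?thesis unfolding reachable_def M_def by (intro bexI[of _ ?H]) auto
  next
    case False
    define s where "s = M - t"
    have sl: "s < m\<^sup>2" using False M0 by (simp add: s_def)
    then obtain a b where s: "a < m" "b < m" "s = a + b * m" using ab by blast
    have "(int F - int s) mod int M = (int F + int t - int M) mod int M" 
    proof -
      have "int F - int s = int F + int t - int M" using tM by (simp add: s_def of_nat_diff)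
      then show ?thesis by (rule arg_cong)
    qed
    also have "\<dots> = (int F + int t) mod int M" by simp
    also have "\<dots> = int r" unfolding t using rM by (simp add: mod_add_right_eq)
    finally have r': "int r = (int F - int (a + b * m)) mod int M" using s by simp
    then obtain u v where uv: "u \<in> {1..n}" "v \<in> {1..n}" "u \<noteq> v" "{u, v} \<in> G"
       "vertex_degree G u = Suc (c - m + a)" "vertex_degree G v = Suc (c + b)"
      using good'[OF s(1,2)] unfolding F_def M_def by blast
    let ?H = "G - {{u, v}}"
    have HG: "?H \<in> graphs_on n" using G by (auto simp: graphs_on_eq)
    have d: "vertex_degree ?H u = c - m + a" "vertex_degree ?H v = c + b"
      using vertex_degree_remove[OF graphs_on_finite[OF G] uv(4)] uv by auto
    have "F = potential n ?h ?H + (a + b * m)"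
      using potential_insert[OF HG uv(1-3), of ?h] uv(4) st[OF s(1,2)] d by (simp add: F_def insert_absorb)
    then have "int (potential n ?h ?H mod M) = int r" using r' by (simp add: zmod_int)
    then have "potential n ?h ?H mod M = r" by simp
    moreover have "sym_diff G ?H = {{u, v}}" using uv(4) by auto
    ultimately show ?thesis using HG unfolding reachable_def M_def by (intro bexI[of _ ?H]) auto
  qed
qed

text \<open>For fixed \<open>G\<close>, each unavailable pair of degrees blocks one residue, so only the average over all residues
  of the failure probability is needed, and no union bound over the pairs.\<close>

lemma exists_residue:
  assumes m: "1 \<le> m" "m \<le> c" and \<eta>: "0 < \<eta>" and \<epsilon>: "0 < \<epsilon>" "2 * \<eta> < \<epsilon>"
    and good: "\<And>a b. a < m \<Longrightarrow> b < m \<Longrightarrow>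
      pr n (\<lambda>G. \<not> (\<exists>u\<in>{1..n}. \<exists>v\<in>{1..n}. u \<noteq> v \<and> nonadj (c - m + a) (c + b) (u, v) G)) \<le> \<eta>"
    and good': "\<And>a b. a < m \<Longrightarrow> b < m \<Longrightarrow>
      pr n (\<lambda>G. \<not> (\<exists>u\<in>{1..n}. \<exists>v\<in>{1..n}. u \<noteq> v \<and> {u, v} \<in> G \<and>
        vertex_degree G u = Suc (c - m + a) \<and> vertex_degree G v = Suc (c + b))) \<le> \<eta>"
  shows "\<exists>A. degree_closed n A \<and> pr n (\<lambda>G. \<not> reachable n A G) \<le> \<epsilon> \<and>
     pr n (\<lambda>G. G \<in> A) * ((2 * (real m)\<^sup>2 - 1) * (1 - 2 * \<eta> / \<epsilon>)) \<le> 1"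
proof -
  define M where "M = 2 * m\<^sup>2 - 1"
  define F where "F = potential n (step c m)"
  define A where "A = (\<lambda>r. {G \<in> graphs_on n. F G mod M = r})"
  define P where "P = (\<lambda>ab G. \<not> (\<exists>u\<in>{1..n}. \<exists>v\<in>{1..n}. u \<noteq> v \<and> nonadj (c - m + fst ab) (c + snd ab) (u, v) G))"
  define Q where "Q = (\<lambda>ab G. \<not> (\<exists>u\<in>{1..n}. \<exists>v\<in>{1..n}. u \<noteq> v \<and> {u, v} \<in> G \<and>
        vertex_degree G u = Suc (c - m + fst ab) \<and> vertex_degree G v = Suc (c + snd ab)))"
  let ?I = "{..<m} \<times> {..<m}"
  have m2: "1 \<le> m\<^sup>2" using m by simp
  have M0: "0 < M" "m\<^sup>2 \<le> M" using m2 by (auto simp: M_def)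
  have Mr: "real M = 2 * (real m)\<^sup>2 - 1" using m2 by (simp add: M_def of_nat_diff)
  have dc: "degree_closed n (A r)" for r
    unfolding degree_closed_def
  proof (intro conjI ballI impI)
    fix G H assume "G \<in> graphs_on n" "H \<in> graphs_on n" "\<forall>i. degcount n G i = degcount n H i" "G \<in> A r"
    then show "H \<in> A r" using potential_cong[of n G H "step c m"] by (simp add: A_def F_def)
  qed (auto simp: A_def)
  have fail: "real (card {r \<in> {..<M}. \<not> reachable n (A r) G}) \<le> (\<Sum>ab\<in>?I. of_bool (P ab G)) + (\<Sum>ab\<in>?I. of_bool (Q ab G))"
    if G: "G \<in> graphs_on n" for G
  proof -
    let ?p = "\<lambda>ab. nat ((int (F G) + int (fst ab + snd ab * m)) mod int M)"
    let ?q = "\<lambda>ab. nat ((int (F G) - int (fst ab + snd ab * m)) mod int M)"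
    have "{r \<in> {..<M}. \<not> reachable n (A r) G} \<subseteq> ?p ` {ab \<in> ?I. P ab G} \<union> ?q ` {ab \<in> ?I. Q ab G}"
    proof (rule subsetI, rule ccontr)
      fix r assume r: "r \<in> {r \<in> {..<M}. \<not> reachable n (A r) G}"
        and no: "r \<notin> ?p ` {ab \<in> ?I. P ab G} \<union> ?q ` {ab \<in> ?I. Q ab G}"
      have "reachable n (A r) G"
        unfolding A_def F_def M_def
      proof (rule reachable_residue[OF G m])
        show "r < 2 * m\<^sup>2 - 1" using r by (simp add: M_def)
      next
        fix a b assume ab: "a < m" "b < m"
          and "int r = (int (potential n (step c m) G) + int (a + b * m)) mod int (2 * m\<^sup>2 - 1)"
        then have "r = ?p (a, b)" unfolding F_def M_def by simp
        then have "\<not> P (a, b) G" using no ab by blast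
        then show "\<exists>u\<in>{1..n}. \<exists>v\<in>{1..n}. u \<noteq> v \<and> nonadj (c - m + a) (c + b) (u, v) G" by (simp add: P_def)
      next
        fix a b assume ab: "a < m" "b < m"
          and "int r = (int (potential n (step c m) G) - int (a + b * m)) mod int (2 * m\<^sup>2 - 1)"
        then have "r = ?q (a, b)" unfolding F_def M_def by simp
        then have "\<not> Q (a, b) G" using no ab by blast
        then show "\<exists>u\<in>{1..n}. \<exists>v\<in>{1..n}. u \<noteq> v \<and> {u, v} \<in> G \<and>
          vertex_degree G u = Suc (c - m + a) \<and> vertex_degree G v = Suc (c + b)"
          unfolding Q_def not_not fst_conv snd_conv .
      qed
      then show False using r by simp
    qed
    then have "card {r \<in> {..<M}. \<not> reachable n (A r) G} \<le> card (?p ` {ab \<in> ?I. P ab G} \<union> ?q ` {ab \<in> ?I. Q ab G})"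
      by (rule card_mono[rotated]) auto
    also have "\<dots> \<le> card (?p ` {ab \<in> ?I. P ab G}) + card (?q ` {ab \<in> ?I. Q ab G})" by (rule card_Un_le)
    also have "\<dots> \<le> card {ab \<in> ?I. P ab G} + card {ab \<in> ?I. Q ab G}" by (intro add_mono card_image_le) auto
    finally have "real (card {r \<in> {..<M}. \<not> reachable n (A r) G}) \<le> real (card {ab \<in> ?I. P ab G}) + real (card {ab \<in> ?I. Q ab G})"
      by linarith
    moreover have "(\<Sum>ab\<in>?I. of_bool (R ab) :: real) = real (card {ab \<in> ?I. R ab})" for R
      by (simp add: of_bool_def sum.If_cases Int_def)
    ultimately show ?thesis by simp
  qed
  have "(\<Sum>r<M. pr n (\<lambda>G. \<not> reachable n (A r) G)) = avg n (\<lambda>G. real (card {r \<in> {..<M}. \<not> reachable n (A r) G}))"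
    unfolding pr_def avg_sum[symmetric] by (rule avg_cong) (simp add: of_bool_def sum.If_cases Int_def)
  also have "\<dots> \<le> avg n (\<lambda>G. (\<Sum>ab\<in>?I. of_bool (P ab G)) + (\<Sum>ab\<in>?I. of_bool (Q ab G)))"
    by (rule avg_mono) (rule fail)
  also have "\<dots> = (\<Sum>ab\<in>?I. pr n (P ab)) + (\<Sum>ab\<in>?I. pr n (Q ab))"
    unfolding avg_add avg_sum pr_def ..
  also have "\<dots> \<le> (\<Sum>ab\<in>?I. \<eta>) + (\<Sum>ab\<in>?I. \<eta>)"
    by (intro add_mono sum_mono) (use good good' in \<open>auto simp: P_def Q_def\<close>)
  also have "\<dots> = 2 * \<eta> * real (m\<^sup>2)" by (simp add: power2_eq_square)
  also have "\<dots> \<le> 2 * \<eta> * real M" using M0 \<eta> by (intro mult_left_mono) auto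
  finally have tot: "(\<Sum>r<M. pr n (\<lambda>G. \<not> reachable n (A r) G)) \<le> 2 * \<eta> * real M" .
  \<comment> \<open>By Markov's inequality at most the fraction
    \<open>2 * \<eta> / \<epsilon>\<close> of the residues is bad, and among the others some class
    has at most the average probability \<open>1 / card Good\<close>.\<close>
  define Bad where "Bad = {r \<in> {..<M}. \<epsilon> < pr n (\<lambda>G. \<not> reachable n (A r) G)}"
  define Good where "Good = {..<M} - Bad"
  have finBad: "finite Bad" "Bad \<subseteq> {..<M}" by (auto simp: Bad_def)
  have "\<epsilon> * real (card Bad) = (\<Sum>r\<in>Bad. \<epsilon>)" by simp
  also have "\<dots> \<le> (\<Sum>r\<in>Bad. pr n (\<lambda>G. \<not> reachable n (A r) G))" by (rule sum_mono) (auto simp: Bad_def)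
  also have "\<dots> \<le> (\<Sum>r<M. pr n (\<lambda>G. \<not> reachable n (A r) G))" by (rule sum_mono2) (use finBad in auto)
  finally have "\<epsilon> * real (card Bad) \<le> 2 * \<eta> * real M" using tot by linarith
  then have "real (card Bad) \<le> 2 * \<eta> / \<epsilon> * real M" using \<epsilon> by (simp add: field_simps)
  moreover have "real (card Good) = real M - real (card Bad)"
    unfolding Good_def using finBad card_mono[of "{..<M}" Bad] by (simp add: card_Diff_subset of_nat_diff)
  ultimately have cG: "real M * (1 - 2 * \<eta> / \<epsilon>) \<le> real (card Good)" by (simp add: algebra_simps)
  have "0 < real M * (1 - 2 * \<eta> / \<epsilon>)" using M0 \<epsilon> by simp
  then have Gne: "Good \<noteq> {}" using cG by auto
  have "(\<Sum>r<M. pr n (\<lambda>G. G \<in> A r)) = avg n (\<lambda>G. \<Sum>r<M. of_bool (G \<in> A r))"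
    unfolding pr_def avg_sum ..
  also have "\<dots> = avg n (\<lambda>_. 1)"
  proof (rule avg_cong)
    fix G assume "G \<in> graphs_on n"
    then have "(\<Sum>r<M. of_bool (G \<in> A r)) = (\<Sum>r<M. if r = F G mod M then 1 else (0::real))"
      by (intro sum.cong) (auto simp: A_def)
    then show "(\<Sum>r<M. of_bool (G \<in> A r)) = (1::real)" using M0 by simp
  qed
  finally have one: "(\<Sum>r<M. pr n (\<lambda>G. G \<in> A r)) = 1" by simp
  have "\<exists>r\<in>Good. pr n (\<lambda>G. G \<in> A r) * real (card Good) \<le> 1"
  proof (rule ccontr)
    assume "\<not> ?thesis"
    then have *: "1 / real (card Good) < pr n (\<lambda>G. G \<in> A r)" if "r \<in> Good" for r
      using that Gne by (auto simp: Good_def field_simps card_gt_0_iff not_le)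
    have "1 = (\<Sum>r\<in>Good. 1 / real (card Good))" using Gne by (simp add: Good_def)
    also have "\<dots> < (\<Sum>r\<in>Good. pr n (\<lambda>G. G \<in> A r))" by (rule sum_strict_mono) (use * Gne in \<open>auto simp: Good_def\<close>)
    also have "\<dots> \<le> (\<Sum>r<M. pr n (\<lambda>G. G \<in> A r))" by (rule sum_mono2) (auto simp: Good_def)
    finally show False using one by simp
  qed
  then obtain r where r: "r \<in> Good" "pr n (\<lambda>G. G \<in> A r) * real (card Good) \<le> 1" by blast
  have "pr n (\<lambda>G. G \<in> A r) * (real M * (1 - 2 * \<eta> / \<epsilon>)) \<le> pr n (\<lambda>G. G \<in> A r) * real (card Good)"
    by (rule mult_left_mono[OF cG]) simp
  then have "pr n (\<lambda>G. G \<in> A r) * ((2 * (real m)\<^sup>2 - 1) * (1 - 2 * \<eta> / \<epsilon>)) \<le> 1" using r(2) unfolding Mr by linarith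
  moreover have "pr n (\<lambda>G. \<not> reachable n (A r) G) \<le> \<epsilon>" using r(1) by (auto simp: Good_def Bad_def)
  ultimately show ?thesis using dc by blast
qed

text \<open>With \<open>m\<close> about \<open>(1 - \<delta>) * dd n / 2\<close> the modulus is
  about \<open>(1 - \<delta>)^2 * n * ln n / 2\<close>, and discarding the bad residues costs
  another factor \<open>1 - \<delta>\<close>.\<close>

lemma construction:
  assumes \<epsilon>: "0 < \<epsilon>"
  shows "\<forall>\<^sub>F n in sequentially. \<exists>A. degree_closed n A \<and> pr n (\<lambda>G. \<not> reachable n A G) \<le> \<epsilon> \<and>
     pr n (\<lambda>G. G \<in> A) \<le> (2 + \<epsilon>) / (real n * ln n)"
proof -
  have "((\<lambda>\<delta>::real. 2 / ((1 - \<delta>)\<^sup>2 * (1 - \<delta>))) \<longlongrightarrow> 2) (at_right 0)" by real_asymp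
  then have "\<forall>\<^sub>F \<delta> in at_right 0. 2 / ((1 - \<delta>)\<^sup>2 * (1 - \<delta>)) < 2 + \<epsilon>" by (rule order_tendstoD) (use \<epsilon> in auto)
  moreover have "\<forall>\<^sub>F \<delta> in at_right (0::real). \<delta> < 1 / 2" by real_asymp
  ultimately have "\<forall>\<^sub>F \<delta> in at_right (0::real). 0 < \<delta> \<and> \<delta> < 1 / 2 \<and> 2 / ((1 - \<delta>)\<^sup>2 * (1 - \<delta>)) < 2 + \<epsilon>"
    using eventually_at_right_less[of 0] by eventually_elim auto
  then obtain \<delta> where \<delta>: "0 < \<delta>" "\<delta> < 1 / 2" "2 / ((1 - \<delta>)\<^sup>2 * (1 - \<delta>)) < 2 + \<epsilon>"
    using eventually_happens[of _ "at_right (0::real)"] by (auto simp: trivial_limit_at_right_real)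
  \<comment> \<open>Makes the fraction \<open>2 * \<eta> / \<epsilon>\<close> of bad residues equal
    to \<open>\<delta>\<close>.\<close>
  define \<eta> where "\<eta> = \<delta> * \<epsilon> / 2"
  have \<eta>: "0 < \<eta>" "2 * \<eta> < \<epsilon>" "2 * \<eta> / \<epsilon> = \<delta>" using \<delta> \<epsilon> by (auto simp: \<eta>_def)
  define m where "m = (\<lambda>n. nat \<lfloor>(1 - \<delta>) * dd n / 2\<rfloor>)"
  have e1: "\<forall>\<^sub>F n in sequentially. 2 \<le> (1 - \<delta>) * dd n / 2"
    using \<delta> unfolding dd_def by real_asymp
  have e2: "\<forall>\<^sub>F n::nat in sequentially. (1 - \<delta>) * dd n / 2 + 4 < real n / 2"
    unfolding dd_def by real_asymp
  have e3: "\<forall>\<^sub>F n in sequentially. 4 \<le> \<delta> / 4 * dd n" using \<delta>(1) unfolding dd_def by real_asymp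
  have lim: "(\<lambda>n::nat. (2 * (x * dd n / 2 - 1)\<^sup>2 - 1) * x / (real n * ln n)) \<longlonglongrightarrow> x\<^sup>2 * x / 2" if "0 < x" for x :: real
    unfolding dd_def using that by (real_asymp simp: field_simps power2_eq_square)
  have "1 / (2 + \<epsilon>) < (1 - \<delta>)\<^sup>2 * (1 - \<delta>) / 2" using \<delta> \<epsilon> by (simp add: field_simps)
  from order_tendstoD(1)[OF lim this] \<delta>
  have e4: "\<forall>\<^sub>F n::nat in sequentially. 1 / (2 + \<epsilon>) < (2 * ((1 - \<delta>) * dd n / 2 - 1)\<^sup>2 - 1) * (1 - \<delta>) / (real n * ln n)"
    by simp
  \<comment> \<open>Pairs are sought in the wider window with \<open>\<delta> / 2\<close>, which
    absorbs rounding and the shift caused by complementation.\<close>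
  have d2: "0 < \<delta> / 2" "\<delta> / 2 < 1" using \<delta> by auto
  show ?thesis
    using e1 e2 e3 e4 nonadj_exists_whp[OF d2 \<eta>(1)] eventually_ge_at_top[of 4]
  proof eventually_elim
    case (elim n)
    define c where "c = n div 2"
    define x where "x = (1 - \<delta>) * dd n / 2"
    have nl: "0 < real n * ln n" using elim(6) by simp
    have mx: "real (m n) \<le> x" "x - 1 < real (m n)" 
    proof -
      have "real (m n) = of_int \<lfloor>x\<rfloor>" using elim(1) by (simp add: m_def x_def)
      then show "real (m n) \<le> x" "x - 1 < real (m n)" by linarith+
    qed
    have m1: "1 \<le> m n"
    proof -
      have "1 < real (m n)" using mx(2) elim(1)[folded x_def] by linarith
      then show ?thesis by simp
    qed
    have cr: "real n / 2 - 1 / 2 \<le> real c" "real c \<le> real n / 2" unfolding c_def by linarith+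
    have mc: "m n \<le> c" using mx cr elim(2) unfolding x_def[symmetric] by linarith
    have win: "\<bar>real k - real n / 2\<bar> \<le> (1 - \<delta> / 2) * dd n / 2 + 2" if "\<bar>real k - real n / 2\<bar> \<le> x + 4" for k
    proof -
      have "x + \<delta> / 4 * dd n = (1 - \<delta> / 2) * dd n / 2" by (simp add: x_def field_simps)
      then show ?thesis using that elim(3) by linarith
    qed
    have ra: "real (c - m n + a) = real c - real (m n) + real a" for a using mc by (simp add: of_nat_diff)
    have "\<exists>A. degree_closed n A \<and> pr n (\<lambda>G. \<not> reachable n A G) \<le> \<epsilon> \<and>
       pr n (\<lambda>G. G \<in> A) * ((2 * (real (m n))\<^sup>2 - 1) * (1 - 2 * \<eta> / \<epsilon>)) \<le> 1"
    proof (rule exists_residue[OF m1 mc \<eta>(1) \<epsilon> \<eta>(2)])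
      fix a b assume ab: "a < m n" "b < m n"
      let ?i = "c - m n + a" and ?j = "c + b"
      have abr: "real a < real (m n)" "real b < real (m n)" using ab by simp_all
      have ij: "?i < c" "?i \<noteq> ?j" using ab mc by auto
      have wi: "\<bar>real ?i - real n / 2\<bar> \<le> x + 1" "\<bar>real ?j - real n / 2\<bar> \<le> x + 1"
        using abr mx cr unfolding ra of_nat_add by (auto simp: abs_le_iff)
      have wi4: "\<bar>real ?i - real n / 2\<bar> \<le> x + 4" "\<bar>real ?j - real n / 2\<bar> \<le> x + 4" using wi by linarith+
      show "pr n (\<lambda>G. \<not> (\<exists>u\<in>{1..n}. \<exists>v\<in>{1..n}. u \<noteq> v \<and> nonadj ?i ?j (u, v) G)) \<le> \<eta>"
        using elim(5)[rule_format, OF ij(2) win[OF wi4(1)] win[OF wi4(2)]] .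
      have le: "?i + 2 \<le> n" "?j + 2 \<le> n"
      proof -
        have "real ?j + 2 \<le> real n" using wi(2) elim(2) unfolding x_def[symmetric] by linarith
        then show "?j + 2 \<le> n" by linarith
        then show "?i + 2 \<le> n" using ij by linarith
      qed
      let ?i' = "n - 2 - ?i" and ?j' = "n - 2 - ?j"
      have r': "real ?i' = real n - 2 - real ?i" "real ?j' = real n - 2 - real ?j" using le by (simp_all add: of_nat_diff)
      have wi': "\<bar>real ?i' - real n / 2\<bar> \<le> x + 4" "\<bar>real ?j' - real n / 2\<bar> \<le> x + 4"
        using wi unfolding r' by linarith+
      have ij': "?i' \<noteq> ?j'" using ij le by linarith
      have "pr n (\<lambda>G. \<not> (\<exists>u\<in>{1..n}. \<exists>v\<in>{1..n}. u \<noteq> v \<and> {u, v} \<in> G \<and> vertex_degree G u = Suc ?i \<and> vertex_degree G v = Suc ?j)) \<le>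
        pr n (\<lambda>G. \<not> (\<exists>u\<in>{1..n}. \<exists>v\<in>{1..n}. u \<noteq> v \<and> nonadj ?i' ?j' (u, v) (edges_on n - G)))"
      proof (rule pr_mono)
        fix G assume G: "G \<in> graphs_on n"
          and "\<not> (\<exists>u\<in>{1..n}. \<exists>v\<in>{1..n}. u \<noteq> v \<and> {u, v} \<in> G \<and> vertex_degree G u = Suc ?i \<and> vertex_degree G v = Suc ?j)"
        then show "\<not> (\<exists>u\<in>{1..n}. \<exists>v\<in>{1..n}. u \<noteq> v \<and> nonadj ?i' ?j' (u, v) (edges_on n - G))"
          using nonadj_swap_compl[OF G le] by blast
      qed
      also have "\<dots> = pr n (\<lambda>G. \<not> (\<exists>u\<in>{1..n}. \<exists>v\<in>{1..n}. u \<noteq> v \<and> nonadj ?i' ?j' (u, v) G))"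
        by (rule pr_compl[of n "\<lambda>G. \<not> (\<exists>u\<in>{1..n}. \<exists>v\<in>{1..n}. u \<noteq> v \<and> nonadj ?i' ?j' (u, v) G)"])
      also have "\<dots> \<le> \<eta>" using elim(5)[rule_format, OF ij' win[OF wi'(1)] win[OF wi'(2)]] .
      finally show "pr n (\<lambda>G. \<not> (\<exists>u\<in>{1..n}. \<exists>v\<in>{1..n}. u \<noteq> v \<and> {u, v} \<in> G \<and> vertex_degree G u = Suc ?i \<and> vertex_degree G v = Suc ?j)) \<le> \<eta>" .
    qed
    then obtain A where A: "degree_closed n A" "pr n (\<lambda>G. \<not> reachable n A G) \<le> \<epsilon>"
       "pr n (\<lambda>G. G \<in> A) * ((2 * (real (m n))\<^sup>2 - 1) * (1 - \<delta>)) \<le> 1" unfolding \<eta>(3) by blast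
    have "1 / (2 + \<epsilon>) * (real n * ln n) < (2 * (x - 1)\<^sup>2 - 1) * (1 - \<delta>)"
      using elim(4) nl unfolding x_def[symmetric] by (subst (asm) pos_less_divide_eq)
    also have "\<dots> \<le> (2 * (real (m n))\<^sup>2 - 1) * (1 - \<delta>)"
      using mx elim(1) \<delta> unfolding x_def[symmetric] by (intro mult_right_mono diff_right_mono mult_left_mono power_mono) auto
    finally have big: "1 / (2 + \<epsilon>) * (real n * ln n) \<le> (2 * (real (m n))\<^sup>2 - 1) * (1 - \<delta>)" by simp
    have "pr n (\<lambda>G. G \<in> A) * (1 / (2 + \<epsilon>) * (real n * ln n)) \<le> 1"
      using mult_left_mono[OF big, of "pr n (\<lambda>G. G \<in> A)"] A(3) by simp
    then have "pr n (\<lambda>G. G \<in> A) \<le> (2 + \<epsilon>) / (real n * ln n)" using nl \<epsilon> by (simp add: field_simps)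
    then show ?case using A by blast
  qed
qed

subsection \<open>Adjusting the probability\<close>

lemma pr_card_eq: "pr n (\<lambda>G. card G = k) = bp (n choose 2) k"
proof -
  have "{G \<in> graphs_on n. card G = k} = {G. G \<subseteq> edges_on n \<and> card G = k}" by (auto simp: graphs_on_eq)
  then show ?thesis by (simp add: pr_eq_card bp_def n_subsets card_edges_on)
qed

lemma handshake:
  assumes "G \<in> graphs_on n"
  shows "(\<Sum>v\<in>{1..n}. vertex_degree G v) = 2 * card G"
proof -
  have fin: "finite G" by (rule graphs_on_finite[OF assms])
  have "(\<Sum>v\<in>{1..n}. vertex_degree G v) = (\<Sum>v\<in>{1..n}. \<Sum>e\<in>G. of_bool (v \<in> e))"
    using fin by (simp add: vertex_degree_def of_bool_def sum.If_cases Int_def)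
  also have "\<dots> = (\<Sum>e\<in>G. \<Sum>v\<in>{1..n}. of_bool (v \<in> e))" by (rule sum.swap)
  also have "\<dots> = (\<Sum>e\<in>G. 2)"
  proof (rule sum.cong[OF refl])
    fix e assume "e \<in> G"
    then have e: "e \<subseteq> {1..n}" "card e = 2" using assms by (auto simp: graphs_on_def)
    have "(\<Sum>v\<in>{1..n}. of_bool (v \<in> e)) = card ({1..n} \<inter> e)" by (simp add: of_bool_def sum.If_cases)
    also have "{1..n} \<inter> e = e" using e by auto
    finally show "(\<Sum>v\<in>{1..n}. of_bool (v \<in> e)) = (2::nat)" using e by simp
  qed
  finally show ?thesis by simp
qed

text \<open>With constant increments 1 the potential is the degree sum, twice the number of edges;
  so graphs may be added according to their number of edges without leaving degree
  properties.\<close>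

lemma card_cong_degcount:
  assumes "G \<in> graphs_on n" "H \<in> graphs_on n" "\<forall>i. degcount n G i = degcount n H i"
  shows "card G = card H"
  using potential_cong[OF assms(3), of "\<lambda>_. 1"] handshake[OF assms(1)] handshake[OF assms(2)]
  by (simp add: potential_def)

text \<open>Each of the \<open>K\<close> terms before \<open>k\<close> is at least half of
  \<open>bp N k\<close>: consecutive quotients are at least \<open>1 - 1 / (2 * K)\<close>, whose
  \<open>K\<close>-th power is at least 1 / 2 by Bernoulli's inequality.\<close>

lemma bp_lower_tail_ge:
  assumes "0 < K" "K \<le> k" "k \<le> N"
    and ratio: "\<And>l. k - K \<le> l \<Longrightarrow> l < k \<Longrightarrow> (1 - 1 / (2 * real K)) * (real N - real l) \<le> real (Suc l)"
  shows "real K / 2 * bp N k \<le> (\<Sum>l<k. bp N l)"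
proof -
  define x where "x = 1 - 1 / (2 * real K)"
  have x: "0 \<le> x" "x \<le> 1" using assms(1) by (auto simp: x_def field_simps)
  have step: "x ^ s * bp N k \<le> bp N (k - s)" if "s \<le> K" for s
    using that
  proof (induction s)
    case (Suc s)
    let ?l = "k - Suc s"
    have l: "Suc ?l = k - s" "?l < k" "k - K \<le> ?l" "?l < N" using Suc.prems assms by auto
    have "x * bp N (k - s) * (real N - real ?l) = bp N (k - s) * (x * (real N - real ?l))" by simp
    also have "\<dots> \<le> bp N (k - s) * real (Suc ?l)"
      by (rule mult_left_mono) (use ratio[OF l(3,2)] in \<open>auto simp: x_def\<close>)
    also have "\<dots> = bp N ?l * (real N - real ?l)" using bp_Suc_mult[of N ?l] l(1) by simp
    finally have "x * bp N (k - s) \<le> bp N ?l" by (rule mult_right_le_imp_le) (use l(4) in simp)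
    moreover have "x * (x ^ s * bp N k) \<le> x * bp N (k - s)" using Suc x by (intro mult_left_mono) auto
    ultimately show ?case by simp
  qed simp
  have "1 / 2 \<le> x ^ K"
  proof -
    have "1 + real K * (- 1 / (2 * real K)) \<le> (1 + (- 1 / (2 * real K))) ^ K"
      by (rule Bernoulli_inequality) (use assms(1) in \<open>auto simp: field_simps\<close>)
    then show ?thesis using assms(1) by (simp add: x_def)
  qed
  then have half: "1 / 2 \<le> x ^ s" if "s \<le> K" for s using power_decreasing[OF that x] by linarith
  have "real K / 2 * bp N k = (\<Sum>s\<in>{1..K}. 1 / 2 * bp N k)" by simp
  also have "\<dots> \<le> (\<Sum>s\<in>{1..K}. bp N (k - s))"
  proof (rule sum_mono)
    fix s assume "s \<in> {1..K}"
    then have s: "s \<le> K" by simp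
    have "1 / 2 * bp N k \<le> x ^ s * bp N k" by (rule mult_right_mono[OF half[OF s]]) simp
    then show "1 / 2 * bp N k \<le> bp N (k - s)" using step[OF s] by linarith
  qed
  also have "\<dots> = (\<Sum>l\<in>(\<lambda>s. k - s) ` {1..K}. bp N l)"
    by (subst sum.reindex) (use assms in \<open>auto simp: inj_on_def\<close>)
  also have "\<dots> \<le> (\<Sum>l<k. bp N l)"
    by (rule sum_mono2) (use assms in auto)
  finally show ?thesis .
qed

text \<open>While graphs with fewer than \<open>k\<close> edges are rarer than the target, those
  with exactly \<open>k\<close> edges are much rarer still: far from the mean by Hoeffding's
  inequality, near it because \<open>bp_lower_tail_ge\<close> bounds them by \<open>2 / K\<close> of
  the lower tail.\<close>

lemma edge_count_step:
  assumes \<epsilon>: "0 < \<epsilon>"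
  shows "\<forall>\<^sub>F n in sequentially. \<forall>k. (\<Sum>l<k. bp (n choose 2) l) < 2 / (real n * ln n) \<longrightarrow>
    bp (n choose 2) k \<le> \<epsilon> * (2 / (real n * ln n))"
proof -
  define K where "K = nat \<lceil>2 / \<epsilon>\<rceil>"
  have K: "0 < K" "2 / \<epsilon> \<le> real K" using \<epsilon> by (auto simp: K_def real_nat_ceiling_ge)
  define x where "x = 1 - 1 / (2 * real K)"
  have x: "0 < x" "x < 1" using K by (auto simp: x_def field_simps)
  let ?N = "\<lambda>n::nat. real n * (real n - 1) / 2"
  \<comment> \<open>Large against the standard deviation of the number of edges, of order
    \<open>n\<close>, and small against its mean, of order \<open>n^2\<close>.\<close>
  define t where "t = (\<lambda>n::nat. real n * sqrt n)"
  have e1: "\<forall>\<^sub>F n::nat in sequentially. 2 * exp (- 2 * (t n)\<^sup>2 / ?N n) \<le> \<epsilon> * (2 / (real n * ln n))"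
    using \<epsilon> unfolding t_def by real_asymp
  have e2: "\<forall>\<^sub>F n::nat in sequentially. x * (?N n / 2 + t n + real K) \<le> ?N n / 2 - t n - real K"
  proof -
    have "(\<lambda>n::nat. (?N n / 2 - t n - real K) / (?N n / 2 + t n + real K)) \<longlonglongrightarrow> 1"
      unfolding t_def by real_asymp
    then have "\<forall>\<^sub>F n::nat in sequentially. x < (?N n / 2 - t n - real K) / (?N n / 2 + t n + real K)"
      by (rule order_tendstoD) (use x in auto)
    moreover have "\<forall>\<^sub>F n::nat in sequentially. 0 < ?N n / 2 + t n + real K" unfolding t_def by real_asymp
    ultimately show ?thesis by eventually_elim (simp add: pos_less_divide_eq less_imp_le)
  qed
  have e3: "\<forall>\<^sub>F n::nat in sequentially. real K < ?N n / 2 - t n" unfolding t_def by real_asymp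
  show ?thesis using e1 e2 e3 eventually_ge_at_top[of 2]
  proof eventually_elim
    case (elim n)
    define N where "N = n choose 2"
    define \<tau> where "\<tau> = 2 / (real n * ln n)"
    have Nr: "real N = ?N n"
    proof -
      have "real N * 2 = real n * (real n - 1)"
        using elim(4) unfolding N_def choose_two by (simp add: real_of_nat_div of_nat_diff)
      then show ?thesis by simp
    qed
    have t0: "0 \<le> t n" by (simp add: t_def)
    have N0: "0 < N" using elim(3) t0 Nr by (cases N) auto
    show ?case unfolding N_def[symmetric] \<tau>_def[symmetric]
    proof (intro allI impI)
      fix k assume small: "(\<Sum>l<k. bp N l) < \<tau>"
      show "bp N k \<le> \<epsilon> * \<tau>"
      proof (cases "t n \<le> \<bar>real k - real N / 2\<bar>")
        case True
        then show ?thesis using bp_le_exp[OF N0 t0 True] elim(1) by (simp add: Nr \<tau>_def)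
      next
        case False
        then have k: "real N / 2 - t n < real k" "real k < real N / 2 + t n" by auto
        have kN: "k \<le> N"
        proof -
          have "real k \<le> real N" using k(2) elim(3) Nr by linarith
          then show ?thesis by simp
        qed
        have Kk: "K \<le> k"
        proof -
          have "real K < real k" using k(1) elim(3) Nr by linarith
          then show ?thesis by simp
        qed
        have "real K / 2 * bp N k \<le> (\<Sum>l<k. bp N l)"
        proof (rule bp_lower_tail_ge[OF K(1) Kk kN])
          fix l assume l: "k - K \<le> l" "l < k"
          then have "real k - real K \<le> real l" by linarith
          then have "real N - real l \<le> ?N n / 2 + t n + real K" "?N n / 2 - t n - real K \<le> real (Suc l)"
            using k l Nr by auto
          then have "x * (real N - real l) \<le> real (Suc l)"
            using elim(2) mult_left_mono[of "real N - real l" "?N n / 2 + t n + real K" x] x by linarith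
          then show "(1 - 1 / (2 * real K)) * (real N - real l) \<le> real (Suc l)" by (simp add: x_def)
        qed
        then have *: "real K / 2 * bp N k \<le> \<tau>" using small by linarith
        have "1 / \<epsilon> * bp N k \<le> real K / 2 * bp N k" using K(2) by (intro mult_right_mono) auto
        then have "1 / \<epsilon> * bp N k \<le> \<tau>" using * by linarith
        then show ?thesis using \<epsilon> by (simp add: field_simps)
      qed
    qed
  qed
qed

text \<open>\<open>construction\<close> bounds the probability only from above. Adding all graphs
  with fewer than \<open>k\<close> edges, for the least sufficient \<open>k\<close>, lifts it to the
  target, and by \<open>edge_count_step\<close> the last step overshoots by at most
  \<open>\<epsilon> / 2 * \<tau>\<close>.\<close>

lemma fill_up:
  assumes \<epsilon>: "0 < \<epsilon>"
  shows "\<forall>\<^sub>F n in sequentially. \<forall>A. degree_closed n A \<longrightarrow> pr n (\<lambda>G. G \<in> A) \<le> (2 + \<epsilon>) / (real n * ln n) \<longrightarrow>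
    (\<exists>A'. A \<subseteq> A' \<and> degree_closed n A' \<and> 2 / (real n * ln n) \<le> pr n (\<lambda>G. G \<in> A') \<and>
      pr n (\<lambda>G. G \<in> A') \<le> (2 + \<epsilon>) / (real n * ln n))"
proof -
  have "\<forall>\<^sub>F n::nat in sequentially. 2 / (real n * ln n) < 1" by real_asymp
  moreover have "0 < \<epsilon> / 2" using \<epsilon> by simp
  note edge_count_step[OF this]
  ultimately show ?thesis
  proof eventually_elim
    case (elim n)
    define \<tau> where "\<tau> = 2 / (real n * ln n)"
    define N where "N = n choose 2"
    have eps: "(2 + \<epsilon>) / (real n * ln n) = \<tau> + \<epsilon> / 2 * \<tau>" by (simp add: \<tau>_def add_divide_distrib)
    show ?case unfolding eps \<tau>_def[symmetric]
    proof (intro allI impI)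
      fix A assume A: "degree_closed n A" and pA: "pr n (\<lambda>G. G \<in> A) \<le> \<tau> + \<epsilon> / 2 * \<tau>"
      define B where "B = (\<lambda>k. A \<union> {G \<in> graphs_on n. card G < k})"
      have dcB: "degree_closed n (B k)" for k
        unfolding degree_closed_def
      proof (intro conjI ballI impI)
        show "B k \<subseteq> graphs_on n" using A by (auto simp: B_def degree_closed_def)
        fix G H assume GH: "G \<in> graphs_on n" "H \<in> graphs_on n" "\<forall>i. degcount n G i = degcount n H i" "G \<in> B k"
        show "H \<in> B k"
        proof (cases "G \<in> A")
          case True
          then have "H \<in> A" using A GH unfolding degree_closed_def by blast
          then show ?thesis by (simp add: B_def)
        next
          case False
          then show ?thesis using GH card_cong_degcount[OF GH(1-3)] by (simp add: B_def)
        qed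
      qed
      show "\<exists>A'. A \<subseteq> A' \<and> degree_closed n A' \<and> \<tau> \<le> pr n (\<lambda>G. G \<in> A') \<and> pr n (\<lambda>G. G \<in> A') \<le> \<tau> + \<epsilon> / 2 * \<tau>"
      proof (cases "\<tau> \<le> pr n (\<lambda>G. G \<in> A)")
        case True
        then show ?thesis using A pA by blast
      next
        case False
        have ex: "\<tau> \<le> pr n (\<lambda>G. G \<in> B (Suc N))"
        proof -
          have "G \<in> B (Suc N)" if "G \<in> graphs_on n" for G
            using that card_mono[of "edges_on n" G] by (auto simp: B_def N_def graphs_on_eq card_edges_on)
          then have "pr n (\<lambda>G. G \<in> B (Suc N)) = pr n (\<lambda>_. True)" by (intro pr_cong) auto
          then show ?thesis using elim(1) by (simp add: \<tau>_def)
        qed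
        define k where "k = (LEAST k. \<tau> \<le> pr n (\<lambda>G. G \<in> B k))"
        have k: "\<tau> \<le> pr n (\<lambda>G. G \<in> B k)" unfolding k_def by (rule LeastI[of "\<lambda>k. \<tau> \<le> pr n (\<lambda>G. G \<in> B k)", OF ex])
        have "k \<noteq> 0"
        proof
          assume "k = 0"
          then have "B k = A" by (simp add: B_def)
          then show False using k False by simp
        qed
        then obtain j where j: "k = Suc j" by (cases k) auto
        have lt: "pr n (\<lambda>G. G \<in> B j) < \<tau>" using not_less_Least[of j "\<lambda>k. \<tau> \<le> pr n (\<lambda>G. G \<in> B k)"] j by (simp add: k_def)
        have "(\<Sum>l<j. bp N l) = pr n (\<lambda>G. card G < j)"
        proof -
          have "(\<Sum>l<j. bp N l) = avg n (\<lambda>G. \<Sum>l<j. of_bool (card G = l))"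
            unfolding avg_sum N_def pr_card_eq[symmetric] pr_def ..
          also have "\<dots> = pr n (\<lambda>G. card G < j)"
            unfolding pr_def by (rule avg_cong) (simp add: of_bool_def)
          finally show ?thesis .
        qed
        also have "\<dots> \<le> pr n (\<lambda>G. G \<in> B j)" by (rule pr_mono) (auto simp: B_def)
        finally have "bp N j \<le> \<epsilon> / 2 * \<tau>" using elim(2) lt by (simp add: N_def \<tau>_def)
        moreover have "pr n (\<lambda>G. G \<in> B k) \<le> pr n (\<lambda>G. G \<in> B j \<or> card G = j)"
          by (rule pr_mono) (auto simp: B_def j less_Suc_eq)
        moreover have "\<dots> \<le> pr n (\<lambda>G. G \<in> B j) + pr n (\<lambda>G. card G = j)" by (rule pr_disj_le)
        ultimately have "pr n (\<lambda>G. G \<in> B k) \<le> \<tau> + \<epsilon> / 2 * \<tau>" using lt by (simp add: pr_card_eq N_def)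
        then show ?thesis using k dcB by (intro exI[of _ "B k"]) (auto simp: B_def)
      qed
    qed
  qed
qed

text \<open>Turns a statement that holds eventually for each fixed \<open>\<epsilon>\<close> into
  one with a single error sequence tending to 0, as the o(1) of the claim demands.\<close>

lemma diagonal_eventually:
  fixes Q :: "nat \<Rightarrow> real \<Rightarrow> bool"
  assumes ev: "\<And>\<epsilon>. 0 < \<epsilon> \<Longrightarrow> \<forall>\<^sub>F n in sequentially. Q n \<epsilon>"
    and mono: "\<And>n x y. Q n x \<Longrightarrow> x \<le> y \<Longrightarrow> Q n y"
  shows "\<exists>e. e \<longlonglongrightarrow> 0 \<and> (\<forall>\<^sub>F n in sequentially. Q n (e n))"
proof -
  define S where "S = (\<lambda>n. {x. 0 < x \<and> Q n x})"
  \<comment> \<open>The infimum itself may fail \<open>Q\<close>, but by \<open>mono\<close>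
    everything above it satisfies \<open>Q\<close>; the added term tends to 0.\<close>
  define e where "e = (\<lambda>n. Inf (S n) + 1 / real (Suc n))"
  have bdd: "bdd_below (S n)" for n unfolding S_def by (rule bdd_belowI[of _ 0]) auto
  have Qe: "Q n (e n)" if ne: "S n \<noteq> {}" for n
  proof -
    have "Inf (S n) < e n" by (simp add: e_def)
    then obtain x where "x \<in> S n" "x < e n" using cInf_lessD[OF ne] by blast
    then show ?thesis using mono[of n x "e n"] by (auto simp: S_def)
  qed
  have "\<forall>\<^sub>F n in sequentially. Q n (e n)"
    using ev[of 1, simplified] by eventually_elim (rule Qe, auto simp: S_def intro: exI[of _ 1])
  moreover have "e \<longlonglongrightarrow> 0"
  proof (rule order_tendstoI)
    fix a :: real assume "0 < a"
    then have a2: "0 < a / 2" by simp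
    have "(\<lambda>n. 1 / real (Suc n)) \<longlonglongrightarrow> 0" by real_asymp
    then have "\<forall>\<^sub>F n in sequentially. 1 / real (Suc n) < a / 2" by (rule order_tendstoD) (use a2 in auto)
    then show "\<forall>\<^sub>F n in sequentially. e n < a" using ev[OF a2]
    proof eventually_elim
      case (elim n)
      have "Inf (S n) \<le> a / 2" by (rule cInf_lower) (use elim a2 bdd in \<open>auto simp: S_def\<close>)
      then show ?case using elim(1) by (simp add: e_def)
    qed
  next
    fix a :: real assume "a < 0"
    show "\<forall>\<^sub>F n in sequentially. a < e n"
      using ev[of 1, simplified]
    proof eventually_elim
      case (elim n)
      have "0 \<le> Inf (S n)" by (rule cInf_greatest) (use elim in \<open>auto simp: S_def intro: exI[of _ 1]\<close>)
      then show ?case using \<open>a < 0\<close> by (simp add: e_def add_nonneg_pos less_trans)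
    qed
  qed
  ultimately show ?thesis by blast
qed

lemma smallo_one_iff: "f \<in> o(\<lambda>_. 1 :: real) \<longleftrightarrow> f \<longlonglongrightarrow> (0 :: real)"
  by (auto intro: smalloI_tendsto dest: smalloD_tendsto)

theorem theorem2:
  shows "(\<exists>A. graph_property A \<and> degree_expressible A \<and> anti_stochastic A \<and>
            (\<exists>\<epsilon> :: nat \<Rightarrow> real. \<epsilon> \<in> o(\<lambda>_. 1) \<and>
               (\<forall>\<^sub>F n in sequentially.
                  measure_pmf.prob (random_graph n) {G. G \<in> A n}
                    = (2 + \<epsilon> n) / (real n * ln (real n))))) \<and>
         (\<forall>A. graph_property A \<and> degree_expressible A \<and> anti_stochastic A \<longrightarrow>
            (\<exists>\<epsilon> :: nat \<Rightarrow> real. \<epsilon> \<in> o(\<lambda>_. 1) \<and>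
               (\<forall>\<^sub>F n in sequentially.
                  measure_pmf.prob (random_graph n) {G. G \<in> A n}
                    \<ge> (1 - \<epsilon> n) / (real n * ln (real n)))))"
  proof (intro conjI allI impI)
  define Q where "Q = (\<lambda>n \<epsilon> A. degree_closed n A \<and> pr n (\<lambda>G. \<not> reachable n A G) \<le> \<epsilon> \<and>
    2 / (real n * ln n) \<le> pr n (\<lambda>G. G \<in> A) \<and> pr n (\<lambda>G. G \<in> A) \<le> (2 + \<epsilon>) / (real n * ln n))"
  have "\<exists>e. e \<longlonglongrightarrow> 0 \<and> (\<forall>\<^sub>F n in sequentially. \<exists>A. Q n (e n) A)"
  proof (rule diagonal_eventually)
    fix \<epsilon> :: real assume \<epsilon>: "0 < \<epsilon>"
    show "\<forall>\<^sub>F n in sequentially. \<exists>A. Q n \<epsilon> A"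
      using construction[OF \<epsilon>] fill_up[OF \<epsilon>]
    proof eventually_elim
      case (elim n)
      then obtain A A' where A: "pr n (\<lambda>G. \<not> reachable n A G) \<le> \<epsilon>" "A \<subseteq> A'" "degree_closed n A'"
        "2 / (real n * ln n) \<le> pr n (\<lambda>G. G \<in> A')" "pr n (\<lambda>G. G \<in> A') \<le> (2 + \<epsilon>) / (real n * ln n)" by blast
      have "pr n (\<lambda>G. \<not> reachable n A' G) \<le> pr n (\<lambda>G. \<not> reachable n A G)"
        by (rule pr_mono) (use A(2) in \<open>auto simp: reachable_def\<close>)
      then show ?case using A unfolding Q_def by (intro exI[of _ A']) auto
    qed
  next
    fix n and x y :: real assume "\<exists>A. Q n x A" and xy: "x \<le> y"
    then obtain A where "Q n x A" by blast
    moreover have "(2 + x) / (real n * ln n) \<le> (2 + y) / (real n * ln n)"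
      using xy by (cases "n = 0") (auto intro!: divide_right_mono)
    ultimately have "Q n y A" using xy unfolding Q_def by linarith
    then show "\<exists>A. Q n y A" ..
  qed
  then obtain e where e: "e \<longlonglongrightarrow> 0" "\<forall>\<^sub>F n in sequentially. \<exists>A. Q n (e n) A" by blast
  \<comment> \<open>The default \<open>{}\<close> is degree-closed, so \<open>dc\<close> below holds
    for every \<open>n\<close>, not just eventually.\<close>
  define A where "A = (\<lambda>n. if \<exists>A. Q n (e n) A then SOME A. Q n (e n) A else {})"
  have QA: "\<forall>\<^sub>F n in sequentially. Q n (e n) (A n)"
    using e(2) by eventually_elim (simp add: A_def someI_ex)
  have dc: "degree_closed n (A n)" for n
  proof (cases "\<exists>A. Q n (e n) A")
    case True
    then have "Q n (e n) (A n)" by (simp add: A_def someI_ex)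
    then show ?thesis by (simp add: Q_def)
  next
    case False
    then have "A n = {}" unfolding A_def by (rule if_not_P)
    then show ?thesis by (simp add: degree_closed_def)
  qed
  then have gp: "A n \<subseteq> graphs_on n" for n by (simp add: degree_closed_def)
  define p where "p = (\<lambda>n. pr n (\<lambda>G. G \<in> A n))"
  \<comment> \<open>The error is read off from the probability, and \<open>Q\<close> squeezes it
    between 0 and \<open>e n\<close>.\<close>
  define \<epsilon> where "\<epsilon> = (\<lambda>n. p n * (real n * ln n) - 2)"
  have p_eq: "\<forall>\<^sub>F n in sequentially. p n = (2 + \<epsilon> n) / (real n * ln n)"
    using eventually_ge_at_top[of 2] by eventually_elim (simp add: \<epsilon>_def)
  have \<epsilon>_lim: "\<epsilon> \<longlonglongrightarrow> 0"
  proof (rule tendsto_sandwich[OF _ _ tendsto_const e(1)])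
    show "\<forall>\<^sub>F n in sequentially. 0 \<le> \<epsilon> n" using QA eventually_ge_at_top[of 2]
      by eventually_elim (simp add: Q_def \<epsilon>_def p_def field_simps)
    show "\<forall>\<^sub>F n in sequentially. \<epsilon> n \<le> e n" using QA eventually_ge_at_top[of 2]
      by eventually_elim (simp add: Q_def \<epsilon>_def p_def field_simps)
  qed
  have "(\<lambda>n. (2 + \<epsilon> n) * (1 / (real n * ln n))) \<longlonglongrightarrow> (2 + 0) * 0"
    by (intro tendsto_mult tendsto_add tendsto_const \<epsilon>_lim) real_asymp
  then have "(\<lambda>n. (2 + \<epsilon> n) / (real n * ln n)) \<longlonglongrightarrow> 0" by simp
  then have p_lim: "p \<longlonglongrightarrow> 0" by (rule Lim_transform_eventually) (use p_eq in \<open>simp add: eq_commute\<close>)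
  \<comment> \<open>Where \<open>A n\<close> is out of reach, \<open>G\<close> stays unchanged, so
    that \<open>f\<close> is an adversary on all graphs.\<close>
  define f where "f = (\<lambda>n G. if reachable n (A n) G
    then SOME H. H \<in> A n \<and> H \<in> graphs_on n \<and> card (sym_diff G H) \<le> 1 else G)"
  have f: "f n G \<in> A n \<and> f n G \<in> graphs_on n \<and> card (sym_diff G (f n G)) \<le> 1" if r: "reachable n (A n) G" for n G
  proof -
    have "\<exists>H. H \<in> A n \<and> H \<in> graphs_on n \<and> card (sym_diff G H) \<le> 1" using r by (auto simp: reachable_def)
    from someI_ex[OF this] show ?thesis using r by (simp add: f_def)
  qed
  have adv: "adversary f"
    unfolding adversary_def
  proof (intro allI ballI)
    fix n G assume "G \<in> graphs_on n"
    then show "f n G \<in> graphs_on n \<and> card (sym_diff G (f n G)) \<le> 1"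
      using f[of n G] by (cases "reachable n (A n) G") (auto simp: f_def)
  qed
  have f_lim: "(\<lambda>n. 1 - pr n (\<lambda>G. f n G \<in> A n)) \<longlonglongrightarrow> 0"
  proof (rule tendsto_sandwich[OF _ _ tendsto_const e(1)])
    show "\<forall>\<^sub>F n in sequentially. 0 \<le> 1 - pr n (\<lambda>G. f n G \<in> A n)" by (simp add: pr_le_1)
    show "\<forall>\<^sub>F n in sequentially. 1 - pr n (\<lambda>G. f n G \<in> A n) \<le> e n" using QA
    proof eventually_elim
      case (elim n)
      have "1 - pr n (\<lambda>G. f n G \<in> A n) \<le> pr n (\<lambda>G. \<not> reachable n (A n) G)"
        unfolding pr_not[symmetric] by (rule pr_mono) (use f in blast)
      then show ?case using elim by (simp add: Q_def)
    qed
  qed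
  have "anti_stochastic A"
    unfolding anti_stochastic_def smallo_one_iff prob_random_graph
    using p_lim adv f_lim unfolding p_def by (intro conjI exI[of _ f])
  moreover have "degree_expressible A" using degree_closed_iff[of A] gp dc by blast
  moreover have "graph_property A" using gp by (simp add: graph_property_def)
  ultimately have "graph_property A \<and> degree_expressible A \<and> anti_stochastic A \<and> \<epsilon> \<in> o(\<lambda>_. 1) \<and>
      (\<forall>\<^sub>F n in sequentially. measure_pmf.prob (random_graph n) {G. G \<in> A n} = (2 + \<epsilon> n) / (real n * ln (real n)))"
    using \<epsilon>_lim p_eq unfolding smallo_one_iff prob_random_graph p_def by simp
  then show "\<exists>A. graph_property A \<and> degree_expressible A \<and> anti_stochastic A \<and>
            (\<exists>\<epsilon> :: nat \<Rightarrow> real. \<epsilon> \<in> o(\<lambda>_. 1) \<and>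
               (\<forall>\<^sub>F n in sequentially.
                  measure_pmf.prob (random_graph n) {G. G \<in> A n}
                    = (2 + \<epsilon> n) / (real n * ln (real n))))"
    by (intro exI[of _ A] exI[of _ \<epsilon>] conjI) simp_all
next
  fix A assume A: "graph_property A \<and> degree_expressible A \<and> anti_stochastic A"
  then have gp: "A n \<subseteq> graphs_on n" for n by (simp add: graph_property_def)
  then have dc: "degree_closed n (A n)" for n using degree_closed_iff[of A] A by blast
  obtain f where f: "adversary f" "(\<lambda>n. 1 - pr n (\<lambda>G. f n G \<in> A n)) \<longlonglongrightarrow> 0"
    using A unfolding anti_stochastic_def smallo_one_iff prob_random_graph by blast
  have lim: "(\<lambda>n. pr n (\<lambda>G. f n G \<in> A n)) \<longlonglongrightarrow> 1"
    using tendsto_diff[OF tendsto_const[of 1] f(2)] by simp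
  define p where "p = (\<lambda>n. pr n (\<lambda>G. G \<in> A n))"
  \<comment> \<open>Cut off at 0: the probability may be far above the bound, and the error must
    still tend to 0.\<close>
  define \<epsilon> where "\<epsilon> = (\<lambda>n. max 0 (1 - p n * (real n * ln n)))"
  have "\<epsilon> \<longlonglongrightarrow> 0"
  proof (rule order_tendstoI)
    fix a :: real assume "0 < a"
    then have a2: "0 < a / 2" by simp
    show "\<forall>\<^sub>F n in sequentially. \<epsilon> n < a"
      using flips_lower_bound[OF dc f(1) lim a2] eventually_ge_at_top[of 2]
    proof eventually_elim
      case (elim n)
      have "0 < real n * ln n" using elim(2) by simp
      then have "1 - a / 2 \<le> p n * (real n * ln n)" using elim(1) by (simp add: p_def pos_divide_le_eq)
      then show ?case using \<open>0 < a\<close> by (simp add: \<epsilon>_def)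
    qed
  qed (simp add: \<epsilon>_def less_max_iff_disj)
  moreover have "\<forall>\<^sub>F n in sequentially. (1 - \<epsilon> n) / (real n * ln n) \<le> p n"
    using eventually_ge_at_top[of 2]
  proof eventually_elim
    case (elim n)
    then have "0 < real n * ln n" by simp
    then show ?case by (simp add: \<epsilon>_def pos_divide_le_eq)
  qed
  ultimately have "\<epsilon> \<in> o(\<lambda>_. 1) \<and>
      (\<forall>\<^sub>F n in sequentially. measure_pmf.prob (random_graph n) {G. G \<in> A n} \<ge> (1 - \<epsilon> n) / (real n * ln (real n)))"
    unfolding smallo_one_iff prob_random_graph p_def by simp
  then show "\<exists>\<epsilon> :: nat \<Rightarrow> real. \<epsilon> \<in> o(\<lambda>_. 1) \<and>
               (\<forall>\<^sub>F n in sequentially.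
                  measure_pmf.prob (random_graph n) {G. G \<in> A n}
                    \<ge> (1 - \<epsilon> n) / (real n * ln (real n)))"
    by (rule exI[of _ \<epsilon>])
qed

end
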